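(* Let $c\in\mathbf R\setminus\{0\}$ (dimension $d=1$). (i) If $m\in\mathbf N\setminus\{0,1\}$, $u(x)=e^{icx^m}$ for $x\in\mathbf R$, and $t>\frac1{m-1}$, then $$\mathrm{WF}^{t,t(m-1)}(u)=\{(x,cmx^{m-1})\in\mathbf R^2:\ x\neq0\}.$$ (ii) If $\alpha\in\mathbf R\setminus2\mathbf N$, $\alpha>1$, $u(x)=e^{ic|x|^\alpha}$ for $x\in\mathbf R$, and $t>\frac1{\alpha-1}$, then $$\{0\}\times(\mathbf R\setminus0)\subseteq\mathrm{WF}^{t,t(\alpha-1)}(u)\subseteq\{(x,c\alpha\,\mathrm{sgn}(x)|x|^{\alpha-1})\in\mathbf R^2:\ x\neq0\}\cup\{0\}\times(\mathbf R\setminus0).$$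
   Context: Notation: $\mathbf N=\{0,1,2,\dots\}$, $D^\beta=(-i)^{|\beta|}\partial^\beta$. For $s,t>0$ with $s+t>1$, the (Beurling type) Gelfand--Shilov space $\Sigma_t^s(\mathbf R^d)$ consists of all $f\in C^\infty(\mathbf R^d)$ such that for every $h>0$ $$\|f\|_{\mathcal S_{t,h}^s}=\sup_{\alpha,\beta\in\mathbf N^d,\,x\in\mathbf R^d}\frac{|x^\alpha D^\beta f(x)|}{h^{|\alpha+\beta|}\alpha!^t\beta!^s}<\infty,$$ with the Fréchet topology given by these seminorms (it is nonzero since $s+t>1$). $(\Sigma_t^s)'(\mathbf R^d)$ is its topological dual, which contains $\mathscr S'(\mathbf R^d)$; the action $(u,\varphi)$ is conjugate linear in $\varphi$ and consistent with the $L^2$ inner product. Short-time Fourier transform: with $T_xf(y)=f(y-x)$, $M_\xi f(y)=e^{i\langle y,\xi\rangle}f(y)$, set $V_\psi u(x,\xi)=(2\pi)^{-d/2}(u,M_\xi T_x\psi)$, $x,\xi\in\mathbf R^d$. Wave front set: write $T^*\mathbf R^d\simeq\mathbf R^{2d}$. For $u\in(\Sigma_t^s)'(\mathbf R^d)$ and a fixed $\psi\in\Sigma_t^s(\mathbf R^d)\setminus\{0\}$, $\mathrm{WF}^{t,s}(u)\subseteq T^*\mathbf R^d\setminus 0$ is defined by: $(x_0,\xi_0)\in T^*\mathbf R^d\setminus0$ satisfies $(x_0,\xi_0)\notin\mathrm{WF}^{t,s}(u)$ if there is an open set $U\subseteq T^*\mathbf R^d\setminus0$ containing $(x_0,\xi_0)$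 such that $$\sup_{\lambda>0,\,(x,\xi)\in U}e^{r\lambda}|V_\psi u(\lambda^tx,\lambda^s\xi)|<\infty\quad\forall r>0.$$ The definition does not depend on the choice of $\psi$. Here $d=1$, and $\mathrm{WF}^{t,t(m-1)}$ means $\mathrm{WF}^{t,s}$ with $s=t(m-1)$. *)

theory Defs
  imports "HOL-Probability.Probability"
begin

definition iter_deriv :: "nat \<Rightarrow> (real \<Rightarrow> complex) \<Rightarrow> real \<Rightarrow> complex" where
  "iter_deriv n = (\<lambda>f x. vector_derivative f (at x)) ^^ n"

definition smooth :: "(real \<Rightarrow> complex) \<Rightarrow> bool" where
  "smooth f \<longleftrightarrow> (\<forall>n x. iter_deriv n f differentiable (at x))"

definition D_op :: "nat \<Rightarrow> (real \<Rightarrow> complex) \<Rightarrow> real \<Rightarrow> complex" where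
  "D_op n f x = (- \<i>) ^ n * iter_deriv n f x"

definition gs_quotients :: "real \<Rightarrow> real \<Rightarrow> real \<Rightarrow> (real \<Rightarrow> complex) \<Rightarrow> real set" where
  "gs_quotients t s h f =
     {cmod (complex_of_real (x ^ \<alpha>) * D_op \<beta> f x) /
        (h ^ (\<alpha> + \<beta>) * fact \<alpha> powr t * fact \<beta> powr s) | \<alpha> \<beta> x. True}"

text \<open>The supremum of an unbounded set of reals is a junk value, so this is the seminorm
  only for functions whose quotients are bounded, as they are on the space \<open>\<Sigma>\<close> below.\<close>

definition gs_norm :: "real \<Rightarrow> real \<Rightarrow> real \<Rightarrow> (real \<Rightarrow> complex) \<Rightarrow> real" where
  "gs_norm t s h f = Sup (gs_quotients t s h f)"

text \<open>The Beurling type space \<open>\<Sigma>\<^sub>t\<^sup>s(\<real>)\<close>; the lower index \<open>t\<close> (decay) comes first.\<close>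

definition gelfand_shilov :: "real \<Rightarrow> real \<Rightarrow> (real \<Rightarrow> complex) set" where
  "gelfand_shilov t s = {f. smooth f \<and> (\<forall>h>0. bdd_above (gs_quotients t s h f))}"

text \<open>Continuous conjugate linear functionals on \<open>\<Sigma>\<^sub>t\<^sup>s(\<real>)\<close>. The seminorms increase as
  \<open>h\<close> decreases, so continuity for the Frechet topology is domination by a multiple of a
  single seminorm. Functionals are total functions; their values outside \<open>\<Sigma>\<^sub>t\<^sup>s(\<real>)\<close> are
  irrelevant.\<close>

definition gs_dual :: "real \<Rightarrow> real \<Rightarrow> ((real \<Rightarrow> complex) \<Rightarrow> complex) set" where
  "gs_dual t s = {u.
     (\<forall>\<phi>\<in>gelfand_shilov t s. \<forall>\<psi>\<in>gelfand_shilov t s. u (\<lambda>x. \<phi> x + \<psi> x) = u \<phi> + u \<psi>) \<and>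
     (\<forall>a. \<forall>\<phi>\<in>gelfand_shilov t s. u (\<lambda>x. a * \<phi> x) = cnj a * u \<phi>) \<and>
     (\<exists>h>0. \<exists>C. \<forall>\<phi>\<in>gelfand_shilov t s. cmod (u \<phi>) \<le> C * gs_norm t s h \<phi>)}"

definition functional_of :: "(real \<Rightarrow> complex) \<Rightarrow> (real \<Rightarrow> complex) \<Rightarrow> complex" where
  "functional_of f \<phi> = (LINT x|lborel. f x * cnj (\<phi> x))"

lemma gs_quotients_le_gs_norm:
  assumes "f \<in> gelfand_shilov t s" "h > 0"
  shows "cmod (complex_of_real (x ^ \<alpha>) * D_op \<beta> f x) /
           (h ^ (\<alpha> + \<beta>) * fact \<alpha> powr t * fact \<beta> powr s) \<le> gs_norm t s h f"
  unfolding gs_norm_def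
  by (rule cSup_upper) (use assms in \<open>auto simp: gelfand_shilov_def gs_quotients_def\<close>)

lemma gelfand_shilov_bound:
  assumes "f \<in> gelfand_shilov t s"
  shows "cmod (f x) \<le> gs_norm t s 1 f * (1 + 2 powr t) / (1 + x\<^sup>2)"
proof -
  have "cmod (f x) \<le> gs_norm t s 1 f"
    using gs_quotients_le_gs_norm[OF assms, of 1 x 0 0] by (simp add: D_op_def iter_deriv_def)
  moreover have "x\<^sup>2 * cmod (f x) \<le> gs_norm t s 1 f * 2 powr t"
    using gs_quotients_le_gs_norm[OF assms, of 1 x 2 0]
    by (simp add: D_op_def iter_deriv_def norm_mult norm_power fact_2 divide_simps)
  ultimately have "cmod (f x) * (1 + x\<^sup>2) \<le> gs_norm t s 1 f * (1 + 2 powr t)"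
    by (simp add: algebra_simps)
  moreover have "0 < 1 + x\<^sup>2" by (simp add: add_pos_nonneg)
  ultimately show ?thesis by (simp add: pos_le_divide_eq)
qed

lemma integrable_inverse_one_plus_square: "integrable lborel (\<lambda>x::real. 1 / (1 + x\<^sup>2))"
  using integrable_inverse_1_plus_square
  by (simp add: set_integrable_def einterval_def inverse_eq_divide)

lemma gelfand_shilov_measurable:
  assumes "f \<in> gelfand_shilov t s"
  shows "f \<in> borel_measurable borel"
proof -
  have "iter_deriv 0 f differentiable (at x)" for x
    using assms unfolding gelfand_shilov_def smooth_def by blast
  then have "continuous_on UNIV f"
    by (auto simp: iter_deriv_def intro!: continuous_at_imp_continuous_on
          differentiable_imp_continuous_within)
  then show ?thesis by (rule borel_measurable_continuous_onI)
qed

text \<open>Bounded functions, such as the chirps \<open>exp (\<i> c x\<^sup>m)\<close>, do act on \<open>\<Sigma>\<^sub>t\<^sup>s(\<real>)\<close>.\<close>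

lemma functional_of_in_gs_dual:
  assumes f: "f \<in> borel_measurable borel" and B: "\<And>x. cmod (f x) \<le> B"
  shows "functional_of f \<in> gs_dual t s"
proof -
  have B0: "B \<ge> 0" using B[of 0] norm_ge_zero[of "f 0"] by linarith
  define K where "K = B * (1 + 2 powr t)"
  have le: "cmod (f x * cnj (\<phi> x)) \<le> K * gs_norm t s 1 \<phi> * (1 / (1 + x\<^sup>2))"
    if "\<phi> \<in> gelfand_shilov t s" for \<phi> x
  proof -
    have "cmod (f x) * cmod (\<phi> x) \<le> B * (gs_norm t s 1 \<phi> * (1 + 2 powr t) / (1 + x\<^sup>2))"
      by (intro mult_mono B gelfand_shilov_bound that B0) auto
    then show ?thesis by (simp add: norm_mult K_def algebra_simps add_divide_distrib)
  qed
  have int: "integrable lborel (\<lambda>x. f x * cnj (\<phi> x))" if \<phi>: "\<phi> \<in> gelfand_shilov t s" for \<phi>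
  proof (rule Bochner_Integration.integrable_bound)
    show "integrable lborel (\<lambda>x. K * gs_norm t s 1 \<phi> * (1 / (1 + x\<^sup>2)))"
      by (intro integrable_mult_right integrable_inverse_one_plus_square)
    have "(\<lambda>x. cnj (\<phi> x)) \<in> borel_measurable borel"
      using gelfand_shilov_measurable[OF \<phi>]
      by (rule measurable_compose) (intro borel_measurable_continuous_onI continuous_intros)
    then show "(\<lambda>x. f x * cnj (\<phi> x)) \<in> borel_measurable lborel"
      using f by simp
    show "AE x in lborel. norm (f x * cnj (\<phi> x)) \<le> norm (K * gs_norm t s 1 \<phi> * (1 / (1 + x\<^sup>2)))"
      using le[OF \<phi>] by (intro AE_I2) (smt (verit) real_norm_def)
  qed
  have "cmod (functional_of f \<phi>) \<le> (K * (LINT x|lborel. 1 / (1 + x\<^sup>2))) * gs_norm t s 1 \<phi>"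
    if \<phi>: "\<phi> \<in> gelfand_shilov t s" for \<phi>
  proof -
    have "cmod (functional_of f \<phi>) \<le> (LINT x|lborel. cmod (f x * cnj (\<phi> x)))"
      unfolding functional_of_def by (rule integral_norm_bound)
    also have "\<dots> \<le> (LINT x|lborel. K * gs_norm t s 1 \<phi> * (1 / (1 + x\<^sup>2)))"
      by (intro integral_mono integrable_norm int \<phi> le integrable_mult_right
            integrable_inverse_one_plus_square)
    also have "\<dots> = K * gs_norm t s 1 \<phi> * (LINT x|lborel. 1 / (1 + x\<^sup>2))"
      by (rule integral_mult_right_zero)
    finally show ?thesis by (simp only: mult_ac)
  qed
  then have "\<exists>h>0. \<exists>C. \<forall>\<phi>\<in>gelfand_shilov t s. cmod (functional_of f \<phi>) \<le> C * gs_norm t s h \<phi>"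
    by (intro exI[of _ "1::real"]) auto
  moreover have "functional_of f (\<lambda>x. \<phi> x + \<psi> x) = functional_of f \<phi> + functional_of f \<psi>"
    if "\<phi> \<in> gelfand_shilov t s" "\<psi> \<in> gelfand_shilov t s" for \<phi> \<psi>
    using int[OF that(1)] int[OF that(2)] by (simp add: functional_of_def distrib_left)
  moreover have "functional_of f (\<lambda>x. a * \<phi> x) = cnj a * functional_of f \<phi>"
    if "\<phi> \<in> gelfand_shilov t s" for a \<phi>
    using int[OF that] by (simp add: functional_of_def mult.left_commute)
  ultimately show ?thesis unfolding gs_dual_def by blast
qed

definition translate :: "real \<Rightarrow> (real \<Rightarrow> complex) \<Rightarrow> real \<Rightarrow> complex" where
  "translate x f y = f (y - x)"

definition modulate :: "real \<Rightarrow> (real \<Rightarrow> complex) \<Rightarrow> real \<Rightarrow> complex" where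
  "modulate \<xi> f y = exp (\<i> * complex_of_real (y * \<xi>)) * f y"

definition stft ::
    "(real \<Rightarrow> complex) \<Rightarrow> ((real \<Rightarrow> complex) \<Rightarrow> complex) \<Rightarrow> real \<Rightarrow> real \<Rightarrow> complex" where
  "stft \<psi> u x \<xi> = complex_of_real ((2 * pi) powr (- 1 / 2)) * u (modulate \<xi> (translate x \<psi>))"

text \<open>The window \<open>\<psi>\<close> is an explicit parameter; the definition is meant for \<open>u \<in> gs_dual t s\<close>
  and \<open>\<psi> \<in> gelfand_shilov t s - {\<lambda>_. 0}\<close>, where the set does not depend on \<open>\<psi>\<close>.\<close>

definition wave_front ::
    "(real \<Rightarrow> complex) \<Rightarrow> real \<Rightarrow> real \<Rightarrow> ((real \<Rightarrow> complex) \<Rightarrow> complex) \<Rightarrow> (real \<times> real) set" where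
  "wave_front \<psi> t s u = {p. p \<noteq> (0, 0) \<and>
     \<not> (\<exists>U. open U \<and> U \<subseteq> - {(0, 0)} \<and> p \<in> U \<and>
          (\<forall>r>0. bdd_above {exp (r * \<mu>) * cmod (stft \<psi> u (\<mu> powr t * x) (\<mu> powr s * \<xi>)) | \<mu> x \<xi>.
                              \<mu> > 0 \<and> (x, \<xi>) \<in> U}))}"

end

theory Submission
  imports Defs "HOL-Complex_Analysis.Complex_Analysis"
begin

text \<open>Put \<open>s = t (\<alpha> - 1)\<close>. Substituting \<open>y = \<mu>\<^sup>t w\<close> turns the transform at \<open>(\<mu>\<^sup>t x, \<mu>\<^sup>s \<xi>)\<close> into an
  oscillatory integral with large parameter \<open>\<mu>\<close> to the power \<open>s + t\<close> and phase \<open>P w - \<xi> w\<close>, where \<open>P\<close> is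
  independent of \<open>\<mu>\<close>. Where \<open>P' \<noteq> \<xi>\<close> and \<open>P\<close> is holomorphic, the window is extended off the real
  line by its Taylor polynomial of degree about \<open>\<mu>\<close> and the contour is shifted by a multiple of
  \<open>\<mu>\<close> to the power \<open>1 - s - t\<close>; the Gevrey bounds on the window make all errors \<open>O (exp (- r \<mu>))\<close> for every \<open>r\<close>.

  Conversely, if some point \<open>(x, P' x)\<close> with \<open>x \<noteq> 0\<close> were missing from the wave front set of
  \<open>exp (\<i> c x ^ m)\<close>, then for \<open>X = \<mu>\<^sup>t x\<close> the Fourier transform of \<open>u \<cdot> cnj (\<psi> (\<cdot> - X))\<close> would be
  small in \<open>L\<^sup>1\<close>; but the supremum of this function is that of \<open>\<psi>\<close>.

  For \<open>\<alpha>\<close> not an even integer and \<open>(0, \<xi>)\<close>, rapid decay of the Fourier transform of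
  \<open>(exp (\<i> c \<bar>y\<bar> powr \<alpha>) - 1) g y\<close> on a half line bounds its integral against
  \<open>(\<epsilon> + \<i> y) powr (- \<alpha> - 2)\<close> as \<open>\<epsilon> \<rightarrow> 0\<close>, whereas by scaling that integral is asymptotic to
  \<open>2 \<i> c g 0 cos ((\<alpha> + 1) \<pi> / 2) / ((\<alpha> + 1) \<epsilon>)\<close>. A zero of the window at the origin is avoided by
  translating: for fixed \<open>b\<close> the point \<open>b = \<mu>\<^sup>t (b / \<mu>\<^sup>t)\<close> lies over a neighbourhood of \<open>0\<close> once
  \<open>\<mu>\<close> is large.\<close>

section \<open>Shifting the contour of an almost analytic integrand\<close>

text \<open>With \<open>A k y\<close> the Taylor polynomial of \<open>\<phi> 0\<close> at \<open>y\<close> evaluated at \<open>y + \<omega> k\<close> and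
  \<open>G k y = E (y + \<omega> k) * A k y\<close>, one has
  \<open>\<partial>\<^sub>k G = \<omega> \<partial>\<^sub>y G - \<omega> E \<phi>\<^sub>n\<^sub>+\<^sub>1 (\<omega> k)\<^sup>n / n!\<close>; integrating in \<open>y\<close> leaves only
  the end points and the remainder.\<close>

lemma contour_shift_bound:
  fixes E :: "complex \<Rightarrow> complex" and \<phi> :: "nat \<Rightarrow> real \<Rightarrow> complex"
  assumes hol: "E holomorphic_on S" "open S"
    and inS: "\<And>y k. y \<in> {a..b} \<Longrightarrow> k \<in> {0..K} \<Longrightarrow> of_real y + \<omega> * of_real k \<in> S"
    and \<omega>: "cmod \<omega> = 1" and ab: "a \<le> b" and K: "0 < K"
    and \<phi>: "\<And>j y. (\<phi> j has_vector_derivative \<phi> (Suc j) y) (at y)"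
    and E1: "\<And>y k. y \<in> {a..b} \<Longrightarrow> k \<in> {0..K} \<Longrightarrow> cmod (E (of_real y + \<omega> * of_real k)) \<le> 1"
    and EK: "\<And>y. y \<in> {a..b} \<Longrightarrow> cmod (E (of_real y + \<omega> * of_real K)) \<le> \<eta>"
    and B: "\<And>y. y \<in> {a..b} \<Longrightarrow> (\<Sum>j\<le>n. cmod (\<phi> j y) * K ^ j / fact j) \<le> B"
    and B1: "\<And>y. y \<in> {a, b} \<Longrightarrow> (\<Sum>j\<le>n. cmod (\<phi> j y) * K ^ j / fact j) \<le> B1"
    and B2: "\<And>y. y \<in> {a..b} \<Longrightarrow> cmod (\<phi> (Suc n) y) * K ^ Suc n / fact n \<le> B2"
  shows "cmod (integral {a..b} (\<lambda>y. E (of_real y) * \<phi> 0 y)) \<le> (b - a) * (\<eta> * B + B2) + 2 * K * B1"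
proof -
  define z where "z k y = of_real y + \<omega> * of_real k" for k y :: real
  define A where "A k y = (\<Sum>j\<le>n. \<phi> j y * (\<omega> * of_real k) ^ j / fact j)" for k y
  define A' where "A' k y = (\<Sum>j\<le>n. \<phi> (Suc j) y * (\<omega> * of_real k) ^ j / fact j)" for k y
  define R where "R k y = \<phi> (Suc n) y * (\<omega> * of_real k) ^ n / fact n" for k y
  define Gy where "Gy k y = deriv E (z k y) * A k y + E (z k y) * A' k y" for k y
  define G where "G k y = E (z k y) * A k y" for k y
  have zS: "z k y \<in> S" if "k \<in> {0..K}" "y \<in> {a..b}" for k y
    using inS that by (simp add: z_def)
  have E': "(E has_field_derivative deriv E (z k y)) (at (z k y))" if "k \<in> {0..K}" "y \<in> {a..b}" for k y
    using holomorphic_derivI[OF hol zS[OF that]] .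
  \<comment> \<open>Differentiating in \<open>k\<close> lowers each power by one and pairs it with
    the next derivative of \<open>\<phi>\<close>. This gives \<open>A'\<close> without its top term,
    and that missing term is \<open>R\<close>.\<close>
  have Ak: "((\<lambda>k. A k y) has_vector_derivative \<omega> * (A' k y - R k y)) (at k)" for k y
  proof -
    \<comment> \<open>The induction runs over a complex \<open>k\<close>, where field derivatives
      apply; the result is then restricted to real \<open>k\<close>.\<close>
    have "((\<lambda>k. \<Sum>j\<le>n. \<phi> j y * (\<omega> * k) ^ j / fact j) has_field_derivative
        \<omega> * (\<Sum>j<n. \<phi> (Suc j) y * (\<omega> * k) ^ j / fact j)) (at k)" for n and k :: complex
    proof (induction n)
      case 0 then show ?case by simp
    next
      case (Suc n)
      have "((\<lambda>k. (\<omega> * k) ^ Suc n) has_field_derivative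
          of_nat (Suc n) * (\<omega> * k) ^ n * \<omega>) (at k)"
        by (rule derivative_eq_intros refl | simp)+
      then have "((\<lambda>k. \<phi> (Suc n) y / fact (Suc n) * (\<omega> * k) ^ Suc n) has_field_derivative
          \<phi> (Suc n) y / fact (Suc n) * (of_nat (Suc n) * (\<omega> * k) ^ n * \<omega>)) (at k)"
        by (rule DERIV_cmult)
      moreover have "\<phi> (Suc n) y / fact (Suc n) * (of_nat (Suc n) * (\<omega> * k) ^ n * \<omega>)
          = \<omega> * (\<phi> (Suc n) y * (\<omega> * k) ^ n / fact n)"
        by (simp add: fact_Suc del: of_nat_Suc)
      ultimately have "((\<lambda>k. \<phi> (Suc n) y * (\<omega> * k) ^ Suc n / fact (Suc n)) has_field_derivative
          \<omega> * (\<phi> (Suc n) y * (\<omega> * k) ^ n / fact n)) (at k)"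
        by (simp only: times_divide_eq_left)
      from DERIV_add[OF Suc this] show ?case
        unfolding sum.atMost_Suc sum.lessThan_Suc distrib_left .
    qed
    from has_vector_derivative_real_field[OF this]
    show ?thesis
      by (simp add: A_def A'_def R_def lessThan_Suc_atMost[symmetric])
  qed
  have Ay: "((\<lambda>y. A k y) has_vector_derivative A' k y) (at y)" for k y
    unfolding A_def A'_def
    by (rule has_vector_derivative_sum)
      (use has_vector_derivative_mult_right[OF \<phi>, of "(\<omega> * of_real k) ^ j / fact j" for j] in
        \<open>simp add: mult_ac\<close>)
  have zk: "((\<lambda>k. z k y) has_vector_derivative \<omega>) (at k)" for k y
    unfolding z_def by (rule derivative_eq_intros refl | simp)+
  have zy: "((\<lambda>y. z k y) has_vector_derivative 1) (at y)" for k y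
    unfolding z_def by (rule derivative_eq_intros refl | simp)+
  have Gk: "((\<lambda>k. G k y) has_vector_derivative \<omega> * (Gy k y - E (z k y) * R k y)) (at k within T)"
    if "k \<in> {0..K}" "y \<in> {a..b}" for k y T
  proof -
    have "((\<lambda>k. E (z k y)) has_vector_derivative \<omega> * deriv E (z k y)) (at k)"
      using field_vector_diff_chain_at[OF zk E'[OF that]] by (simp add: o_def)
    from has_vector_derivative_at_within[OF has_vector_derivative_mult[OF this Ak]] show ?thesis
      unfolding G_def Gy_def by (simp add: algebra_simps)
  qed
  have Gy: "((\<lambda>y. G k y) has_vector_derivative Gy k y) (at y within T)"
    if "k \<in> {0..K}" "y \<in> {a..b}" for k y T
  proof -
    have "((\<lambda>y. E (z k y)) has_vector_derivative deriv E (z k y)) (at y)"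
      using field_vector_diff_chain_at[OF zy E'[OF that]] by (simp add: o_def)
    from has_vector_derivative_at_within[OF has_vector_derivative_mult[OF this Ay]] show ?thesis
      unfolding G_def Gy_def by (simp add: algebra_simps)
  qed
  have cont\<phi>: "continuous_on T (\<phi> j)" for j T
    by (meson \<phi> continuous_at_imp_continuous_on has_vector_derivative_continuous)
  have contE: "continuous_on S E" "continuous_on S (deriv E)"
    using hol holomorphic_deriv holomorphic_on_imp_continuous_on by blast+
  have cz: "continuous_on T (\<lambda>p. z (fst p) (snd p))" for T
    unfolding z_def by (intro continuous_intros)
  let ?T = "{0..K} \<times> {a..b}"
  have "continuous_on ?T (\<lambda>p. \<phi> j (snd p))" for j
    by (rule continuous_on_compose2[OF cont\<phi>[of UNIV]]) (auto intro: continuous_intros)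
  note cc = this
  have cE: "continuous_on ?T (\<lambda>p. E (z (fst p) (snd p)))"
    "continuous_on ?T (\<lambda>p. deriv E (z (fst p) (snd p)))"
    by (rule continuous_on_compose2[OF contE(1) cz] continuous_on_compose2[OF contE(2) cz],
        use zS in auto)+
  have cont: "continuous_on ?T (\<lambda>p. G (fst p) (snd p))"
    "continuous_on ?T (\<lambda>p. \<omega> * (Gy (fst p) (snd p) - E (z (fst p) (snd p)) * R (fst p) (snd p)))"
    "continuous_on ?T (\<lambda>p. E (z (fst p) (snd p)) * R (fst p) (snd p))"
    unfolding G_def Gy_def A_def A'_def R_def
    by (intro continuous_intros cE cc; simp)+
  have cslice: "continuous_on {a..b} (\<lambda>y. h k y)"
    if "continuous_on ?T (\<lambda>p. h (fst p) (snd p))" "k \<in> {0..K}" for h :: "real \<Rightarrow> real \<Rightarrow> complex" and k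
  proof -
    have "continuous_on {a..b} (\<lambda>y. (k, y))"
      by (rule continuous_on_Pair[OF continuous_on_const continuous_on_id])
    moreover have "(\<lambda>y. (k, y)) ` {a..b} \<subseteq> ?T"
      using that(2) by auto
    ultimately show ?thesis
      using continuous_on_compose2[OF that(1), of "{a..b}" "\<lambda>y. (k, y)"] by simp
  qed
  have contG: "continuous_on {a..b} (\<lambda>y. G k y)"
    and contER: "continuous_on {a..b} (\<lambda>y. E (z k y) * R k y)" if "k \<in> {0..K}" for k
    by (rule cslice[of "\<lambda>k y. G k y"] cslice[of "\<lambda>k y. E (z k y) * R k y"],
        rule cont, rule that)+
  \<comment> \<open>\<open>F 0\<close> is the integral to be estimated, and \<open>F K\<close> is
    the integral over the shifted contour, where \<open>E\<close> is bounded by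
    \<open>\<eta>\<close>. The difference is controlled by the derivative \<open>F'\<close>.\<close>
  define F where "F k = integral {a..b} (G k)" for k
  define F' where "F' k = \<omega> * (G k b - G k a - integral {a..b} (\<lambda>y. E (z k y) * R k y))" for k
  have dF: "(F has_vector_derivative F' k) (at k within {0..K})" if k: "k \<in> {0..K}" for k
  proof -
    have "(F has_vector_derivative
        integral (cbox a b) (\<lambda>y. \<omega> * (Gy k y - E (z k y) * R k y))) (at k within {0..K})"
      unfolding F_def[abs_def] box_real(2)[symmetric]
      by (rule leibniz_rule_vector_derivative)
        (use Gk integrable_continuous_real[OF contG] cont(2) k in \<open>auto simp: case_prod_unfold\<close>)
    moreover have "integral {a..b} (Gy k) = G k b - G k a" "Gy k integrable_on {a..b}"
      using fundamental_theorem_of_calculus[OF ab Gy[OF k]]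
      by (auto simp: integral_unique has_integral_integrable)
    ultimately show ?thesis
      using integrable_continuous_real[OF contER[OF k]]
      by (simp add: F'_def Henstock_Kurzweil_Integration.integral_diff)
  qed
  have A_le: "cmod (A k y) \<le> (\<Sum>j\<le>n. cmod (\<phi> j y) * K ^ j / fact j)" if "k \<in> {0..K}" for k y
    unfolding A_def
  proof (rule sum_norm_le)
    fix j
    have "k ^ j \<le> K ^ j" using that by (intro power_mono) auto
    then show "cmod (\<phi> j y * (\<omega> * of_real k) ^ j / fact j) \<le> cmod (\<phi> j y) * K ^ j / fact j"
      using that \<omega> by (auto simp: norm_mult norm_divide norm_power intro!: divide_right_mono mult_left_mono)
  qed
  have Gend: "cmod (G k y) \<le> B1" if "k \<in> {0..K}" "y \<in> {a, b}" for k y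
  proof -
    have "cmod (E (z k y)) * cmod (A k y) \<le> 1 * B1"
      using E1[of y k] that ab order_trans[OF A_le[OF that(1)] B1[OF that(2)]]
      by (intro mult_mono) (auto simp: z_def)
    then show ?thesis by (simp add: G_def norm_mult)
  qed
  \<comment> \<open>\<open>B2\<close> bounds a term with \<open>K ^ Suc n\<close>, while
    \<open>R\<close> has only \<open>n\<close> powers of \<open>k\<close>. The quotient by
    \<open>K\<close> disappears again when the bound is integrated over
    \<open>{0..K}\<close>.\<close>
  have ER: "cmod (E (z k y) * R k y) \<le> B2 / K" if k: "k \<in> {0..K}" and y: "y \<in> {a..b}" for k y
  proof -
    have "cmod (R k y) \<le> cmod (\<phi> (Suc n) y) * K ^ n / fact n"
      unfolding R_def norm_mult norm_divide norm_power using k \<omega>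
      by (auto intro!: divide_right_mono mult_left_mono power_mono)
    also have "\<dots> \<le> B2 / K"
      using B2[OF y] K by (simp add: field_simps)
    finally have "cmod (E (z k y)) * cmod (R k y) \<le> 1 * (B2 / K)"
      using E1[OF y k] by (intro mult_mono) (auto simp: z_def)
    then show ?thesis by (simp add: norm_mult)
  qed
  have "norm (F K - F 0) \<le> (2 * B1 + (b - a) * (B2 / K)) * norm (K - 0)"
  proof (rule differentiable_bound[where S="{0..K}" and f'="\<lambda>k h. h *\<^sub>R F' k"])
    fix k assume k: "k \<in> {0..K}"
    show "(F has_derivative (\<lambda>h. h *\<^sub>R F' k)) (at k within {0..K})"
      using dF[OF k] by (simp add: has_vector_derivative_def)
    have "norm (integral {a..b} (\<lambda>y. E (z k y) * R k y)) \<le> B2 / K * (b - a)"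
      using integrable_continuous_real[OF contER[OF k]] ER[OF k] ab
      by (intro integral_bound contER[OF k]) auto
    then have "cmod (G k b - G k a - integral {a..b} (\<lambda>y. E (z k y) * R k y))
        \<le> B1 + B1 + B2 / K * (b - a)"
      using Gend[OF k, of a] Gend[OF k, of b]
      by (intro order_trans[OF norm_triangle_ineq4] add_mono) auto
    then have "norm (F' k) \<le> 2 * B1 + (b - a) * (B2 / K)"
      using \<omega> by (simp add: F'_def norm_mult mult.commute)
    then show "onorm (\<lambda>h. h *\<^sub>R F' k) \<le> 2 * B1 + (b - a) * (B2 / K)"
      by (intro onorm_le) (simp add: mult.commute mult_left_mono)
  qed (use K in auto)
  also have "\<dots> = 2 * K * B1 + (b - a) * B2"
    using K by (simp add: field_simps)
  finally have 1: "norm (F K - F 0) \<le> 2 * K * B1 + (b - a) * B2" .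
  have KK: "K \<in> {0..K}" using K by simp
  have "norm (F K) \<le> \<eta> * B * (b - a)"
    unfolding F_def
  proof (rule integral_bound[OF ab])
    show "continuous_on {a..b} (G K)"
      by (rule contG[OF KK])
    fix y assume y: "y \<in> {a..b}"
    have "cmod (E (z K y)) * cmod (A K y) \<le> \<eta> * B"
      using EK[OF y] order_trans[OF A_le[OF KK] B[OF y]] order_trans[OF norm_ge_zero EK[OF y]]
      by (intro mult_mono) (auto simp: z_def)
    then show "norm (G K y) \<le> \<eta> * B" by (simp add: G_def norm_mult)
  qed
  \<comment> \<open>At \<open>k = 0\<close> only the term \<open>j = 0\<close> of the Taylor
    polynomial survives, because \<open>0 ^ 0 = 1\<close>.\<close>
  moreover have "G 0 = (\<lambda>y. E (of_real y) * \<phi> 0 y)"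
  proof
    fix y
    have "A 0 y = \<phi> 0 y"
      unfolding A_def by (subst sum.remove[of _ 0]) (auto simp: power_0_left)
    then show "G 0 y = E (of_real y) * \<phi> 0 y" by (simp add: G_def z_def)
  qed
  ultimately show ?thesis
    using 1 norm_triangle_sub[of "F 0" "F K"]
    by (simp add: F_def norm_minus_commute algebra_simps)
qed

section \<open>Decay away from the characteristic set\<close>

lemma gelfand_shilov_has_vector_derivative:
  assumes "\<psi> \<in> gelfand_shilov t s"
  shows "(iter_deriv j \<psi> has_vector_derivative iter_deriv (Suc j) \<psi> z) (at z)"
proof -
  have "iter_deriv j \<psi> differentiable (at z)"
    using assms by (auto simp: gelfand_shilov_def smooth_def)
  then show ?thesis
    by (simp add: vector_derivative_works iter_deriv_def)
qed

lemma gelfand_shilov_bounds: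
  assumes "\<psi> \<in> gelfand_shilov t s" "h > 0"
  obtains C where "C > 0"
    "\<And>a j z. \<bar>z\<bar> ^ a * cmod (iter_deriv j \<psi> z) \<le> C * h ^ (a + j) * fact a powr t * fact j powr s"
proof
  \<comment> \<open>The maximum with 1 makes the constant strictly positive, even if the seminorm is
    zero.\<close>
  show "max 1 (gs_norm t s h \<psi>) > 0" by simp
  fix a j z
  have "\<bar>z\<bar> ^ a * cmod (iter_deriv j \<psi> z) / (h ^ (a + j) * fact a powr t * fact j powr s)
      \<le> gs_norm t s h \<psi>"
    using gs_quotients_le_gs_norm[OF assms, of z a j]
    by (simp add: D_op_def norm_mult norm_power)
  also have "\<dots> \<le> max 1 (gs_norm t s h \<psi>)" by simp
  finally show "\<bar>z\<bar> ^ a * cmod (iter_deriv j \<psi> z)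
      \<le> max 1 (gs_norm t s h \<psi>) * h ^ (a + j) * fact a powr t * fact j powr s"
    using \<open>h > 0\<close> by (simp add: pos_divide_le_eq mult.assoc)
qed

section \<open>Gevrey estimates at scale \<open>\<mu>\<close>\<close>

text \<open>Since \<open>fact j \<le> j ^ j\<close> and \<open>j\<close> is at most
  \<open>2 * \<mu>\<close>, the factorial weights are dominated by geometric ones. Taylor degrees
  and decay orders proportional to \<open>\<mu>\<close> are chosen for this purpose.\<close>

lemma fact_powr_le:
  assumes "j \<le> N" "0 < N" "real N \<le> 2 * \<mu>" "p \<ge> 0"
  shows "fact j powr p \<le> ((2 * \<mu>) powr p) ^ j"
proof -
  have "(fact j :: real) \<le> real j ^ j"
    by (metis fact_le_power of_nat_fact of_nat_mono of_nat_power le_refl)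
  also have "\<dots> \<le> (2 * \<mu>) ^ j"
    using assms by (intro power_mono) auto
  finally have "fact j powr p \<le> ((2 * \<mu>) ^ j) powr p"
    using assms by (intro powr_mono2) auto
  also have "\<dots> = ((2 * \<mu>) powr p) ^ j"
  proof -
    have "(x ^ j) powr p = (x powr p) ^ j" if "x > 0" for x :: real
      using that by (simp add: powr_powr powr_realpow[symmetric] mult.commute)
    from this[of "2 * \<mu>"] show ?thesis using assms(2,3) by (simp add: power_mult_distrib)
  qed
  finally show ?thesis .
qed

text \<open>The powers of \<open>\<mu>\<close> cancel: the rescaling factor
  \<open>\<mu> powr t\<close> and the contour height combine to \<open>\<mu> powr (1 - s)\<close>
  per order, and the surplus factorial \<open>fact j powr (s - 1)\<close> is at most
  \<open>(2 * \<mu>) powr (s - 1)\<close> per order. What remains is geometric in \<open>j\<close>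
  with a ratio proportional to \<open>h\<close>.\<close>

lemma gevrey_taylor_term_le:
  fixes D :: real
  assumes D: "0 \<le> D" "D \<le> M * h ^ j * fact j powr s" and M: "0 \<le> M" "0 < h" "0 < \<rho>"
    and s: "s > 1" and N: "j \<le> N" "0 < N" "real N \<le> 2 * \<mu>"
  shows "(\<mu> powr t) ^ j * D * (\<rho> * \<mu> powr (1 - s - t)) ^ j / fact j
       \<le> M * (h * \<rho> * 2 powr (s - 1)) ^ j"
proof -
  have l: "\<mu> > 0" using N by simp
  have "(\<mu> powr t) ^ j * D * (\<rho> * \<mu> powr (1 - s - t)) ^ j / fact j
      \<le> (\<mu> powr t) ^ j * (M * h ^ j * fact j powr s) * (\<rho> * \<mu> powr (1 - s - t)) ^ j / fact j"
    using D M by (intro divide_right_mono mult_right_mono mult_left_mono) auto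
  also have "\<dots> = M * (h * \<rho> * \<mu> powr (1 - s)) ^ j * fact j powr (s - 1)"
  proof -
    have "\<mu> powr t * \<mu> powr (1 - s - t) = \<mu> powr (1 - s)"
      by (simp add: powr_add[symmetric])
    moreover have "fact j powr s = fact j powr (s - 1) * (fact j :: real)"
      by (simp add: powr_diff)
    ultimately show ?thesis
      by (simp add: power_mult_distrib[symmetric] mult_ac)
  qed
  also have "\<dots> \<le> M * (h * \<rho> * \<mu> powr (1 - s)) ^ j * ((2 * \<mu>) powr (s - 1)) ^ j"
    using fact_powr_le[OF N, of "s - 1"] s M by (intro mult_left_mono) auto
  also have "\<dots> = M * (h * \<rho> * (\<mu> powr (1 - s) * (2 * \<mu>) powr (s - 1))) ^ j"
    by (simp add: power_mult_distrib)
  also have "\<mu> powr (1 - s) * (2 * \<mu>) powr (s - 1) = 2 powr (s - 1)"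
    using l by (simp add: powr_mult powr_add[symmetric])
  finally show ?thesis .
qed

text \<open>Use the decay seminorm with weight \<open>\<bar>z\<bar> ^ N\<close>. As
  \<open>\<bar>z\<bar>\<close> is at least \<open>\<epsilon> * \<mu> powr t\<close>, it beats
  \<open>fact N powr t\<close>, and the \<open>N\<close>-th power of a quantity proportional to
  \<open>h\<close> is gained. For small \<open>h\<close> and \<open>N\<close> of order
  \<open>\<mu>\<close> this is exponentially small.\<close>

lemma gelfand_shilov_far_bound:
  assumes C: "\<And>a j z. \<bar>z\<bar> ^ a * cmod (iter_deriv j \<psi> z) \<le> C * h ^ (a + j) * fact a powr t * fact j powr s"
    and "C > 0" "h > 0" "t > 0" "\<epsilon> > 0"
    and N: "0 < N" "real N \<le> 2 * \<mu>" and z: "\<epsilon> * \<mu> powr t \<le> \<bar>z\<bar>"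
  shows "cmod (iter_deriv j \<psi> z) \<le> C * (h * 2 powr t / \<epsilon>) ^ N * h ^ j * fact j powr s"
proof -
  have l: "\<mu> > 0" using N by simp
  have "(\<epsilon> * \<mu> powr t) ^ N * cmod (iter_deriv j \<psi> z) \<le> \<bar>z\<bar> ^ N * cmod (iter_deriv j \<psi> z)"
    using z \<open>\<epsilon> > 0\<close> by (intro mult_right_mono power_mono) auto
  also have "\<dots> \<le> C * h ^ (N + j) * fact N powr t * fact j powr s" by (rule C)
  also have "\<dots> \<le> C * h ^ (N + j) * ((2 * \<mu>) powr t) ^ N * fact j powr s"
    using fact_powr_le[of N N \<mu> t] N assms by (intro mult_right_mono mult_left_mono) auto
  also have "\<dots> = (\<epsilon> * \<mu> powr t) ^ N * (C * (h * 2 powr t / \<epsilon>) ^ N * h ^ j * fact j powr s)"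
    using \<open>\<epsilon> > 0\<close> l by (simp add: powr_mult power_add power_mult_distrib power_divide)
  finally show ?thesis
    using \<open>\<epsilon> > 0\<close> l by (simp add: mult_le_cancel_left_pos)
qed

text \<open>Two more powers of \<open>z\<close> are kept on the left to make the tail integrable.
  They cost \<open>fact (N + 2)\<close> in place of \<open>fact N\<close>, hence the base 6 instead
  of 2.\<close>

lemma gelfand_shilov_tail_bound:
  assumes C: "\<And>a j z. \<bar>z\<bar> ^ a * cmod (iter_deriv j \<psi> z) \<le> C * h ^ (a + j) * fact a powr t * fact j powr s"
    and "C > 0" "h > 0" "t > 0" "\<epsilon> > 0"
    and N: "0 < N" "real N \<le> 2 * \<mu>" and z: "\<epsilon> * \<mu> powr t \<le> \<bar>z\<bar>"
  shows "z\<^sup>2 * cmod (\<psi> z) \<le> C * h\<^sup>2 * 2 powr t * (h * 6 powr t / \<epsilon>) ^ N"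
proof -
  have l: "\<mu> > 0" using N by simp
  have "fact (N + 2) \<le> (2 * 3 ^ N * fact N :: real)"
  proof -
    have "(N + 1) * (N + 2) \<le> 2 * 3 ^ N"
      by (induction N) (auto simp: algebra_simps)
    then have "real ((N + 1) * (N + 2)) * fact N \<le> real (2 * 3 ^ N) * fact N"
      by (intro mult_right_mono of_nat_mono) auto
    then show ?thesis by (simp add: algebra_simps)
  qed
  then have "fact (N + 2) powr t \<le> (2 * 3 ^ N * fact N) powr t"
    using \<open>t > 0\<close> by (intro powr_mono2) auto
  also have "\<dots> = 2 powr t * (3 powr t) ^ N * fact N powr t"
    by (simp add: powr_mult powr_realpow[symmetric] powr_powr mult.commute)
  also have "\<dots> \<le> 2 powr t * (3 powr t) ^ N * ((2 * \<mu>) powr t) ^ N"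
    using fact_powr_le[of N N \<mu> t] N assms by (intro mult_left_mono) auto
  finally have F: "fact (N + 2) powr t \<le> 2 powr t * (3 powr t) ^ N * ((2 * \<mu>) powr t) ^ N" .
  have "(\<epsilon> * \<mu> powr t) ^ N * (z\<^sup>2 * cmod (\<psi> z)) \<le> \<bar>z\<bar> ^ N * (z\<^sup>2 * cmod (\<psi> z))"
    using z \<open>\<epsilon> > 0\<close> by (intro mult_right_mono power_mono) auto
  also have "\<dots> = \<bar>z\<bar> ^ (N + 2) * cmod (iter_deriv 0 \<psi> z)"
    by (simp add: iter_deriv_def power_add mult_ac power2_eq_square)
  also have "\<dots> \<le> C * h ^ (N + 2) * fact (N + 2) powr t"
    using C[of z "N + 2" 0] by simp
  also have "\<dots> \<le> C * h ^ (N + 2) * (2 powr t * (3 powr t) ^ N * ((2 * \<mu>) powr t) ^ N)"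
    using F assms by (intro mult_left_mono) auto
  also have "\<dots> = (\<epsilon> * \<mu> powr t) ^ N * (C * h\<^sup>2 * 2 powr t * (h * 6 powr t / \<epsilon>) ^ N)"
  proof -
    have "(6::real) powr t = 3 powr t * 2 powr t" by (simp add: powr_mult[symmetric])
    then show ?thesis
      using \<open>\<epsilon> > 0\<close> l by (simp add: powr_mult power_add power_mult_distrib power_divide power2_eq_square)
  qed
  finally show ?thesis
    using \<open>\<epsilon> > 0\<close> l by (simp add: mult_le_cancel_left_pos)
qed

text \<open>Subtract from \<open>P\<close> the linear function with slope \<open>\<xi> + d\<close>,
  where \<open>d = p0 - \<xi>0\<close>. A quarter of \<open>\<bar>d\<bar>\<close> is allowed for the
  variation of \<open>P'\<close> and a quarter for that of \<open>\<xi>\<close>, so the rest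
  \<open>Q\<close> has a derivative of size at most \<open>\<bar>d\<bar> / 2\<close>. As
  \<open>Q\<close> is real on the axis, moving by \<open>k\<close> in the direction
  \<open>sgn d\<close> changes the imaginary part of the phase by \<open>\<bar>d\<bar> * k\<close>
  up to half of that amount.\<close>

lemma phase_decay_off_axis:
  fixes P :: "complex \<Rightarrow> complex" and \<xi> \<xi>0 :: real
  assumes P: "\<And>z. z \<in> cball (of_real x0) (3 * \<epsilon>) \<Longrightarrow> (P has_field_derivative P' z) (at z)"
    and near: "\<And>z. z \<in> cball (of_real x0) (3 * \<epsilon>) \<Longrightarrow> cmod (P' z - of_real p0) \<le> \<bar>p0 - \<xi>0\<bar> / 4"
    and real: "\<And>w::real. \<bar>w - x0\<bar> \<le> 3 * \<epsilon> \<Longrightarrow> P (of_real w) \<in> \<real>"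
    and \<xi>: "\<bar>\<xi> - \<xi>0\<bar> \<le> \<bar>p0 - \<xi>0\<bar> / 4"
    and y: "\<bar>y - x0\<bar> \<le> 2 * \<epsilon>" and k: "0 \<le> k" "k \<le> \<epsilon>" and L: "0 \<le> \<Lambda>"
  shows "cmod (exp (\<i> * of_real \<Lambda> * (P (of_real y + \<i> * of_real (sgn (p0 - \<xi>0)) * of_real k)
            - of_real \<xi> * (of_real y + \<i> * of_real (sgn (p0 - \<xi>0)) * of_real k))))
         \<le> exp (- (\<Lambda> * k * \<bar>p0 - \<xi>0\<bar> / 2))"
proof -
  define d where "d = p0 - \<xi>0"
  define z where "z = of_real y + \<i> * of_real (sgn d) * of_real k"
  define Q where "Q w = P w - of_real \<xi> * w - of_real d * w" for w
  have zy: "cmod (z - of_real y) \<le> k"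
    using k by (simp add: z_def norm_mult sgn_if)
  have yx: "cmod (of_real y - of_real x0) = \<bar>y - x0\<bar>"
    by (metis norm_of_real of_real_diff)
  have yin: "of_real y \<in> cball (of_real x0 :: complex) (3 * \<epsilon>)"
    using y k yx by (simp add: dist_norm norm_minus_commute)
  have "cmod (z - of_real x0) \<le> cmod (z - of_real y) + cmod (of_real y - of_real x0)"
    using norm_triangle_ineq[of "z - of_real y" "of_real y - of_real x0"] by simp
  then have zin: "z \<in> cball (of_real x0) (3 * \<epsilon>)"
    using zy yx y k by (simp add: dist_norm norm_minus_commute)
  have "cmod (Q z - Q (of_real y)) \<le> \<bar>d\<bar> / 2 * cmod (z - of_real y)"
  proof (rule field_differentiable_bound[OF convex_cball _ _ zin yin])
    fix w :: complex assume w: "w \<in> cball (of_real x0) (3 * \<epsilon>)"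
    show "(Q has_field_derivative P' w - of_real \<xi> - of_real d) (at w within cball (of_real x0) (3 * \<epsilon>))"
      unfolding Q_def
      by (rule has_field_derivative_at_within) (rule derivative_eq_intros P[OF w] refl | simp)+
    have "P' w - of_real \<xi> - of_real d = (P' w - of_real p0) - of_real (\<xi> - \<xi>0)"
      by (simp add: d_def)
    also have "cmod \<dots> \<le> cmod (P' w - of_real p0) + \<bar>\<xi> - \<xi>0\<bar>"
      by (metis norm_triangle_ineq4 norm_of_real real_norm_def)
    finally show "cmod (P' w - of_real \<xi> - of_real d) \<le> \<bar>d\<bar> / 2"
      using near[OF w] \<xi> by (simp add: d_def)
  qed
  also have "\<dots> \<le> \<bar>d\<bar> / 2 * k" using zy by (intro mult_left_mono) auto
  finally have "\<bar>Im (Q z - Q (of_real y))\<bar> \<le> \<bar>d\<bar> / 2 * k"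
    by (rule order_trans[OF abs_Im_le_cmod])
  moreover have "Im (Q (of_real y)) = 0"
    using real[of y] y k by (auto simp: Q_def complex_is_Real_iff)
  then have "Im (Q z - Q (of_real y)) = Im (P z - of_real \<xi> * z) - \<bar>d\<bar> * k"
    by (simp add: Q_def z_def abs_sgn mult.assoc)
  ultimately have "\<bar>Im (P z - of_real \<xi> * z) - \<bar>d\<bar> * k\<bar> \<le> \<bar>d\<bar> * k / 2"
    by simp
  moreover have "B / 2 \<le> A" if "\<bar>A - B\<bar> \<le> B / 2" for A B :: real
    using that by linarith
  ultimately have "Im (P z - of_real \<xi> * z) \<ge> \<bar>d\<bar> * k / 2" by blast
  then have "\<Lambda> * (\<bar>d\<bar> * k / 2) \<le> \<Lambda> * Im (P z - of_real \<xi> * z)"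
    using L by (rule mult_left_mono)
  then show ?thesis
    unfolding d_def[symmetric] z_def[symmetric] by (simp add: mult_ac)
qed

lemma nat_between_double:
  fixes \<mu> :: real
  assumes "\<mu> \<ge> 1"
  obtains n where "\<mu> \<le> real (Suc n)" "real (Suc n) \<le> 2 * \<mu>"
proof
  show "\<mu> \<le> real (Suc (nat \<lfloor>\<mu>\<rfloor>))" "real (Suc (nat \<lfloor>\<mu>\<rfloor>)) \<le> 2 * \<mu>"
    using assms by linarith+
qed

lemma exp_power_le:
  assumes "\<mu> \<le> real N" "0 \<le> \<theta>" "\<theta> \<le> exp (- b)" "b \<ge> 0"
  shows "\<theta> ^ N \<le> exp (- (b * \<mu>))"
proof -
  have "\<theta> ^ N \<le> exp (- b) ^ N" using assms by (intro power_mono) auto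
  also have "\<dots> = exp (- (b * real N))" by (simp add: exp_of_nat_mult[symmetric] mult.commute)
  also have "\<dots> \<le> exp (- (b * \<mu>))" using assms by (simp add: mult_left_mono)
  finally show ?thesis .
qed

text \<open>The contour is raised by a multiple of \<open>\<mu> powr (1 - s - t)\<close>. Multiplied
  by the large parameter \<open>\<mu> powr (s + t)\<close> this is proportional to
  \<open>\<mu>\<close>, so any rate \<open>r\<close> can be reached by adjusting the multiple and
  taking the seminorm parameter \<open>h\<close> small. The Beurling condition supplies a bound for
  every such \<open>h\<close>.\<close>

lemma local_oscillatory_bound:
  fixes P P' :: "complex \<Rightarrow> complex" and \<xi>0 p0 x0 :: real
  assumes \<psi>: "\<psi> \<in> gelfand_shilov t s" and t: "t > 0" and s: "s > 1" and \<epsilon>: "\<epsilon> > 0"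
    and S: "open S" "cball (of_real x0) (3 * \<epsilon>) \<subseteq> S" "P holomorphic_on S"
    and P: "\<And>z. z \<in> cball (of_real x0) (3 * \<epsilon>) \<Longrightarrow> (P has_field_derivative P' z) (at z)"
    and near: "\<And>z. z \<in> cball (of_real x0) (3 * \<epsilon>) \<Longrightarrow> cmod (P' z - of_real p0) \<le> \<bar>p0 - \<xi>0\<bar> / 4"
    and real: "\<And>w::real. \<bar>w - x0\<bar> \<le> 3 * \<epsilon> \<Longrightarrow> P (of_real w) \<in> \<real>"
    and p0: "p0 \<noteq> \<xi>0" and r: "r \<ge> 0"
  shows "\<exists>\<mu>0 C. \<mu>0 \<ge> 1 \<and> (\<forall>\<mu> x \<xi>. \<mu> \<ge> \<mu>0 \<longrightarrow> \<bar>x - x0\<bar> \<le> \<epsilon> \<longrightarrow> \<bar>\<xi> - \<xi>0\<bar> \<le> \<bar>p0 - \<xi>0\<bar> / 4 \<longrightarrow>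
       cmod (integral {x - \<epsilon>..x + \<epsilon>} (\<lambda>w. exp (\<i> * of_real (\<mu> powr (s + t)) * (P (of_real w) - of_real \<xi> * of_real w))
           * cnj (\<psi> (\<mu> powr t * (w - x))))) \<le> C * exp (- (r * \<mu>)))"
proof -
  define d where "d = p0 - \<xi>0"
  define \<omega> where "\<omega> = \<i> * of_real (sgn d)"
  \<comment> \<open>With this factor the exponent on the raised contour is \<open>\<rho> * \<mu> *
    \<bar>d\<bar> / 2 = r * \<mu> + \<mu> * \<bar>d\<bar> / 2\<close>.\<close>
  define \<rho> where "\<rho> = 2 * r / \<bar>d\<bar> + 1"
  define q where "q = exp (- (r + 1))"
  \<comment> \<open>Three demands fix \<open>h\<close>: the Taylor ratio \<open>\<theta>\<close> is
    at most \<open>1 / 2\<close>, so that geometric sums are at most 2; \<open>\<theta>\<close> is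
    at most \<open>q\<close>; and the decay ratio \<open>h * 2 powr t / \<epsilon>\<close> at the
    end points is at most \<open>q\<close>. The extra 1 in \<open>q = exp (- (r + 1))\<close> pays
    for a factor \<open>n + 1\<close> in the Taylor remainder.\<close>
  define h where "h = min (min 1 q) (1 / 2) * min (\<epsilon> / 2 powr t) (1 / (\<rho> * 2 powr (s - 1)))"
  define \<theta> where "\<theta> = h * \<rho> * 2 powr (s - 1)"
  have d: "\<bar>d\<bar> > 0" using p0 by (simp add: d_def)
  have \<rho>: "\<rho> > 0" using r d by (simp add: \<rho>_def add_nonneg_pos)
  have h: "h > 0" using \<epsilon> \<rho> by (simp add: h_def q_def)
  have \<theta>: "0 \<le> \<theta>" "\<theta> \<le> 1 / 2" "\<theta> \<le> q"
  proof -
    have "h \<le> min (min 1 q) (1 / 2) * (1 / (\<rho> * 2 powr (s - 1)))"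
      unfolding h_def using \<rho> \<epsilon> by (intro mult_left_mono) (auto simp: q_def)
    then have "\<theta> \<le> min (min 1 q) (1 / 2)"
      using \<rho> by (simp add: \<theta>_def pos_le_divide_eq mult.assoc del: min_less_iff_conj)
    then show "\<theta> \<le> 1 / 2" "\<theta> \<le> q" by auto
    show "0 \<le> \<theta>" using h \<rho> by (simp add: \<theta>_def)
  qed
  have hq: "h * 2 powr t / \<epsilon> \<le> q"
  proof -
    have "h \<le> min (min 1 q) (1 / 2) * (\<epsilon> / 2 powr t)"
      unfolding h_def using \<rho> \<epsilon> by (intro mult_left_mono) (auto simp: q_def)
    also have "\<dots> \<le> q * (\<epsilon> / 2 powr t)"
      using \<epsilon> by (intro mult_right_mono) (auto simp: q_def)
    finally show ?thesis using \<epsilon> by (simp add: field_simps)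
  qed
  obtain C where C: "C > 0"
    "\<And>a j z. \<bar>z\<bar> ^ a * cmod (iter_deriv j \<psi> z) \<le> C * h ^ (a + j) * fact a powr t * fact j powr s"
    using gelfand_shilov_bounds[OF \<psi> h] by blast
  \<comment> \<open>The exponent is negative, so for large \<open>\<mu>\<close> the raised contour
    stays in the disc where the phase is controlled.\<close>
  have "((\<lambda>\<mu>. \<rho> * \<mu> powr (1 - s - t)) \<longlongrightarrow> \<rho> * 0) at_top"
    using s t by (intro tendsto_mult tendsto_const tendsto_neg_powr filterlim_ident) auto
  then have "eventually (\<lambda>\<mu>. \<rho> * \<mu> powr (1 - s - t) < \<epsilon>) at_top"
    using \<epsilon> by (auto dest: order_tendstoD(2))
  then obtain \<mu>1 where \<mu>1: "\<And>\<mu>. \<mu> \<ge> \<mu>1 \<Longrightarrow> \<rho> * \<mu> powr (1 - s - t) < \<epsilon>"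
    by (auto simp: eventually_at_top_linorder)
  show ?thesis
  proof (rule exI[of _ "max 1 \<mu>1"], rule exI[of _ "10 * \<epsilon> * C"], intro conjI allI impI)
    fix \<mu> x \<xi> :: real
    assume \<mu>: "\<mu> \<ge> max 1 \<mu>1" and x: "\<bar>x - x0\<bar> \<le> \<epsilon>" and \<xi>: "\<bar>\<xi> - \<xi>0\<bar> \<le> \<bar>p0 - \<xi>0\<bar> / 4"
    define \<Lambda> where "\<Lambda> = \<mu> powr (s + t)"
    define K where "K = \<rho> * \<mu> powr (1 - s - t)"
    define E where "E z = exp (\<i> * of_real \<Lambda> * (P z - of_real \<xi> * z))" for z
    \<comment> \<open>The \<open>j\<close>-th derivative in \<open>w\<close> of the rescaled and
      conjugated window.\<close>
    define \<phi> where "\<phi> j w = of_real ((\<mu> powr t) ^ j) * cnj (iter_deriv j \<psi> (\<mu> powr t * (w - x)))" for j w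
    have K: "0 < K" "K \<le> \<epsilon>" using \<mu>1[of \<mu>] \<mu> \<rho> by (auto simp: K_def)
    obtain n where n: "\<mu> \<le> real (Suc n)" "real (Suc n) \<le> 2 * \<mu>"
      using nat_between_double[of \<mu>] \<mu> by auto
    have cm\<phi>: "cmod (\<phi> j w) = (\<mu> powr t) ^ j * cmod (iter_deriv j \<psi> (\<mu> powr t * (w - x)))" for j w
      by (simp add: \<phi>_def norm_mult norm_power)
    have near_term: "cmod (\<phi> j w) * K ^ j / fact j \<le> C * \<theta> ^ j" if "j \<le> Suc n" for j w
      unfolding cm\<phi> K_def \<theta>_def using C(1) C(2)[of "\<mu> powr t * (w - x)" 0 j] h \<rho> s n that
      by (intro gevrey_taylor_term_le[where N="Suc n"]) auto
    \<comment> \<open>At the end points the argument of the window has modulus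
      \<open>\<epsilon> * \<mu> powr t\<close>, so every Taylor coefficient carries an additional
      exponentially small factor.\<close>
    have far: "cmod (\<phi> j w) * K ^ j / fact j \<le> C * (h * 2 powr t / \<epsilon>) ^ Suc n * \<theta> ^ j"
      if "j \<le> Suc n" "w \<in> {x - \<epsilon>, x + \<epsilon>}" for j w
      unfolding cm\<phi> K_def \<theta>_def
    proof (rule gevrey_taylor_term_le[where N="Suc n"])
      show "cmod (iter_deriv j \<psi> (\<mu> powr t * (w - x)))
          \<le> C * (h * 2 powr t / \<epsilon>) ^ Suc n * h ^ j * fact j powr s"
        by (rule gelfand_shilov_far_bound[where \<mu>=\<mu>]) (use C h t \<epsilon> n that in \<open>auto simp: abs_mult\<close>)
    qed (use C h \<rho> s n that \<epsilon> in auto)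
    have geo: "(\<Sum>j\<le>n. M * \<theta> ^ j) \<le> 2 * M" if "M \<ge> 0" for M :: real
    proof -
      have "(\<Sum>j\<le>n. \<theta> ^ j) \<le> (\<Sum>j\<le>n. (1 / 2) ^ j)"
        using \<theta> by (intro sum_mono power_mono) auto
      also have "\<dots> \<le> 2" by (subst sum_gp0) (simp add: field_simps)
      finally have "M * (\<Sum>j\<le>n. \<theta> ^ j) \<le> M * 2" using that by (rule mult_left_mono)
      then show ?thesis by (simp add: sum_distrib_left)
    qed
    have "cmod (integral {x - \<epsilon>..x + \<epsilon>} (\<lambda>w. E (of_real w) * \<phi> 0 w))
       \<le> ((x + \<epsilon>) - (x - \<epsilon>)) * (exp (- (r * \<mu>)) * (2 * C) + C * exp (- (r * \<mu>)))
          + 2 * K * (2 * (C * exp (- (r * \<mu>))))"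
    proof (rule contour_shift_bound[where \<omega>=\<omega> and S=S and n=n])
      show "E holomorphic_on S" unfolding E_def by (intro holomorphic_intros S)
      show "open S" by (rule S)
      show "cmod \<omega> = 1" using d by (simp add: \<omega>_def norm_mult sgn_if)
      show "x - \<epsilon> \<le> x + \<epsilon>" using \<epsilon> by simp
      show "0 < K" by (rule K)
      show "(\<phi> j has_vector_derivative \<phi> (Suc j) w) (at w)" for j w
      proof -
        have "((\<lambda>w. \<mu> powr t * (w - x)) has_real_derivative \<mu> powr t) (at w)"
          by (auto intro!: derivative_eq_intros)
        from vector_diff_chain_at[OF this[unfolded has_real_derivative_iff_has_vector_derivative]
            gelfand_shilov_has_vector_derivative[OF \<psi>, of j]]
        have "((\<lambda>w. iter_deriv j \<psi> (\<mu> powr t * (w - x))) has_vector_derivative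
            \<mu> powr t *\<^sub>R iter_deriv (Suc j) \<psi> (\<mu> powr t * (w - x))) (at w)"
          by (simp add: o_def)
        from has_vector_derivative_mult_right[OF has_vector_derivative_cnj[OF this], of "of_real ((\<mu> powr t) ^ j)"]
        show ?thesis unfolding \<phi>_def by (simp add: scaleR_conv_of_real mult_ac)
      qed
      have Ebound: "cmod (E (of_real y + \<omega> * of_real k)) \<le> exp (- (\<Lambda> * k * \<bar>d\<bar> / 2))"
        if "y \<in> {x - \<epsilon>..x + \<epsilon>}" "k \<in> {0..K}" for y k
        unfolding E_def \<omega>_def d_def
        by (rule phase_decay_off_axis[where P'=P' and \<epsilon>=\<epsilon> and ?x0.0=x0])
          (use P near real \<xi> that x K in \<open>auto simp: \<Lambda>_def abs_le_iff\<close>)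
      show "cmod (E (of_real y + \<omega> * of_real k)) \<le> 1"
        if "y \<in> {x - \<epsilon>..x + \<epsilon>}" "k \<in> {0..K}" for y k
      proof -
        have "0 \<le> \<Lambda> * k * \<bar>d\<bar> / 2" using that by (simp add: \<Lambda>_def)
        then show ?thesis using order_trans[OF Ebound[OF that]] by simp
      qed
      show "cmod (E (of_real y + \<omega> * of_real K)) \<le> exp (- (r * \<mu>))"
        if "y \<in> {x - \<epsilon>..x + \<epsilon>}" for y
      proof (rule order_trans[OF Ebound[OF that]])
        have "\<Lambda> * K = \<rho> * \<mu>"
          using \<mu> by (simp add: \<Lambda>_def K_def powr_add[symmetric])
        then have "\<Lambda> * K * \<bar>d\<bar> / 2 = r * \<mu> + \<mu> * \<bar>d\<bar> / 2"
          using d by (simp add: \<rho>_def field_simps)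
        then show "exp (- (\<Lambda> * K * \<bar>d\<bar> / 2)) \<le> exp (- (r * \<mu>))"
          using \<mu> by simp
      qed (use K in auto)
      show "of_real y + \<omega> * of_real k \<in> S" if "y \<in> {x - \<epsilon>..x + \<epsilon>}" "k \<in> {0..K}" for y k
      proof -
        have "cmod (of_real x0 - (of_real y + \<omega> * of_real k)) \<le> cmod (of_real (x0 - y)) + cmod (\<omega> * of_real k)"
          using norm_triangle_ineq4[of "of_real (x0 - y)" "\<omega> * of_real k"] by (simp add: algebra_simps)
        also have "\<dots> \<le> \<bar>x0 - y\<bar> + k"
          using that d by (simp add: \<omega>_def norm_mult sgn_if del: of_real_diff)
        also have "\<dots> \<le> 3 * \<epsilon>" using that x K by auto
        finally show ?thesis using S(2) by (auto simp: dist_norm)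
      qed
      show "(\<Sum>j\<le>n. cmod (\<phi> j y) * K ^ j / fact j) \<le> 2 * C" for y
        by (rule order_trans[OF sum_mono geo]) (use near_term C(1) in auto)
      show "(\<Sum>j\<le>n. cmod (\<phi> j y) * K ^ j / fact j) \<le> 2 * (C * exp (- (r * \<mu>)))"
        if "y \<in> {x - \<epsilon>, x + \<epsilon>}" for y
      proof (rule order_trans[OF sum_mono geo])
        have "h * 2 powr t / \<epsilon> \<le> exp (- r)"
          by (rule order_trans[OF hq]) (simp add: q_def)
        then have "(h * 2 powr t / \<epsilon>) ^ Suc n \<le> exp (- (r * \<mu>))"
          using h \<epsilon> by (intro exp_power_le n r) auto
        then have *: "C * (h * 2 powr t / \<epsilon>) ^ Suc n * \<theta> ^ j \<le> C * exp (- (r * \<mu>)) * \<theta> ^ j" for j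
          using C(1) \<theta> by (intro mult_right_mono mult_left_mono) auto
        show "cmod (\<phi> j y) * K ^ j / fact j \<le> C * exp (- (r * \<mu>)) * \<theta> ^ j"
          if "j \<in> {..n}" for j
          using order_trans[OF far[of j y] *] that \<open>y \<in> {x - \<epsilon>, x + \<epsilon>}\<close> by simp
      qed (use C in auto)
      \<comment> \<open>The remainder has \<open>fact n\<close> where a Taylor term has
        \<open>fact (Suc n)\<close>. The lost factor \<open>Suc n\<close> is bounded by
        \<open>exp (Suc n)\<close> and absorbed into the ratio by means of
        \<open>exp 1 * q = exp (- r)\<close>.\<close>
      show "cmod (\<phi> (Suc n) y) * K ^ Suc n / fact n \<le> C * exp (- (r * \<mu>))" for y
      proof -
        have "cmod (\<phi> (Suc n) y) * K ^ Suc n / fact n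
            = real (Suc n) * (cmod (\<phi> (Suc n) y) * K ^ Suc n / fact (Suc n))"
          by (simp add: fact_Suc del: of_nat_Suc power_Suc)
        also have "\<dots> \<le> real (Suc n) * (C * \<theta> ^ Suc n)"
          by (intro mult_left_mono near_term) auto
        also have "\<dots> \<le> exp (real (Suc n)) * (C * \<theta> ^ Suc n)"
          using C(1) \<theta> exp_ge_add_one_self[of "real (Suc n)"]
          by (intro mult_right_mono) auto
        also have "\<dots> = C * (exp 1 * \<theta>) ^ Suc n"
          by (simp add: power_mult_distrib exp_of_nat_mult[symmetric] del: power_Suc of_nat_Suc)
        also have "\<dots> \<le> C * exp (- (r * \<mu>))"
        proof (intro mult_left_mono exp_power_le n)
          have "exp 1 * \<theta> \<le> exp 1 * q" using \<theta> by (intro mult_left_mono) auto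
          also have "\<dots> = exp (- r)" by (simp add: q_def exp_add[symmetric])
          finally show "exp 1 * \<theta> \<le> exp (- r)" .
        qed (use C(1) \<theta> r in auto)
        finally show ?thesis .
      qed
    qed
    also have "\<dots> \<le> ((x + \<epsilon>) - (x - \<epsilon>)) * (exp (- (r * \<mu>)) * (2 * C) + C * exp (- (r * \<mu>)))
          + 2 * \<epsilon> * (2 * (C * exp (- (r * \<mu>))))"
      using K C(1) by (intro add_left_mono mult_right_mono) auto
    \<comment> \<open>An interval of length \<open>2 * \<epsilon>\<close> with bound
      \<open>3 * C\<close>, and the two end points with \<open>4 * \<epsilon> * C\<close> in
      all.\<close>
    also have "\<dots> = 10 * \<epsilon> * C * exp (- (r * \<mu>))" by (simp add: algebra_simps)
    finally show "cmod (integral {x - \<epsilon>..x + \<epsilon>} (\<lambda>w. exp (\<i> * of_real (\<mu> powr (s + t)) * (P (of_real w) - of_real \<xi> * of_real w))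
           * cnj (\<psi> (\<mu> powr t * (w - x))))) \<le> 10 * \<epsilon> * C * exp (- (r * \<mu>))"
      by (simp add: E_def \<Lambda>_def \<phi>_def iter_deriv_def)
  qed simp
qed

section \<open>The short-time Fourier transform near noncharacteristic points\<close>

lemma stft_functional_of:
  "stft \<psi> (functional_of u) x \<xi> = of_real ((2 * pi) powr (- 1 / 2)) *
     (LINT y|lborel. u y * cnj (\<psi> (y - x)) * exp (- \<i> * of_real (y * \<xi>)))"
  by (simp add: stft_def functional_of_def modulate_def translate_def exp_cnj mult_ac)

lemma norm_stft_functional_of_le:
  "cmod (stft \<psi> (functional_of u) x \<xi>) \<le>
     cmod (LINT y|lborel. u y * cnj (\<psi> (y - x)) * exp (- \<i> * of_real (y * \<xi>)))"
    (is "_ \<le> cmod ?I")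
proof -
  have "(2 * pi) powr (- 1 / 2) \<le> 1"
    using pi_ge_two by (simp add: powr_minus_divide powr_half_sqrt)
  then have "(2 * pi) powr (- 1 / 2) * cmod ?I \<le> 1 * cmod ?I"
    by (intro mult_right_mono) auto
  then show ?thesis by (simp add: stft_functional_of norm_mult)
qed

lemma gelfand_shilov_tail:
  assumes \<psi>: "\<psi> \<in> gelfand_shilov t s" and t: "t > 0" and \<epsilon>: "\<epsilon> > 0" and r: "r \<ge> 0"
  shows "\<exists>M\<ge>0. \<forall>\<mu> z. \<mu> \<ge> 1 \<longrightarrow> \<epsilon> * \<mu> powr t \<le> \<bar>z\<bar> \<longrightarrow> z\<^sup>2 * cmod (\<psi> z) \<le> M * exp (- (r * \<mu>))"
proof -
  \<comment> \<open>Chosen so that the ratio \<open>h * 6 powr t / \<epsilon>\<close> is exactly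
    \<open>exp (- r)\<close>.\<close>
  define h where "h = \<epsilon> * exp (- r) / 6 powr t"
  have h: "h > 0" using \<epsilon> by (simp add: h_def)
  obtain C where C: "C > 0"
    "\<And>a j z. \<bar>z\<bar> ^ a * cmod (iter_deriv j \<psi> z) \<le> C * h ^ (a + j) * fact a powr t * fact j powr s"
    using gelfand_shilov_bounds[OF \<psi> h] by blast
  show ?thesis
  proof (rule exI[of _ "C * h\<^sup>2 * 2 powr t"], intro conjI allI impI)
    fix \<mu> z :: real assume \<mu>: "\<mu> \<ge> 1" and z: "\<epsilon> * \<mu> powr t \<le> \<bar>z\<bar>"
    obtain n where n: "\<mu> \<le> real (Suc n)" "real (Suc n) \<le> 2 * \<mu>"
      using nat_between_double[OF \<mu>] by auto
    have "z\<^sup>2 * cmod (\<psi> z) \<le> C * h\<^sup>2 * 2 powr t * (h * 6 powr t / \<epsilon>) ^ Suc n"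
      by (rule gelfand_shilov_tail_bound[OF C(2)]) (use C(1) h t \<epsilon> n z in auto)
    also have "h * 6 powr t / \<epsilon> = exp (- r)" using \<epsilon> by (simp add: h_def)
    also have "C * h\<^sup>2 * 2 powr t * exp (- r) ^ Suc n \<le> C * h\<^sup>2 * 2 powr t * exp (- (r * \<mu>))"
      using C(1) by (intro mult_left_mono exp_power_le n r) auto
    finally show "z\<^sup>2 * cmod (\<psi> z) \<le> C * h\<^sup>2 * 2 powr t * exp (- (r * \<mu>))" .
  qed (use C h in auto)
qed

lemma gelfand_shilov_integrable:
  assumes "\<psi> \<in> gelfand_shilov t s"
  shows "integrable lborel \<psi>"
proof (rule Bochner_Integration.integrable_bound)
  show "integrable lborel (\<lambda>x. gs_norm t s 1 \<psi> * (1 + 2 powr t) * (1 / (1 + x\<^sup>2)))"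
    by (intro integrable_mult_right integrable_inverse_one_plus_square)
  show "\<psi> \<in> borel_measurable lborel"
    using gelfand_shilov_measurable[OF assms] by simp
  show "AE x in lborel. norm (\<psi> x) \<le> norm (gs_norm t s 1 \<psi> * (1 + 2 powr t) * (1 / (1 + x\<^sup>2)))"
    using gelfand_shilov_bound[OF assms]
    by (intro AE_I2) (smt (verit) real_norm_def mult_cancel_left1 times_divide_eq_right)
qed

lemma stft_integrand_integrable:
  assumes \<psi>: "\<psi> \<in> gelfand_shilov t s"
    and u: "u \<in> borel_measurable borel" "\<And>y. cmod (u y) \<le> 1"
  shows "integrable lborel (\<lambda>y. u y * cnj (\<psi> (y - x)) * exp (- \<i> * of_real (y * \<xi>)))"
proof (rule Bochner_Integration.integrable_bound)
  show "integrable lborel (\<lambda>y. \<psi> (y - x))"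
    using lborel_integrable_real_affine[OF gelfand_shilov_integrable[OF \<psi>], of 1 "- x"] by simp
  have "(\<lambda>y. \<psi> (y - x)) \<in> borel_measurable borel"
    using gelfand_shilov_measurable[OF \<psi>] by measurable
  then have "(\<lambda>y. cnj (\<psi> (y - x))) \<in> borel_measurable borel"
    by (rule measurable_compose) (intro borel_measurable_continuous_onI continuous_intros)
  moreover have "(\<lambda>y. exp (- \<i> * of_real (y * \<xi>))) \<in> borel_measurable borel"
    by (intro borel_measurable_continuous_onI continuous_intros)
  ultimately show "(\<lambda>y. u y * cnj (\<psi> (y - x)) * exp (- \<i> * of_real (y * \<xi>))) \<in> borel_measurable lborel"
    using u(1) by simp
  show "AE y in lborel. norm (u y * cnj (\<psi> (y - x)) * exp (- \<i> * of_real (y * \<xi>))) \<le> norm (\<psi> (y - x))"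
    using u(2) by (intro AE_I2) (auto simp: norm_mult intro!: mult_left_le_one_le)
qed

lemma stft_bounded:
  assumes \<psi>: "\<psi> \<in> gelfand_shilov t s"
    and u: "u \<in> borel_measurable borel" "\<And>y. cmod (u y) \<le> 1"
  shows "cmod (stft \<psi> (functional_of u) x \<xi>) \<le> (LINT y|lborel. cmod (\<psi> y))"
proof -
  have "cmod (LINT y|lborel. u y * cnj (\<psi> (y - x)) * exp (- \<i> * of_real (y * \<xi>)))
      \<le> (LINT y|lborel. cmod (u y * cnj (\<psi> (y - x)) * exp (- \<i> * of_real (y * \<xi>))))"
    by (rule integral_norm_bound)
  also have "\<dots> \<le> (LINT y|lborel. cmod (\<psi> (y - x)))"
  proof (rule integral_mono)
    show "integrable lborel (\<lambda>y. cmod (u y * cnj (\<psi> (y - x)) * exp (- \<i> * of_real (y * \<xi>))))"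
      by (intro integrable_norm stft_integrand_integrable[OF \<psi> u])
    show "integrable lborel (\<lambda>y. cmod (\<psi> (y - x)))"
      using lborel_integrable_real_affine[OF integrable_norm[OF gelfand_shilov_integrable[OF \<psi>]], of 1 "- x"]
      by simp
  qed (use u(2) in \<open>auto simp: norm_mult intro!: mult_left_le_one_le\<close>)
  also have "\<dots> = (LINT y|lborel. cmod (\<psi> y))"
    using lborel_integral_real_affine[of 1 "\<lambda>y. cmod (\<psi> y)" "- x"] by simp
  finally show ?thesis by (rule order_trans[OF norm_stft_functional_of_le])
qed

text \<open>After \<open>y = \<mu> powr t * w\<close> the integral splits at distance
  \<open>\<epsilon>\<close> from \<open>x\<close>. The inner part is the oscillatory integral with
  phase \<open>P w - \<xi> * w\<close>, whose derivative at \<open>x0\<close> is not small for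
  \<open>\<xi>\<close> near \<open>\<xi>0\<close>. The outer part is small because the window is
  evaluated at points of modulus at least \<open>\<epsilon> * \<mu> powr t\<close>.\<close>

lemma stft_decay_noncharacteristic:
  fixes u :: "real \<Rightarrow> complex" and P :: "complex \<Rightarrow> complex" and x0 p0 \<xi>0 :: real
  assumes \<psi>: "\<psi> \<in> gelfand_shilov t s" and t: "t > 0" and s: "s > 1"
    and u: "u \<in> borel_measurable borel" "\<And>y. cmod (u y) \<le> 1"
    and e0: "e0 > 0" and hol: "P holomorphic_on ball (of_real x0) e0"
    and real: "\<And>w::real. \<bar>w - x0\<bar> < e0 \<Longrightarrow> P (of_real w) \<in> \<real>"
    and hom: "\<And>\<mu> w::real. \<mu> > 0 \<Longrightarrow> \<bar>w - x0\<bar> < e0 \<Longrightarrow>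
       u (\<mu> powr t * w) = exp (\<i> * of_real (\<mu> powr (s + t)) * P (of_real w))"
    and p0: "(P has_field_derivative of_real p0) (at (of_real x0))" "p0 \<noteq> \<xi>0"
  shows "\<exists>\<delta>>0. \<forall>r>0. \<exists>C. \<forall>\<mu> x \<xi>. \<mu> > 0 \<longrightarrow> \<bar>x - x0\<bar> \<le> \<delta> \<longrightarrow> \<bar>\<xi> - \<xi>0\<bar> \<le> \<delta> \<longrightarrow>
       exp (r * \<mu>) * cmod (stft \<psi> (functional_of u) (\<mu> powr t * x) (\<mu> powr s * \<xi>)) \<le> C"
proof -
  have "isCont (deriv P) (of_real x0)"
    using holomorphic_on_imp_continuous_on[OF holomorphic_deriv[OF hol open_ball]] e0
    by (simp add: continuous_on_eq_continuous_at)
  moreover have "deriv P (of_real x0) = of_real p0" using p0(1) by (rule DERIV_imp_deriv)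
  ultimately obtain \<eta> where \<eta>: "\<eta> > 0"
    "\<And>z. dist z (of_real x0) < \<eta> \<Longrightarrow> dist (deriv P z) (of_real p0) < \<bar>p0 - \<xi>0\<bar> / 4"
    using p0(2) unfolding continuous_at_eps_delta
    by (metis diff_gt_0_iff_gt divide_pos_pos linorder_neqE_linordered_idom right_minus_eq zero_less_abs_iff zero_less_numeral)
  define \<epsilon> where "\<epsilon> = min \<eta> e0 / 4"
  define S where "S = ball (complex_of_real x0) e0"
  have \<epsilon>: "\<epsilon> > 0" "3 * \<epsilon> < \<eta>" "3 * \<epsilon> < e0" using \<eta>(1) e0 by (auto simp: \<epsilon>_def)
  have S: "open S" "cball (of_real x0) (3 * \<epsilon>) \<subseteq> S" "P holomorphic_on S"
    using \<epsilon> hol by (auto simp: S_def)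
  have P: "(P has_field_derivative deriv P z) (at z)" if "z \<in> cball (of_real x0) (3 * \<epsilon>)" for z
    using holomorphic_derivI[OF S(3,1)] S(2) that by blast
  have near: "cmod (deriv P z - of_real p0) \<le> \<bar>p0 - \<xi>0\<bar> / 4" if "z \<in> cball (of_real x0) (3 * \<epsilon>)" for z
    using \<eta>(2)[of z] that \<epsilon>(2) unfolding mem_cball dist_commute[of _ z] by (simp add: dist_norm)
  have real': "P (of_real w) \<in> \<real>" if "\<bar>w - x0\<bar> \<le> 3 * \<epsilon>" for w :: real
    using real that \<epsilon> by simp
  define J :: real where "J = (LINT x|lborel. 1 / (1 + x\<^sup>2))"
  define \<delta> where "\<delta> = min \<epsilon> (\<bar>p0 - \<xi>0\<bar> / 4)"
  show ?thesis
  proof (rule exI[of _ \<delta>], intro conjI allI impI)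
    show "\<delta> > 0" using \<epsilon> p0 by (simp add: \<delta>_def)
    fix r :: real assume r: "r > 0"
    \<comment> \<open>Both parts are estimated at the rate \<open>r + t\<close>; the excess
      \<open>t\<close> pays for the Jacobian, since
      \<open>\<mu> powr t \<le> exp (t * \<mu>)\<close>.\<close>
    then have rt: "r + t \<ge> 0" using t by simp
    obtain \<mu>0 C where \<mu>0: "\<mu>0 \<ge> 1" and C:
      "\<And>\<mu> x \<xi>. \<mu> \<ge> \<mu>0 \<Longrightarrow> \<bar>x - x0\<bar> \<le> \<epsilon> \<Longrightarrow> \<bar>\<xi> - \<xi>0\<bar> \<le> \<bar>p0 - \<xi>0\<bar> / 4 \<Longrightarrow>
       cmod (integral {x - \<epsilon>..x + \<epsilon>} (\<lambda>w. exp (\<i> * of_real (\<mu> powr (s + t)) * (P (of_real w) - of_real \<xi> * of_real w))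
           * cnj (\<psi> (\<mu> powr t * (w - x))))) \<le> C * exp (- ((r + t) * \<mu>))"
      using local_oscillatory_bound[OF \<psi> t s \<epsilon>(1) S P near real' p0(2) rt] by blast
    obtain M where M: "M \<ge> 0"
      "\<And>\<mu> z. \<mu> \<ge> 1 \<Longrightarrow> \<epsilon> * \<mu> powr t \<le> \<bar>z\<bar> \<Longrightarrow> z\<^sup>2 * cmod (\<psi> z) \<le> M * exp (- ((r + t) * \<mu>))"
      using gelfand_shilov_tail[OF \<psi> t \<epsilon>(1) rt] by blast
    define M' where "M' = (1 + 1 / \<epsilon>\<^sup>2) * M"
    define N0 where "N0 = (LINT y|lborel. cmod (\<psi> y))"
    have large: "exp (r * \<mu>) * cmod (stft \<psi> (functional_of u) (\<mu> powr t * x) (\<mu> powr s * \<xi>)) \<le> C + M' * J"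
      if \<mu>: "\<mu> \<ge> \<mu>0" and x: "\<bar>x - x0\<bar> \<le> \<delta>" and \<xi>: "\<bar>\<xi> - \<xi>0\<bar> \<le> \<delta>" for \<mu> x \<xi>
    proof -
      have \<mu>1: "\<mu> \<ge> 1" using \<mu> \<mu>0 by simp
      define g where "g w = u (\<mu> powr t * w) * cnj (\<psi> (\<mu> powr t * (w - x))) *
          exp (- \<i> * of_real (\<mu> powr t * w * (\<mu> powr s * \<xi>)))" for w
      define A where "A = {x - \<epsilon>..x + \<epsilon>}"
      let ?f = "\<lambda>y. u y * cnj (\<psi> (y - \<mu> powr t * x)) * exp (- \<i> * of_real (y * (\<mu> powr s * \<xi>)))"
      have "(LINT y|lborel. ?f y) = \<mu> powr t *\<^sub>R (LINT w|lborel. g w)"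
        using lborel_integral_real_affine[of "\<mu> powr t" ?f 0] \<mu>1 by (simp add: g_def right_diff_distrib)
      have gint: "integrable lborel g"
        using lborel_integrable_real_affine[OF stft_integrand_integrable[OF \<psi> u, of "\<mu> powr t * x" "\<mu> powr s * \<xi>"], of "\<mu> powr t" 0] \<mu>1
        by (simp add: g_def[abs_def] right_diff_distrib)
      have gA: "integrable lborel (\<lambda>w. indicator A w *\<^sub>R g w)" "integrable lborel (\<lambda>w. indicator (- A) w *\<^sub>R g w)"
        by (rule integrable_mult_indicator[OF _ gint], simp add: A_def)+
      have "(LINT w|lborel. g w) = (LINT w|lborel. indicator A w *\<^sub>R g w + indicator (- A) w *\<^sub>R g w)"
        by (rule Bochner_Integration.integral_cong) (auto simp: indicator_def)
      also have "\<dots> = (LINT w|lborel. indicator A w *\<^sub>R g w) + (LINT w|lborel. indicator (- A) w *\<^sub>R g w)"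
        by (rule Bochner_Integration.integral_add[OF gA])
      finally have split: "(LINT w|lborel. g w)
          = (LINT w|lborel. indicator A w *\<^sub>R g w) + (LINT w|lborel. indicator (- A) w *\<^sub>R g w)" .
      have "(LINT w|lborel. indicator A w *\<^sub>R g w) = integral A g"
        using set_borel_integral_eq_integral(2)[of A g] gA(1)
        by (simp add: set_integrable_def set_lebesgue_integral_def)
      also have "\<dots> = integral A (\<lambda>w. exp (\<i> * of_real (\<mu> powr (s + t)) * (P (of_real w) - of_real \<xi> * of_real w))
           * cnj (\<psi> (\<mu> powr t * (w - x))))"
      proof (rule Henstock_Kurzweil_Integration.integral_cong)
        fix w assume "w \<in> A"
        then have "\<bar>w - x0\<bar> < e0" using x \<epsilon> by (auto simp: A_def \<delta>_def)
        then have "u (\<mu> powr t * w) = exp (\<i> * of_real (\<mu> powr (s + t)) * P (of_real w))"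
          using hom[of \<mu> w] \<mu>1 by simp
        moreover have "exp (\<i> * of_real (\<mu> powr (s + t)) * P (of_real w)) *
            exp (- \<i> * of_real (\<mu> powr t * w * (\<mu> powr s * \<xi>)))
          = exp (\<i> * of_real (\<mu> powr (s + t)) * (P (of_real w) - of_real \<xi> * of_real w))"
          by (simp add: exp_add[symmetric] powr_add algebra_simps)
        ultimately show "g w = exp (\<i> * of_real (\<mu> powr (s + t)) * (P (of_real w) - of_real \<xi> * of_real w))
           * cnj (\<psi> (\<mu> powr t * (w - x)))"
          unfolding g_def by (metis mult.assoc mult.commute)
      qed
      finally have near_part: "cmod (LINT w|lborel. indicator A w *\<^sub>R g w) \<le> C * exp (- ((r + t) * \<mu>))"
        using C[OF \<mu>, of x \<xi>] x \<xi> by (simp add: A_def \<delta>_def)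
      have "cmod (LINT w|lborel. indicator (- A) w *\<^sub>R g w) \<le> (LINT w|lborel. cmod (indicator (- A) w *\<^sub>R g w))"
        by (rule integral_norm_bound)
      also have "\<dots> \<le> (LINT w|lborel. M' * exp (- ((r + t) * \<mu>)) * (1 / (1 + (w - x)\<^sup>2)))"
      proof (rule integral_mono)
        show "integrable lborel (\<lambda>w. M' * exp (- ((r + t) * \<mu>)) * (1 / (1 + (w - x)\<^sup>2)))"
          using lborel_integrable_real_affine[OF integrable_inverse_one_plus_square, of 1 "- x"]
          by (intro integrable_mult_right) simp
        show "integrable lborel (\<lambda>w. cmod (indicator (- A) w *\<^sub>R g w))"
          by (intro integrable_norm gA)
        fix w
        show "cmod (indicator (- A) w *\<^sub>R g w) \<le> M' * exp (- ((r + t) * \<mu>)) * (1 / (1 + (w - x)\<^sup>2))"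
        proof (cases "w \<in> A")
          case True
          then show ?thesis using M(1) by (simp add: M'_def)
        next
          case False
          then have far: "\<epsilon> \<le> \<bar>w - x\<bar>" by (auto simp: A_def)
          define z where "z = \<mu> powr t * (w - x)"
          have m1: "1 \<le> \<mu> powr t" using \<mu>1 t by (simp add: ge_one_powr_ge_zero)
          have "\<epsilon> * \<mu> powr t \<le> \<bar>z\<bar>"
            using mult_left_mono[OF far, of "\<mu> powr t"] by (simp add: z_def abs_mult mult.commute)
          from M(2)[OF \<mu>1 this] have zM: "z\<^sup>2 * cmod (\<psi> z) \<le> M * exp (- ((r + t) * \<mu>))" .
          have "(w - x)\<^sup>2 \<le> z\<^sup>2"
            using m1 mult_right_mono[OF m1, of "\<bar>w - x\<bar>"]
            by (intro abs_le_square_iff[THEN iffD1]) (simp add: z_def abs_mult)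
          moreover have "\<epsilon>\<^sup>2 \<le> (w - x)\<^sup>2"
            using far \<epsilon> by (intro abs_le_square_iff[THEN iffD1]) simp
          then have "1 \<le> (w - x)\<^sup>2 / \<epsilon>\<^sup>2" using \<epsilon> by simp
          \<comment> \<open>Outside the interval
            \<open>\<epsilon>\<^sup>2 \<le> (w - x)\<^sup>2 \<le> z\<^sup>2\<close>. Hence the
            factor \<open>z\<^sup>2\<close> in the tail bound yields the integrable weight
            \<open>1 / (1 + (w - x)\<^sup>2)\<close> at the cost of
            \<open>1 + 1 / \<epsilon>\<^sup>2\<close>.\<close>
          ultimately have "1 + (w - x)\<^sup>2 \<le> z\<^sup>2 / \<epsilon>\<^sup>2 + z\<^sup>2"
            by (smt (verit) divide_right_mono zero_le_power2)
          then have "(1 + (w - x)\<^sup>2) * cmod (\<psi> z) \<le> (1 + 1 / \<epsilon>\<^sup>2) * (z\<^sup>2 * cmod (\<psi> z))"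
            using mult_right_mono[of _ _ "cmod (\<psi> z)"] by (fastforce simp: algebra_simps)
          also have "\<dots> \<le> (1 + 1 / \<epsilon>\<^sup>2) * (M * exp (- ((r + t) * \<mu>)))"
            using zM by (intro mult_left_mono) auto
          finally have "cmod (\<psi> z) * (1 + (w - x)\<^sup>2) \<le> M' * exp (- ((r + t) * \<mu>))"
            by (simp add: M'_def mult_ac)
          then have "cmod (\<psi> z) \<le> M' * exp (- ((r + t) * \<mu>)) * (1 / (1 + (w - x)\<^sup>2))"
            by (simp add: pos_le_divide_eq add_pos_nonneg)
          moreover have "cmod (g w) \<le> cmod (\<psi> z)"
            using u(2) by (auto simp: g_def z_def norm_mult intro!: mult_left_le_one_le)
          ultimately show ?thesis using False by simp
        qed
      qed
      also have "\<dots> = M' * exp (- ((r + t) * \<mu>)) * J"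
        using lborel_integral_real_affine[of 1 "\<lambda>x. 1 / (1 + x\<^sup>2)" "- x"]
        by (simp only: integral_mult_right_zero J_def) simp
      finally have far_part: "cmod (LINT w|lborel. indicator (- A) w *\<^sub>R g w) \<le> M' * exp (- ((r + t) * \<mu>)) * J" .
      have "cmod (stft \<psi> (functional_of u) (\<mu> powr t * x) (\<mu> powr s * \<xi>))
          \<le> cmod (LINT y|lborel. ?f y)"
        by (rule norm_stft_functional_of_le)
      also have "\<dots> \<le> \<mu> powr t * (C * exp (- ((r + t) * \<mu>)) + M' * exp (- ((r + t) * \<mu>)) * J)"
        using norm_triangle_le[OF add_mono[OF near_part far_part]]
          \<open>(LINT y|lborel. ?f y) = \<mu> powr t *\<^sub>R (LINT w|lborel. g w)\<close>
        by (simp add: split mult_left_mono)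
      finally have "exp (r * \<mu>) * cmod (stft \<psi> (functional_of u) (\<mu> powr t * x) (\<mu> powr s * \<xi>))
          \<le> exp (r * \<mu>) * (\<mu> powr t * (C * exp (- ((r + t) * \<mu>)) + M' * exp (- ((r + t) * \<mu>)) * J))"
        by (rule mult_left_mono) simp
      also have "\<dots> = (\<mu> powr t * exp (- (t * \<mu>))) * (C + M' * J)"
        by (simp add: algebra_simps exp_add exp_diff exp_minus field_simps)
      also have "\<dots> \<le> 1 * (C + M' * J)"
      proof (rule mult_right_mono)
        have "\<mu> powr t \<le> exp (t * \<mu>)"
          using \<mu>1 t ln_le_minus_one[of \<mu>] by (simp add: powr_def)
        then show "\<mu> powr t * exp (- (t * \<mu>)) \<le> 1" by (simp add: exp_minus field_simps)
        have "0 \<le> C * exp (- ((r + t) * \<mu>))" by (rule order_trans[OF norm_ge_zero near_part])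
        then have "0 \<le> C" by (simp add: zero_le_mult_iff)
        moreover have "0 \<le> J" unfolding J_def by (rule Bochner_Integration.integral_nonneg) (simp add: add_nonneg_nonneg)
        ultimately show "0 \<le> C + M' * J" using M(1) by (simp add: M'_def)
      qed
      finally show ?thesis by simp
    qed
    \<comment> \<open>For bounded \<open>\<mu>\<close> the trivial bound by the integral of the
      modulus of the window suffices.\<close>
    have small: "exp (r * \<mu>) * cmod (stft \<psi> (functional_of u) (\<mu> powr t * x) (\<mu> powr s * \<xi>)) \<le> exp (r * \<mu>0) * N0"
      if "\<mu> \<le> \<mu>0" for \<mu> x \<xi>
      using r that stft_bounded[OF \<psi> u] by (intro mult_mono) (auto simp: N0_def)
    show "\<exists>C. \<forall>\<mu> x \<xi>. \<mu> > 0 \<longrightarrow> \<bar>x - x0\<bar> \<le> \<delta> \<longrightarrow> \<bar>\<xi> - \<xi>0\<bar> \<le> \<delta> \<longrightarrow>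
       exp (r * \<mu>) * cmod (stft \<psi> (functional_of u) (\<mu> powr t * x) (\<mu> powr s * \<xi>)) \<le> C"
    proof (rule exI[of _ "max (C + M' * J) (exp (r * \<mu>0) * N0)"], intro allI impI)
      fix \<mu> x \<xi> assume "\<bar>x - x0\<bar> \<le> \<delta>" "\<bar>\<xi> - \<xi>0\<bar> \<le> \<delta>"
      then show "exp (r * \<mu>) * cmod (stft \<psi> (functional_of u) (\<mu> powr t * x) (\<mu> powr s * \<xi>))
          \<le> max (C + M' * J) (exp (r * \<mu>0) * N0)"
        using large[of \<mu> x \<xi>] small[of \<mu> x \<xi>] by (cases "\<mu> \<ge> \<mu>0") simp_all
    qed
  qed
qed

section \<open>Fourier transforms\<close>

text \<open>Fubini for \<open>f y * h \<xi> * exp (- \<i> * y * \<xi>)\<close>. It moves the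
  transform from an unknown function to an explicit kernel, first a Gaussian and later a
  Laplace-type kernel.\<close>

lemma fourier_multiplication_formula:
  fixes f h :: "real \<Rightarrow> complex"
  assumes f: "integrable lborel f" and h: "integrable lborel h"
  shows "(LINT \<xi>|lborel. h \<xi> * (LINT y|lborel. f y * exp (- \<i> * of_real (y * \<xi>))))
       = (LINT y|lborel. f y * (LINT \<xi>|lborel. h \<xi> * exp (- \<i> * of_real (y * \<xi>))))"
proof -
  define F where "F y \<xi> = f y * h \<xi> * exp (- \<i> * of_real (y * \<xi>))" for y \<xi> :: real
  have meas: "f \<in> borel_measurable borel" "h \<in> borel_measurable borel"
    using f h by auto
  have e: "(\<lambda>p. exp (- \<i> * of_real (fst p * snd p))) \<in> borel_measurable (borel :: (real \<times> real) measure)"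
    by (intro borel_measurable_continuous_onI continuous_intros)
  have "(\<lambda>p. F (fst p) (snd p)) \<in> borel_measurable (borel \<Otimes>\<^sub>M borel)"
  proof -
    have 1: "(\<lambda>p. f (fst p)) \<in> borel_measurable (borel \<Otimes>\<^sub>M borel)"
      "(\<lambda>p. h (snd p)) \<in> borel_measurable (borel \<Otimes>\<^sub>M borel)"
      using meas by measurable
    show ?thesis unfolding F_def
      by (intro borel_measurable_times 1 e[folded borel_prod])
  qed
  then have Fm: "(\<lambda>(y, \<xi>). F y \<xi>) \<in> borel_measurable (lborel \<Otimes>\<^sub>M lborel)"
    by (simp add: case_prod_unfold)
  have norm_F: "cmod (F y \<xi>) = cmod (f y) * cmod (h \<xi>)" for y \<xi>
    by (simp add: F_def norm_mult)
  have slice: "integrable lborel (\<lambda>\<xi>. F y \<xi>)" for y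
  proof (rule Bochner_Integration.integrable_bound)
    show "integrable lborel (\<lambda>\<xi>. f y * h \<xi>)" using h by simp
    show "(\<lambda>\<xi>. F y \<xi>) \<in> borel_measurable lborel"
      unfolding F_def using meas(2)
      by (intro borel_measurable_times borel_measurable_const)
        (auto intro!: borel_measurable_continuous_onI continuous_intros)
  qed (simp add: norm_F norm_mult)
  have "integrable (lborel \<Otimes>\<^sub>M lborel) (\<lambda>(y, \<xi>). F y \<xi>)"
  proof (rule lborel_pair.Fubini_integrable[OF Fm])
    have "integrable lborel (\<lambda>y. cmod (f y) * (LINT \<xi>|lborel. cmod (h \<xi>)))"
      using f by (intro integrable_mult_left integrable_norm)
    then show "integrable lborel (\<lambda>y. LINT \<xi>|lborel. cmod (case (y, \<xi>) of (y, \<xi>) \<Rightarrow> F y \<xi>))"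
      by (simp add: norm_F)
  qed (use slice in simp)
  from lborel_pair.Fubini_integral[OF this]
  have "(LINT \<xi>|lborel. LINT y|lborel. F y \<xi>) = (LINT y|lborel. LINT \<xi>|lborel. F y \<xi>)" by simp
  moreover have "(LINT y|lborel. F y \<xi>) = h \<xi> * (LINT y|lborel. f y * exp (- \<i> * of_real (y * \<xi>)))" for \<xi>
    by (subst integral_mult_right_zero[symmetric]) (simp add: F_def mult_ac)
  moreover have "(LINT \<xi>|lborel. F y \<xi>) = f y * (LINT \<xi>|lborel. h \<xi> * exp (- \<i> * of_real (y * \<xi>)))" for y
    by (simp add: F_def[abs_def] mult.assoc)
  ultimately show ?thesis by simp
qed

text \<open>This is the characteristic function of the standard normal distribution.\<close>

lemma gaussian_fourier:
  "(LINT x|lborel. of_real (std_normal_density x) * exp (\<i> * of_real (a * x))) = complex_of_real (exp (- a\<^sup>2 / 2))"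
proof -
  have "char std_normal_distribution a = (LINT x|lborel. std_normal_density x *\<^sub>R exp (\<i> * of_real (a * x)))"
    unfolding char_def by (subst integral_density) (auto simp: mult.commute)
  then show ?thesis by (simp add: char_std_normal_distribution scaleR_conv_of_real)
qed

text \<open>A Gaussian summability kernel replaces the Fourier inversion formula.\<close>

lemma bounded_by_fourier_transform:
  fixes f :: "real \<Rightarrow> complex"
  defines "F \<equiv> (\<lambda>\<xi>. LINT y|lborel. f y * exp (- \<i> * of_real (y * \<xi>)))"
  assumes f: "integrable lborel f" and cont: "isCont f y0" and B: "\<And>y. cmod (f y) \<le> B"
    and F: "integrable lborel F"
  shows "cmod (f y0) \<le> (LINT \<xi>|lborel. cmod (F \<xi>))"
proof -
  define n where "n = std_normal_density"
  define \<delta> where "\<delta> k = inverse (real (Suc k))" for k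
  have \<delta>: "\<delta> k > 0" for k by (simp add: \<delta>_def)
  have fm: "f \<in> borel_measurable borel" using f by auto
  have n0: "n x \<ge> 0" for x by (simp add: n_def)
  have n1: "n x \<le> 1" for x
  proof -
    have "1 \<le> sqrt (2 * pi)" using pi_ge_two by simp
    moreover have "exp (- x\<^sup>2 / 2) \<le> 1" by simp
    ultimately show ?thesis
      unfolding n_def std_normal_density_def by (intro mult_le_one) auto
  qed
  have nint: "integrable lborel n" "(LINT x|lborel. n x) = 1"
    unfolding n_def by simp_all
  \<comment> \<open>Averages of \<open>f\<close> against Gaussians of width
    \<open>\<delta> k\<close> centred at \<open>y0\<close>. They tend to \<open>f y0\<close> by
    continuity there and dominated convergence.\<close>
  define I where "I k = (LINT w|lborel. f (y0 + \<delta> k * w) * of_real (n w))" for k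
  have "I \<longlonglongrightarrow> (LINT w|lborel. f y0 * of_real (n w))"
    unfolding I_def
  proof (rule integral_dominated_convergence[where w="\<lambda>w. B * n w"])
    show "integrable lborel (\<lambda>w. B * n w)" using nint by simp
    show "AE w in lborel. (\<lambda>k. f (y0 + \<delta> k * w) * of_real (n w)) \<longlonglongrightarrow> f y0 * of_real (n w)"
    proof (intro AE_I2 tendsto_mult tendsto_const)
      fix w
      have "(\<lambda>k. y0 + \<delta> k * w) \<longlonglongrightarrow> y0 + 0 * w"
        unfolding \<delta>_def by (intro tendsto_intros LIMSEQ_inverse_real_of_nat)
      then show "(\<lambda>k. f (y0 + \<delta> k * w)) \<longlonglongrightarrow> f y0"
        using isCont_tendsto_compose[OF cont] by simp
    qed
    show "AE w in lborel. norm (f (y0 + \<delta> k * w) * of_real (n w)) \<le> B * n w" for k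
      using B n0 by (auto simp: norm_mult intro!: AE_I2 mult_right_mono)
    show "(\<lambda>w. f (y0 + \<delta> k * w) * of_real (n w)) \<in> borel_measurable lborel" for k
      using fm unfolding n_def by measurable
  qed (use fm in \<open>simp add: n_def\<close>)
  moreover have "(LINT w|lborel. f y0 * of_real (n w)) = f y0"
    using nint by simp
  ultimately have "I \<longlonglongrightarrow> f y0" by (simp only:)
  moreover have "cmod (I k) \<le> (LINT \<xi>|lborel. cmod (F \<xi>))" for k
  proof -
    \<comment> \<open>The Fourier transform of \<open>h\<close> is the normal density of mean
      \<open>y0\<close> and width \<open>\<delta> k\<close>. Only
      \<open>cmod (h \<eta>) \<le> 1\<close> is used afterwards, so the sharp constant
      \<open>1 / (2 * pi)\<close> is given up.\<close>
    define h where "h \<eta> = of_real (n (\<delta> k * \<eta>) / sqrt (2 * pi)) * exp (\<i> * of_real (\<eta> * y0))" for \<eta>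
    have "integrable lborel (\<lambda>\<eta>. n (\<delta> k * \<eta>) / sqrt (2 * pi))"
      using lborel_integrable_real_affine[OF nint(1), of "\<delta> k" 0] \<delta>[of k] by simp
    then have hint: "integrable lborel h"
    proof (rule Bochner_Integration.integrable_bound)
      have "(\<lambda>\<eta>. exp (\<i> * of_real (\<eta> * y0))) \<in> borel_measurable borel"
        by (intro borel_measurable_continuous_onI continuous_intros)
      then show "h \<in> borel_measurable lborel" unfolding h_def n_def by measurable
      show "AE \<eta> in lborel. cmod (h \<eta>) \<le> norm (n (\<delta> k * \<eta>) / sqrt (2 * pi))"
        by (intro AE_I2) (simp add: h_def norm_mult norm_divide)
    qed
    have h1: "cmod (h \<eta>) \<le> 1" for \<eta>
    proof -
      have "1 \<le> sqrt (2 * pi)" using pi_ge_two by simp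
      then have "n (\<delta> k * \<eta>) \<le> sqrt (2 * pi)"
        using n1[of "\<delta> k * \<eta>"] by linarith
      then have "n (\<delta> k * \<eta>) / sqrt (2 * pi) \<le> 1" by simp
      then show ?thesis using n0 by (simp add: h_def norm_mult norm_divide)
    qed
    have hF: "(LINT \<eta>|lborel. h \<eta> * exp (- \<i> * of_real (y * \<eta>))) = of_real (n ((y - y0) / \<delta> k) / \<delta> k)" for y
    proof -
      define a where "a = (y0 - y) / \<delta> k"
      have "(LINT \<eta>|lborel. h \<eta> * exp (- \<i> * of_real (y * \<eta>)))
          = of_real (1 / sqrt (2 * pi)) * (LINT \<eta>|lborel. of_real (n (\<delta> k * \<eta>)) * exp (\<i> * of_real (a * (\<delta> k * \<eta>))))"
      proof (subst integral_mult_right_zero[symmetric], rule Bochner_Integration.integral_cong)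
        fix \<eta>
        have a\<eta>: "a * (\<delta> k * \<eta>) = \<eta> * (y0 - y)" using \<delta>[of k] by (simp add: a_def)
        show "h \<eta> * exp (- \<i> * of_real (y * \<eta>))
            = of_real (1 / sqrt (2 * pi)) * (of_real (n (\<delta> k * \<eta>)) * exp (\<i> * of_real (a * (\<delta> k * \<eta>))))"
          unfolding a\<eta> by (simp add: h_def exp_add[symmetric] algebra_simps)
      qed simp
      also have "(LINT \<eta>|lborel. of_real (n (\<delta> k * \<eta>)) * exp (\<i> * of_real (a * (\<delta> k * \<eta>))))
          = of_real (1 / \<delta> k) * (LINT x|lborel. of_real (n x) * exp (\<i> * of_real (a * x)))"
        using lborel_integral_real_affine[of "\<delta> k" "\<lambda>x. of_real (n x) * exp (\<i> * of_real (a * x))" 0] \<delta>[of k]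
        by (simp add: scaleR_conv_of_real)
      also have "(LINT x|lborel. of_real (n x) * exp (\<i> * of_real (a * x))) = complex_of_real (exp (- a\<^sup>2 / 2))"
        unfolding n_def by (rule gaussian_fourier)
      also have "a\<^sup>2 = ((y - y0) / \<delta> k)\<^sup>2" by (simp add: a_def power_divide power2_commute)
      finally show ?thesis by (simp add: n_def std_normal_density_def)
    qed
    have "I k = (LINT y|lborel. f y * of_real (n ((y - y0) / \<delta> k) / \<delta> k))"
      using lborel_integral_real_affine[of "\<delta> k" "\<lambda>y. f y * of_real (n ((y - y0) / \<delta> k) / \<delta> k)" y0] \<delta>[of k]
      by (simp add: I_def scaleR_conv_of_real)
    also have "\<dots> = (LINT \<xi>|lborel. h \<xi> * F \<xi>)"
      unfolding hF[symmetric] F_def by (rule fourier_multiplication_formula[OF f hint, symmetric])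
    also have "cmod \<dots> \<le> (LINT \<xi>|lborel. cmod (h \<xi> * F \<xi>))" by (rule integral_norm_bound)
    also have "\<dots> \<le> (LINT \<xi>|lborel. cmod (F \<xi>))"
    proof (rule integral_mono)
      show "integrable lborel (\<lambda>\<xi>. cmod (h \<xi> * F \<xi>))"
      proof (rule Bochner_Integration.integrable_bound[OF F])
        show "(\<lambda>\<xi>. cmod (h \<xi> * F \<xi>)) \<in> borel_measurable lborel" using hint F by auto
      qed (use h1 in \<open>auto simp: norm_mult intro!: AE_I2 mult_left_le_one_le\<close>)
      show "cmod (h \<xi> * F \<xi>) \<le> cmod (F \<xi>)" for \<xi>
        using h1 by (simp add: norm_mult mult_left_le_one_le)
    qed (use F in simp)
    finally show ?thesis .
  qed
  ultimately show ?thesis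
    using Lim_bounded[OF tendsto_norm] by blast
qed

section \<open>The singularity of the chirp at the origin\<close>

lemma integrable_powr_exp:
  fixes q a :: real
  assumes "q > - 1" "a > 0"
  shows "integrable lborel (\<lambda>x. indicator {0<..} x * (x powr q * exp (- a * x)))"
proof -
  have "(\<lambda>t. complex_of_real t powr (of_real (q + 1) - 1) / of_real (exp (a * t))) absolutely_integrable_on {0<..}"
    using assms by (intro absolutely_integrable_Gamma_integral) auto
  then have "integrable lebesgue (\<lambda>t. cmod (indicator {0<..} t *\<^sub>R (complex_of_real t powr (of_real (q + 1) - 1) / of_real (exp (a * t)))))"
    unfolding set_integrable_def by (rule integrable_norm)
  moreover have "cmod (indicator {0<..} t *\<^sub>R (complex_of_real t powr (of_real (q + 1) - 1) / of_real (exp (a * t))))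
      = indicator {0<..} t * (t powr q * exp (- a * t))" for t :: real
    by (auto simp: indicator_def norm_divide norm_powr_real_powr exp_minus field_simps)
  ultimately have "integrable lebesgue (\<lambda>t. indicator {0<..} t * (t powr q * exp (- a * t)))"
    by (simp only:)
  then show ?thesis
    by (subst (asm) integrable_completion) auto
qed

text \<open>For \<open>q > - 1\<close> and \<open>Re z > 0\<close> this is
  \<open>Gamma (q + 1) * z powr (- q - 1)\<close>. The Gamma value stays in the form
  \<open>laplace_powr q 1\<close>, of which only the nonvanishing matters.\<close>

definition laplace_powr :: "real \<Rightarrow> complex \<Rightarrow> complex" where
  "laplace_powr q z = (LINT x|lborel. indicator {0<..} x *\<^sub>R (of_real (x powr q) * exp (- z * of_real x)))"

lemma integrable_laplace_powr:
  assumes "q > - 1" "Re z > 0"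
  shows "integrable lborel (\<lambda>x. indicator {0<..} x *\<^sub>R (of_real (x powr q) * exp (- z * of_real x)))"
proof (rule Bochner_Integration.integrable_bound[OF integrable_powr_exp[OF assms]])
  show "(\<lambda>x. indicator {0<..} x *\<^sub>R (of_real (x powr q) * exp (- z * of_real x))) \<in> borel_measurable lborel"
    by measurable
qed (auto simp: norm_mult)

text \<open>The mean value inequality on a half plane; it supplies the majorant for the difference
  quotients of the Laplace integral.\<close>

lemma exp_difference_bound:
  fixes w z :: complex and x a :: real
  assumes "x \<ge> 0" "a \<le> Re w" "a \<le> Re z"
  shows "cmod (exp (- w * of_real x) - exp (- z * of_real x)) \<le> x * exp (- a * x) * cmod (w - z)"
proof (rule field_differentiable_bound[where S="{z. a \<le> Re z}"])
  show "convex {z. a \<le> Re z}" by (rule convex_halfspace_Re_ge)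
  fix y :: complex assume y: "y \<in> {z. a \<le> Re z}"
  show "((\<lambda>y. exp (- y * of_real x)) has_field_derivative - of_real x * exp (- y * of_real x))
      (at y within {z. a \<le> Re z})"
    by (auto intro!: derivative_eq_intros)
  show "cmod (- of_real x * exp (- y * of_real x)) \<le> x * exp (- a * x)"
    using assms y by (auto simp: norm_mult intro!: mult_left_mono mult_right_mono)
qed (use assms in auto)

text \<open>Differentiation under the integral sign, by dominated convergence along sequences in the
  half plane \<open>Re w > a\<close> with \<open>a = Re z / 2\<close>. There all difference
  quotients are dominated by \<open>x powr (q + 1) * exp (- a * x)\<close>.\<close>

lemma laplace_powr_field_differentiable:
  assumes q: "q > - 1" and z: "Re z > 0"
  shows "laplace_powr q field_differentiable at z"
proof -
  define a where "a = Re z / 2"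
  define U where "U = {w. a < Re w}"
  define J :: "complex \<Rightarrow> real \<Rightarrow> complex" where "J w x = indicator {0<..} x *\<^sub>R (of_real (x powr q) * exp (- w * of_real x))" for w x
  define D where "D = (LINT x|lborel. indicator {0<..} x *\<^sub>R (of_real (x powr q) * (- of_real x * exp (- z * of_real x))))"
  have a: "a > 0" "a < Re z" using z by (auto simp: a_def)
  have U: "open U" "z \<in> U" using a by (auto simp: U_def open_halfspace_Re_gt)
  have "(laplace_powr q has_field_derivative D) (at z within U)"
    unfolding has_field_derivative_iff tendsto_at_iff_sequentially
  proof (intro allI impI)
    fix X assume X: "\<forall>i. X i \<in> U - {z}" and lim: "X \<longlonglongrightarrow> z"
    have XU: "a < Re (X i)" "X i \<noteq> z" for i using X by (auto simp: U_def)
    have "(\<lambda>i. LINT x|lborel. (J (X i) x - J z x) / (X i - z)) \<longlonglongrightarrow> D"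
      unfolding D_def
    proof (rule integral_dominated_convergence)
      show "integrable lborel (\<lambda>x. indicator {0<..} x * (x powr (q + 1) * exp (- a * x)))"
        using q a by (intro integrable_powr_exp) auto
      show "AE x in lborel. (\<lambda>i. (J (X i) x - J z x) / (X i - z)) \<longlonglongrightarrow>
          indicator {0<..} x *\<^sub>R (of_real (x powr q) * (- of_real x * exp (- z * of_real x)))"
      proof (rule AE_I2)
        fix x :: real
        have "((\<lambda>y. exp (- y * of_real x)) has_field_derivative - of_real x * exp (- z * of_real x)) (at z within U)"
          by (auto intro!: derivative_eq_intros)
        then have "(\<lambda>i. (exp (- X i * of_real x) - exp (- z * of_real x)) / (X i - z)) \<longlonglongrightarrow> - of_real x * exp (- z * of_real x)"
          using X lim unfolding has_field_derivative_iff tendsto_at_iff_sequentially by (auto simp: o_def)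
        then have "(\<lambda>i. indicator {0<..} x *\<^sub>R (of_real (x powr q) * ((exp (- X i * of_real x) - exp (- z * of_real x)) / (X i - z))))
            \<longlonglongrightarrow> indicator {0<..} x *\<^sub>R (of_real (x powr q) * (- of_real x * exp (- z * of_real x)))"
          by (intro tendsto_intros)
        then show "(\<lambda>i. (J (X i) x - J z x) / (X i - z)) \<longlonglongrightarrow>
            indicator {0<..} x *\<^sub>R (of_real (x powr q) * (- of_real x * exp (- z * of_real x)))"
          by (simp add: J_def scaleR_conv_of_real algebra_simps diff_divide_distrib)
      qed
      show "AE x in lborel. norm ((J (X i) x - J z x) / (X i - z)) \<le> indicator {0<..} x * (x powr (q + 1) * exp (- a * x))" for i
      proof (rule AE_I2)
        fix x :: real
        show "norm ((J (X i) x - J z x) / (X i - z)) \<le> indicator {0<..} x * (x powr (q + 1) * exp (- a * x))"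
        proof (cases "x > 0")
          case True
          have "J (X i) x - J z x = of_real (x powr q) * (exp (- X i * of_real x) - exp (- z * of_real x))"
            using True by (simp add: J_def algebra_simps)
          then have "cmod (J (X i) x - J z x) = x powr q * cmod (exp (- X i * of_real x) - exp (- z * of_real x))"
            by (simp only: norm_mult norm_of_real) simp
          also have "\<dots> \<le> x powr q * (x * exp (- a * x) * cmod (X i - z))"
            using exp_difference_bound[of x a "X i" z] True XU[of i] a by (intro mult_left_mono) auto
          also have "\<dots> = x powr (q + 1) * exp (- a * x) * cmod (X i - z)"
            using True by (simp add: powr_add)
          finally show ?thesis
            using True XU(2)[of i] by (simp add: norm_divide pos_divide_le_eq)
        qed (simp add: J_def)
      qed
      show "(\<lambda>x. (J (X i) x - J z x) / (X i - z)) \<in> borel_measurable lborel" for i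
        unfolding J_def by measurable
    qed measurable
    moreover have "(LINT x|lborel. (J (X i) x - J z x) / (X i - z)) = (laplace_powr q (X i) - laplace_powr q z) / (X i - z)" for i
    proof -
      have "integrable lborel (J (X i))" "integrable lborel (J z)"
        unfolding J_def using integrable_laplace_powr[OF q, of "X i"] integrable_laplace_powr[OF q z] XU[of i] a by auto
      moreover have "laplace_powr q w = integral\<^sup>L lborel (J w)" for w
        by (simp add: laplace_powr_def J_def[abs_def])
      ultimately show ?thesis by simp
    qed
    ultimately show "((\<lambda>y. (laplace_powr q y - laplace_powr q z) / (y - z)) \<circ> X) \<longlonglongrightarrow> D"
      by (simp only: o_def)
  qed
  then show ?thesis
    unfolding at_within_open[OF U(2) U(1)] field_differentiable_def by blast
qed

lemma laplace_powr_of_real: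
  assumes "a > 0"
  shows "laplace_powr q (of_real a) = laplace_powr q 1 * of_real a powr of_real (- q - 1)"
proof -
  define f :: "real \<Rightarrow> complex" where "f x = indicator {0<..} x *\<^sub>R (of_real (x powr q) * exp (- of_real a * of_real x))" for x
  have "laplace_powr q (of_real a) = (1 / a) *\<^sub>R (LINT x|lborel. f ((1 / a) * x))"
    using lborel_integral_real_affine[of "1 / a" f 0] assms by (simp add: laplace_powr_def f_def[abs_def])
  also have "(\<lambda>x. f ((1 / a) * x)) = (\<lambda>x. of_real (a powr (- q)) * (indicator {0<..} x *\<^sub>R (of_real (x powr q) * exp (- 1 * of_real x))))"
  proof
    fix x :: real
    show "f ((1 / a) * x) = of_real (a powr (- q)) * (indicator {0<..} x *\<^sub>R (of_real (x powr q) * exp (- 1 * of_real x)))"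
    proof (cases "x > 0")
      case True
      then show ?thesis using assms by (simp add: f_def powr_divide powr_minus_divide)
    qed (use assms in \<open>auto simp: f_def indicator_def zero_less_divide_iff\<close>)
  qed
  also have "(1 / a) *\<^sub>R (LINT x|lborel. of_real (a powr (- q)) * (indicator {0<..} x *\<^sub>R (of_real (x powr q) * exp (- 1 * of_real x))))
      = of_real (a powr (- q) / a) * laplace_powr q 1"
    by (simp only: integral_mult_right_zero laplace_powr_def scaleR_conv_of_real) simp
  also have "a powr (- q) / a = a powr (- q - 1)" using assms by (simp add: powr_diff)
  finally show ?thesis
    unfolding powr_of_real[OF less_imp_le[OF assms]] by (simp only: mult.commute)
qed

text \<open>Both sides are holomorphic on the right half plane and agree on the positive axis by
  scaling; the identity theorem extends the equality from there.\<close>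

lemma laplace_powr_eq:
  assumes q: "q > - 1" and z: "Re z > 0"
  shows "laplace_powr q z = laplace_powr q 1 * z powr of_real (- q - 1)"
proof -
  define H where "H = {z::complex. Re z > 0}"
  have H: "open H" "connected H"
    unfolding H_def by (auto intro: open_halfspace_Re_gt convex_connected convex_halfspace_Re_gt)
  have "laplace_powr q z - laplace_powr q 1 * z powr of_real (- q - 1) = 0"
  proof (rule analytic_continuation[of "\<lambda>z. laplace_powr q z - laplace_powr q 1 * z powr of_real (- q - 1)" H "of_real ` {0<..}" 1])
    show "(\<lambda>z. laplace_powr q z - laplace_powr q 1 * z powr of_real (- q - 1)) holomorphic_on H"
    proof (intro holomorphic_intros)
      show "laplace_powr q holomorphic_on H"
        using laplace_powr_field_differentiable[OF q]
        by (auto simp: H_def holomorphic_on_def intro: field_differentiable_at_within)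
    qed (auto simp: H_def complex_nonpos_Reals_iff)
    show "(1::complex) islimpt of_real ` {0<..}"
    proof (rule islimpt_approachable[THEN iffD2], intro allI impI)
      fix e :: real assume "e > 0"
      then have "of_real (1 + e / 2) \<noteq> (1::complex)" "dist (of_real (1 + e / 2)) (1::complex) < e"
        "1 + e / 2 \<in> {0<..}"
        by (auto simp: dist_norm)
      then show "\<exists>x'\<in>of_real ` {0<..}. x' \<noteq> 1 \<and> dist x' (1::complex) < e" by blast
    qed
  qed (use laplace_powr_of_real z H in \<open>auto simp: H_def\<close>)
  then show ?thesis by simp
qed

lemma laplace_powr_one_nonzero:
  assumes "q > - 1"
  shows "laplace_powr q 1 \<noteq> 0"
proof -
  define f where "f x = indicator {0<..} x * (x powr q * exp (- x))" for x :: real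
  have int: "integrable lborel f" unfolding f_def using integrable_powr_exp[OF assms, of 1] by simp
  have "laplace_powr q 1 = (LINT x|lborel. complex_of_real (f x))"
    unfolding laplace_powr_def f_def
    by (rule Bochner_Integration.integral_cong) (auto simp: indicator_def exp_of_real[symmetric])
  also have "\<dots> = of_real (LINT x|lborel. f x)" by (rule integral_complex_of_real)
  finally have "laplace_powr q 1 = of_real (LINT x|lborel. f x)" .
  moreover have "(LINT x|lborel. f x) \<noteq> 0"
  proof
    assume "(LINT x|lborel. f x) = 0"
    moreover have "AE x in lborel. 0 \<le> f x" by (simp add: f_def)
    ultimately have "AE x in lborel. f x = 0"
      using integral_nonneg_eq_0_iff_AE[OF int] by simp
    moreover have "f x = 0 \<longleftrightarrow> x \<notin> {0<..}" for x by (auto simp: f_def)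
    ultimately have "AE x in lborel. (x::real) \<notin> {0<..}" by simp
    then have "emeasure lborel {0::real<..} = 0"
      by (subst (asm) AE_iff_measurable[of "{0<..}"]) auto
    moreover have "emeasure lborel {0<..<1::real} \<le> emeasure lborel {0::real<..}"
      by (intro emeasure_mono) auto
    ultimately show False by simp
  qed
  ultimately show ?thesis by simp
qed

section \<open>The model integral of the singularity\<close>

text \<open>For \<open>\<sigma> = 1\<close> this is what \<open>\<bar>y\<bar> powr \<alpha> *
  (\<epsilon> + \<i> * y) powr (- \<alpha> - 2)\<close> becomes under
  \<open>y = \<epsilon> * w\<close>, up to a power of \<open>\<epsilon>\<close>. Reflection in
  \<open>w\<close> changes the sign of \<open>\<sigma>\<close>, so both halves of the line reduce to
  \<open>w > 0\<close>.\<close>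

definition halfline_kernel :: "real \<Rightarrow> real \<Rightarrow> real \<Rightarrow> complex" where
  "halfline_kernel \<alpha> \<sigma> w = of_real (\<bar>w\<bar> powr \<alpha>) * (1 + \<i> * of_real (\<sigma> * w)) powr of_real (- \<alpha> - 2)"

lemma one_plus_ii_not_nonpos: "1 + \<i> * of_real x \<notin> \<real>\<^sub>\<le>\<^sub>0"
  by (simp add: complex_nonpos_Reals_iff)

lemma one_plus_ii_nonzero: "1 + \<i> * complex_of_real x \<noteq> 0"
  by (auto simp: complex_eq_iff)

lemma borel_measurable_one_plus_ii_powr:
  "(\<lambda>w. (1 + \<i> * of_real (\<sigma> * w)) powr c) \<in> borel_measurable borel"
  using one_plus_ii_not_nonpos[of "\<sigma> * w" for w] one_plus_ii_nonzero[of "\<sigma> * w" for w]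
  by (intro borel_measurable_continuous_onI continuous_on_powr_complex continuous_intros) auto

text \<open>As \<open>\<bar>w\<bar>\<close> is at most the modulus of \<open>1 + \<i> * w\<close>,
  the power \<open>\<alpha>\<close> cancels and the exponent \<open>- 2\<close> is left.\<close>

lemma norm_one_plus_ii_powr_le:
  assumes "\<alpha> > 0"
  shows "\<bar>w\<bar> powr \<alpha> * cmod ((1 + \<i> * of_real w) powr of_real (- \<alpha> - 2)) \<le> 1 / (1 + w\<^sup>2)"
proof -
  define m where "m = cmod (1 + \<i> * of_real w)"
  have m2: "m\<^sup>2 = 1 + w\<^sup>2" by (simp add: m_def cmod_power2)
  have m: "m > 0" using one_plus_ii_nonzero by (simp add: m_def)
  have "\<bar>w\<bar> \<le> m" unfolding m_def using abs_Im_le_cmod[of "1 + \<i> * of_real w"] by simp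
  then have "\<bar>w\<bar> powr \<alpha> * m powr (- \<alpha> - 2) \<le> m powr \<alpha> * m powr (- \<alpha> - 2)"
    using assms by (intro mult_right_mono powr_mono2) auto
  also have "\<dots> = m powr (- 2)" by (simp add: powr_add[symmetric])
  also have "\<dots> = 1 / (1 + w\<^sup>2)"
    using m by (simp add: m2[symmetric] powr_minus_divide powr_realpow[of _ 2, simplified])
  finally show ?thesis
    by (simp add: m_def norm_powr_real_powr')
qed

lemma halfline_kernel_integrable:
  assumes "\<alpha> > 0" "\<sigma> \<in> {1, -1}"
  shows "integrable lborel (halfline_kernel \<alpha> \<sigma>)"
proof (rule Bochner_Integration.integrable_bound[OF integrable_inverse_one_plus_square])
  show "halfline_kernel \<alpha> \<sigma> \<in> borel_measurable lborel"
    unfolding halfline_kernel_def[abs_def] using borel_measurable_one_plus_ii_powr[of \<sigma>]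
    by simp
  show "AE w in lborel. cmod (halfline_kernel \<alpha> \<sigma> w) \<le> norm (1 / (1 + w\<^sup>2))"
  proof (rule AE_I2)
    fix w :: real
    have "(\<sigma> * w)\<^sup>2 = w\<^sup>2" "\<bar>\<sigma> * w\<bar> = \<bar>w\<bar>" using assms by auto
    then show "cmod (halfline_kernel \<alpha> \<sigma> w) \<le> norm (1 / (1 + w\<^sup>2))"
      using norm_one_plus_ii_powr_le[OF assms(1), of "\<sigma> * w"]
      by (simp add: halfline_kernel_def norm_mult abs_of_nonneg add_nonneg_nonneg)
  qed
qed

text \<open>The exponent \<open>- \<alpha> - 2\<close> is chosen so that the integrand is the derivative of
  \<open>(w / (1 + \<i> \<sigma> w)) powr (\<alpha> + 1) / (\<alpha> + 1)\<close>.\<close>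

lemma integral_halfline_kernel:
  assumes \<alpha>: "\<alpha> > 0" and \<sigma>: "\<sigma> \<in> {1, -1}"
  shows "(LINT w|lborel. indicator {0<..} w *\<^sub>R halfline_kernel \<alpha> \<sigma> w)
       = (\<i> * of_real \<sigma>) powr of_real (- \<alpha> - 1) / of_real (\<alpha> + 1)"
proof -
  define a where "a = \<alpha> + 1"
  have "a > 0" using \<alpha> by (simp add: a_def)
  then have a: "a > 0" "of_real a \<noteq> (0::complex)" by simp_all
  \<comment> \<open>The primitive keeps the two powers apart: \<open>w\<close> is positive and
    \<open>1 + \<i> * \<sigma> * w\<close> has real part 1, so neither base meets the branch
    cut.\<close>
  define F where "F w = of_real (w powr a) * (1 + \<i> * of_real (\<sigma> * w)) powr of_real (- a) / of_real a" for w :: real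
  have "(LBINT w=ereal 0..\<infinity>. halfline_kernel \<alpha> \<sigma> w) = (\<i> * of_real \<sigma>) powr of_real (- a) / of_real a - 0"
  proof (rule interval_integral_FTC_integrable)
    fix w :: real assume "ereal 0 < ereal w"
    then have w: "w > 0" by simp
    define z where "z = 1 + \<i> * of_real (\<sigma> * w)"
    have z: "z \<notin> \<real>\<^sub>\<le>\<^sub>0" unfolding z_def by (rule one_plus_ii_not_nonpos)
    then have z0: "z \<noteq> 0" by auto
    have "((\<lambda>w. of_real (w powr a)) has_vector_derivative complex_of_real (a * w powr (a - 1))) (at w)"
      using w by (intro has_vector_derivative_of_real)
        (auto simp: has_real_derivative_iff_has_vector_derivative[symmetric] intro!: derivative_eq_intros)
    moreover have "((\<lambda>w. (1 + \<i> * of_real (\<sigma> * w)) powr of_real (- a)) has_vector_derivative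
        (\<i> * of_real \<sigma>) * (of_real (- a) * z powr (of_real (- a) - 1))) (at w)"
    proof -
      have "((\<lambda>w. 1 + \<i> * of_real (\<sigma> * w)) has_vector_derivative \<i> * of_real \<sigma>) (at w)"
        by (auto intro!: derivative_eq_intros)
      from field_vector_diff_chain_at[OF this has_field_derivative_powr[OF z[unfolded z_def], of "of_real (- a)"]]
      show ?thesis by (simp add: o_def z_def)
    qed
    ultimately have "((\<lambda>w. of_real (w powr a) * (1 + \<i> * of_real (\<sigma> * w)) powr of_real (- a)) has_vector_derivative
       of_real (w powr a) * ((\<i> * of_real \<sigma>) * (of_real (- a) * z powr (of_real (- a) - 1)))
       + of_real (a * w powr (a - 1)) * z powr of_real (- a)) (at w)"
      unfolding z_def by (rule has_vector_derivative_mult)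
    from has_vector_derivative_divide[OF this, of "of_real a"]
    have "(F has_vector_derivative
       (of_real (w powr a) * ((\<i> * of_real \<sigma>) * (of_real (- a) * z powr (of_real (- a) - 1)))
       + of_real (a * w powr (a - 1)) * z powr of_real (- a)) / of_real a) (at w)"
      by (simp add: F_def[abs_def])
    moreover have "(of_real (w powr a) * ((\<i> * of_real \<sigma>) * (of_real (- a) * z powr (of_real (- a) - 1)))
       + of_real (a * w powr (a - 1)) * z powr of_real (- a)) / of_real a = halfline_kernel \<alpha> \<sigma> w"
    proof -
      have 1: "z powr of_real (- a) = z * z powr (of_real (- a) - 1)"
        using z0 by (simp add: powr_diff)
      have 2: "w powr a = w * w powr (a - 1)" using w by (simp add: powr_diff)
      have "(of_real (w powr a) * ((\<i> * of_real \<sigma>) * (of_real (- a) * z powr (of_real (- a) - 1)))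
         + of_real (a * w powr (a - 1)) * z powr of_real (- a)) / of_real a
         = of_real (w powr (a - 1)) * z powr (of_real (- a) - 1) * (z - \<i> * of_real (\<sigma> * w))"
        unfolding 1 2 using a by (simp add: field_simps)
      also have "z - \<i> * of_real (\<sigma> * w) = 1" by (simp add: z_def)
      also have "of_real (w powr (a - 1)) * z powr (of_real (- a) - 1) * 1 = halfline_kernel \<alpha> \<sigma> w"
      proof -
        have "of_real (- a) - 1 = complex_of_real (- \<alpha> - 2)" by (simp add: a_def)
        then show ?thesis using w by (simp only: halfline_kernel_def z_def) (simp add: a_def)
      qed
      finally show ?thesis .
    qed
    ultimately show "(F has_vector_derivative halfline_kernel \<alpha> \<sigma> w) (at w)" by simp
    show "isCont (halfline_kernel \<alpha> \<sigma>) w"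
      unfolding halfline_kernel_def[abs_def] using w one_plus_ii_not_nonpos[of "\<sigma> * w"] one_plus_ii_nonzero[of "\<sigma> * w"]
      by (intro continuous_intros isCont_powr_complex) auto
  next
    show "set_integrable lborel (einterval (ereal 0) \<infinity>) (halfline_kernel \<alpha> \<sigma>)"
      unfolding set_integrable_def
      by (intro integrable_mult_indicator halfline_kernel_integrable \<alpha> \<sigma>) simp
    have "(F \<longlongrightarrow> 0) (at_right 0)"
    proof (rule Lim_null_comparison)
      show "((\<lambda>w::real. w powr a / a) \<longlongrightarrow> 0) (at_right 0)"
        using a by (auto intro!: tendsto_eq_intros tendsto_powr2 simp: eventually_at_filter)
      show "eventually (\<lambda>w. cmod (F w) \<le> w powr a / a) (at_right 0)"
      proof (intro always_eventually allI)
        fix w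
        have "1 \<le> cmod (1 + \<i> * of_real (\<sigma> * w))"
          using complex_Re_le_cmod[of "1 + \<i> * of_real (\<sigma> * w)"] by simp
        then have "cmod (1 + \<i> * of_real (\<sigma> * w)) powr (- a) \<le> 1"
          using a powr_mono[of "- a" 0] by simp
        then have "cmod ((1 + \<i> * of_real (\<sigma> * w)) powr of_real (- a)) \<le> 1"
          by (simp add: norm_powr_real_powr')
        then show "cmod (F w) \<le> w powr a / a"
          using a by (simp add: F_def norm_mult norm_divide divide_right_mono mult_left_le)
      qed
    qed
    then show "((F \<circ> real_of_ereal) \<longlongrightarrow> 0) (at_right (ereal 0))"
      by (simp add: ereal_tendsto_simps)
    \<comment> \<open>For the limit at infinity the positive factor \<open>w\<close> is taken out of
      the complex base, which then tends to \<open>\<i> * \<sigma>\<close>, off the branch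
      cut.\<close>
    have "((\<lambda>w. (of_real (1 / w) + \<i> * of_real \<sigma>) powr of_real (- a) / of_real a) \<longlongrightarrow>
        (of_real 0 + \<i> * of_real \<sigma>) powr of_real (- a) / of_real a) at_top"
    proof (intro tendsto_intros a tendsto_powr_complex)
      show "((\<lambda>x::real. 1 / x) \<longlongrightarrow> 0) at_top"
        by (rule tendsto_divide_0[OF tendsto_const]) (rule filterlim_at_top_imp_at_infinity[OF filterlim_ident])
    qed (use \<sigma> in \<open>auto simp: complex_nonpos_Reals_iff\<close>)
    moreover have "eventually (\<lambda>w. (of_real (1 / w) + \<i> * of_real \<sigma>) powr of_real (- a) / of_real a = F w) at_top"
      using eventually_gt_at_top[of 0]
    proof eventually_elim
      case (elim w)
      have "1 + \<i> * of_real (\<sigma> * w) = of_real w * (of_real (1 / w) + \<i> * of_real \<sigma>)"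
        using elim by (simp add: field_simps)
      then have "(1 + \<i> * of_real (\<sigma> * w)) powr of_real (- a)
          = of_real w powr of_real (- a) * (of_real (1 / w) + \<i> * of_real \<sigma>) powr of_real (- a)"
        using elim by (simp add: powr_times_real_left del: of_real_divide)
      also have "of_real w powr complex_of_real (- a) = of_real (w powr (- a))"
        using elim by (intro powr_of_real) simp
      finally show ?case
        using elim by (simp add: F_def powr_minus)
    qed
    ultimately have "(F \<longlongrightarrow> (\<i> * of_real \<sigma>) powr of_real (- a) / of_real a) at_top"
      by (auto elim: Lim_transform_eventually)
    then show "((F \<circ> real_of_ereal) \<longlongrightarrow> (\<i> * of_real \<sigma>) powr of_real (- a) / of_real a) (at_left \<infinity>)"
      by (simp add: ereal_tendsto_simps)
  qed simp
  moreover have "- a = - \<alpha> - 1" by (simp add: a_def)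
  ultimately show ?thesis
    by (simp add: interval_lebesgue_integral_def set_lebesgue_integral_def a_def)
qed

text \<open>The two half lines contribute \<open>\<i> powr (- \<alpha> - 1)\<close> and its
  conjugate, each divided by \<open>\<alpha> + 1\<close>. Their sum is twice a real part, hence the
  cosine.\<close>

lemma integral_abs_powr_kernel:
  assumes \<alpha>: "\<alpha> > 0"
  shows "(LINT w|lborel. halfline_kernel \<alpha> 1 w) = of_real (2 * cos ((\<alpha> + 1) * pi / 2) / (\<alpha> + 1))"
proof -
  let ?H = "halfline_kernel \<alpha>"
  have int: "integrable lborel (\<lambda>w. indicator {0<..} w *\<^sub>R ?H \<sigma> w)" if "\<sigma> \<in> {1, -1}" for \<sigma>
    by (intro integrable_mult_indicator halfline_kernel_integrable \<alpha> that) simp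
  have refl: "?H 1 (- w) = ?H (- 1) w" for w by (simp add: halfline_kernel_def)
  \<comment> \<open>The splitting is exact also at the origin, where neither indicator is 1, because
    \<open>0 powr \<alpha> = 0\<close>.\<close>
  have "(LINT w|lborel. ?H 1 w) = (LINT w|lborel. indicator {0<..} w *\<^sub>R ?H 1 w + indicator {0<..} (- w) *\<^sub>R ?H 1 w)"
    using \<alpha> by (intro Bochner_Integration.integral_cong) (auto simp: indicator_def halfline_kernel_def)
  also have "\<dots> = (LINT w|lborel. indicator {0<..} w *\<^sub>R ?H 1 w) + (LINT w|lborel. indicator {0<..} (- w) *\<^sub>R ?H 1 w)"
    using lborel_integrable_real_affine[OF int[of "- 1"], of "- 1" 0]
    by (intro Bochner_Integration.integral_add int) (auto simp: refl[symmetric])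
  also have "(LINT w|lborel. indicator {0<..} (- w) *\<^sub>R ?H 1 w) = (LINT w|lborel. indicator {0<..} w *\<^sub>R ?H (- 1) w)"
    using lborel_integral_real_affine[of "- 1" "\<lambda>w. indicator {0<..} w *\<^sub>R ?H (- 1) w" 0]
    by (simp add: refl[symmetric])
  also have "(LINT w|lborel. indicator {0<..} w *\<^sub>R ?H 1 w) + \<dots>
      = (\<i> powr of_real (- \<alpha> - 1) + (- \<i>) powr of_real (- \<alpha> - 1)) / of_real (\<alpha> + 1)"
    using integral_halfline_kernel[OF \<alpha>, of 1] integral_halfline_kernel[OF \<alpha>, of "- 1"]
    by (simp add: add_divide_distrib)
  also have "\<i> powr of_real (- \<alpha> - 1) + (- \<i>) powr of_real (- \<alpha> - 1) = of_real (2 * cos ((\<alpha> + 1) * pi / 2))"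
  proof -
    define b where "b = (\<alpha> + 1) * pi / 2"
    have "of_real (- \<alpha> - 1) * (\<i> * of_real pi / 2) = \<i> * of_real (- b)"
      "of_real (- \<alpha> - 1) * (- (\<i> * of_real pi / 2)) = \<i> * of_real b"
      by (simp_all add: b_def field_simps)
    then have "\<i> powr of_real (- \<alpha> - 1) = exp (\<i> * of_real (- b))"
      "(- \<i>) powr of_real (- \<alpha> - 1) = exp (\<i> * of_real b)"
      by (simp_all only: powr_def Ln_ii Ln_minus_ii) simp_all
    then show ?thesis
      unfolding b_def[symmetric] by (simp add: exp_Euler exp_minus_Euler cos_of_real)
  qed
  finally show ?thesis by simp
qed

text \<open>A zero of the cosine would make \<open>\<alpha> + 1\<close> an odd integer. This is
  where the exclusion of even exponents enters: for them the model integral vanishes.\<close>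

lemma cos_nonzero_of_not_even:
  assumes "\<alpha> > 0" "\<alpha> \<notin> {2 * real k | k::nat. True}"
  shows "cos ((\<alpha> + 1) * pi / 2) \<noteq> 0"
proof
  assume "cos ((\<alpha> + 1) * pi / 2) = 0"
  then obtain i :: int where i: "odd i" "(\<alpha> + 1) * pi / 2 = of_int i * (pi / 2)"
    by (auto simp: cos_zero_iff_int)
  then have "(\<alpha> + 1) * (pi / 2) = of_int i * (pi / 2)" by simp
  then have "\<alpha> + 1 = of_int i" by (subst (asm) mult_cancel_right) simp
  moreover obtain j where "i = 2 * j + 1" using i(1) by (elim oddE)
  ultimately have "\<alpha> = 2 * of_int j" by simp
  then have "\<alpha> = 2 * real (nat j)" using assms(1) by simp
  then show False using assms(2) by auto
qed

section \<open>Nonsmoothness obstructs decay on a half line\<close>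

text \<open>The transform of \<open>f\<close> is paired with
  \<open>\<eta> powr (\<alpha> + 1) * exp (- \<epsilon> * \<eta>)\<close> on the positive half line.
  The assumed decay keeps the pairing bounded as \<open>\<epsilon>\<close> tends to 0. On the other
  side it is \<open>L\<close> times the integral of \<open>f\<close> against
  \<open>(\<epsilon> + \<i> * y) powr (- \<alpha> - 2)\<close>, which grows like
  \<open>1 / \<epsilon>\<close> since \<open>f y\<close> behaves like
  \<open>\<i> * c * \<bar>y\<bar> powr \<alpha> * g 0\<close> at the origin.\<close>

lemma singularity_obstruction:
  fixes g :: "real \<Rightarrow> complex" and \<alpha> c W :: real
  defines "f \<equiv> (\<lambda>y. (exp (\<i> * of_real (c * \<bar>y\<bar> powr \<alpha>)) - 1) * g y)"
  assumes \<alpha>: "\<alpha> > 0" "\<alpha> \<notin> {2 * real k | k::nat. True}" and c: "c \<noteq> 0"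
    and g: "integrable lborel g" "\<And>y. cmod (g y) \<le> B" "isCont g 0" "g 0 \<noteq> 0"
    and W: "\<And>\<eta>. \<eta> > 0 \<Longrightarrow>
       \<eta> powr (\<alpha> + 1) * cmod (LINT y|lborel. f y * exp (- \<i> * of_real (y * \<eta>))) \<le> W * (1 / (1 + \<eta>\<^sup>2))"
  shows False
proof -
  define F where "F \<eta> = (LINT y|lborel. f y * exp (- \<i> * of_real (y * \<eta>)))" for \<eta> :: real
  define L where "L = laplace_powr (\<alpha> + 1) 1"
  define k where "k w = (1 + \<i> * of_real w) powr of_real (- \<alpha> - 2)" for w :: real
  define R where "R = (LINT \<eta>|lborel. W * (1 / (1 + \<eta>\<^sup>2)))"
  have L: "L \<noteq> 0" unfolding L_def using \<alpha> by (intro laplace_powr_one_nonzero) simp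
  have gm: "g \<in> borel_measurable borel" using g(1) by auto
  have em: "(\<lambda>y. exp (\<i> * of_real (c * \<bar>y\<bar> powr \<alpha>)) - 1) \<in> borel_measurable borel"
    using \<alpha> by (intro borel_measurable_continuous_onI continuous_intros continuous_on_powr') auto
  have fm: "f \<in> borel_measurable borel"
    unfolding f_def using em gm by (rule borel_measurable_times)
  have e1: "cmod (exp (\<i> * of_real x) - 1) \<le> \<bar>x\<bar>" for x
    using iexp_approx1[of x 0] by simp
  have e2: "cmod (exp (\<i> * of_real x) - 1) \<le> 2" for x
    using norm_triangle_ineq4[of "exp (\<i> * of_real x)" 1] by simp
  have fint: "integrable lborel f"
  proof (rule Bochner_Integration.integrable_bound)
    show "integrable lborel (\<lambda>y. 2 * g y)" using g(1) by simp
    show "f \<in> borel_measurable lborel" using fm by simp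
    show "AE y in lborel. cmod (f y) \<le> norm (2 * g y)"
      using e2 by (auto simp: f_def norm_mult intro!: AE_I2 mult_right_mono simp del: of_real_mult)
  qed
  have bound: "cmod (L * (LINT y|lborel. f y * (of_real \<epsilon> + \<i> * of_real y) powr of_real (- \<alpha> - 2))) \<le> R"
    if \<epsilon>: "\<epsilon> > 0" for \<epsilon>
  proof -
    define h where "h \<eta> = indicator {0<..} \<eta> *\<^sub>R (of_real (\<eta> powr (\<alpha> + 1)) * exp (- of_real \<epsilon> * of_real \<eta>) :: complex)" for \<eta> :: real
    have hint: "integrable lborel h"
      unfolding h_def using integrable_laplace_powr[of "\<alpha> + 1" "of_real \<epsilon>"] \<alpha> \<epsilon> by simp
    have hF: "(LINT \<eta>|lborel. h \<eta> * exp (- \<i> * of_real (y * \<eta>))) = L * (of_real \<epsilon> + \<i> * of_real y) powr of_real (- \<alpha> - 2)" for y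
    proof -
      have "(LINT \<eta>|lborel. h \<eta> * exp (- \<i> * of_real (y * \<eta>))) = laplace_powr (\<alpha> + 1) (of_real \<epsilon> + \<i> * of_real y)"
        unfolding laplace_powr_def h_def
        by (rule Bochner_Integration.integral_cong) (auto simp: indicator_def exp_add[symmetric] algebra_simps)
      also have "\<dots> = L * (of_real \<epsilon> + \<i> * of_real y) powr of_real (- (\<alpha> + 1) - 1)"
        unfolding L_def using \<alpha> \<epsilon> by (intro laplace_powr_eq) auto
      also have "- (\<alpha> + 1) - 1 = - \<alpha> - 2" by simp
      finally show ?thesis .
    qed
    have "L * (LINT y|lborel. f y * (of_real \<epsilon> + \<i> * of_real y) powr of_real (- \<alpha> - 2))
        = (LINT y|lborel. f y * (LINT \<eta>|lborel. h \<eta> * exp (- \<i> * of_real (y * \<eta>))))"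
      unfolding hF by (subst integral_mult_right_zero[symmetric]) (simp only: mult_ac)
    also have "\<dots> = (LINT \<eta>|lborel. h \<eta> * F \<eta>)"
      unfolding F_def by (rule fourier_multiplication_formula[OF fint hint, symmetric])
    also have "cmod \<dots> \<le> (LINT \<eta>|lborel. cmod (h \<eta> * F \<eta>))" by (rule integral_norm_bound)
    also have "\<dots> \<le> R"
      unfolding R_def
    proof (rule integral_mono')
      show "integrable lborel (\<lambda>\<eta>. W * (1 / (1 + \<eta>\<^sup>2)))"
        by (intro integrable_mult_right integrable_inverse_one_plus_square)
      fix \<eta> :: real
      have "0 \<le> W * (1 / (1 + 1\<^sup>2))" by (rule order_trans[OF _ W[of 1]]) simp_all
      then have W0: "0 \<le> W" by simp
      show "cmod (h \<eta> * F \<eta>) \<le> W * (1 / (1 + \<eta>\<^sup>2))"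
      proof (cases "\<eta> > 0")
        case True
        then have "cmod (h \<eta> * F \<eta>) \<le> \<eta> powr (\<alpha> + 1) * cmod (F \<eta>)"
          using \<epsilon> by (auto simp: h_def norm_mult intro!: mult_left_mono mult_left_le_one_le)
        also have "\<dots> \<le> W * (1 / (1 + \<eta>\<^sup>2))" using W[OF True] by (simp only: F_def)
        finally show ?thesis .
      qed (use W0 in \<open>simp add: h_def\<close>)
      show "0 \<le> W * (1 / (1 + \<eta>\<^sup>2))" using W0 by simp
    qed
    finally show ?thesis .
  qed
  define \<delta> where "\<delta> n = inverse (real (Suc n))" for n
  have \<delta>: "\<delta> n > 0" for n by (simp add: \<delta>_def)
  have \<delta>0: "\<delta> \<longlonglongrightarrow> 0" unfolding \<delta>_def by (rule LIMSEQ_inverse_real_of_nat)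
  \<comment> \<open>The integral of \<open>f\<close> against the kernel for
    \<open>\<epsilon> = \<delta> n\<close> equals \<open>I n / \<delta> n\<close>. So the uniform
    bound forces \<open>I\<close> to 0, while dominated convergence gives a nonzero limit.\<close>
  define I where "I n = (LINT w|lborel. of_real (\<delta> n powr (- \<alpha>)) * f (\<delta> n * w) * k w)" for n
  have "I \<longlonglongrightarrow> (LINT w|lborel. \<i> * of_real c * g 0 * halfline_kernel \<alpha> 1 w)"
    unfolding I_def
  proof (rule integral_dominated_convergence)
    show "integrable lborel (\<lambda>w. \<bar>c\<bar> * B * (1 / (1 + w\<^sup>2)))"
      by (intro integrable_mult_right integrable_inverse_one_plus_square)
    have km: "k \<in> borel_measurable borel"
      using borel_measurable_one_plus_ii_powr[of 1 "of_real (- \<alpha> - 2)"] by (simp add: k_def[abs_def])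
    show "(\<lambda>w. of_real (\<delta> n powr (- \<alpha>)) * f (\<delta> n * w) * k w) \<in> borel_measurable lborel" for n
      using fm km by measurable
    show "(\<lambda>w. \<i> * of_real c * g 0 * halfline_kernel \<alpha> 1 w) \<in> borel_measurable lborel"
      using halfline_kernel_integrable[OF \<alpha>(1), of 1] by auto
    show "AE w in lborel. norm (of_real (\<delta> n powr (- \<alpha>)) * f (\<delta> n * w) * k w) \<le> \<bar>c\<bar> * B * (1 / (1 + w\<^sup>2))" for n
    proof (rule AE_I2)
      fix w :: real
      have B: "B \<ge> 0" using order_trans[OF norm_ge_zero g(2)] .
      have "cmod (f (\<delta> n * w)) \<le> \<bar>c * \<bar>\<delta> n * w\<bar> powr \<alpha>\<bar> * B"
        unfolding f_def norm_mult by (intro mult_mono e1 g(2)) auto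
      also have "\<dots> = \<delta> n powr \<alpha> * (\<bar>c\<bar> * B * \<bar>w\<bar> powr \<alpha>)"
        using \<delta>[of n] by (simp add: abs_mult powr_mult)
      finally have "\<delta> n powr (- \<alpha>) * cmod (f (\<delta> n * w)) \<le> \<delta> n powr (- \<alpha>) * (\<delta> n powr \<alpha> * (\<bar>c\<bar> * B * \<bar>w\<bar> powr \<alpha>))"
        by (rule mult_left_mono) simp
      also have "\<dots> = \<bar>c\<bar> * B * \<bar>w\<bar> powr \<alpha>"
        using \<delta>[of n] by (simp add: powr_minus)
      finally have "\<delta> n powr (- \<alpha>) * cmod (f (\<delta> n * w)) * cmod (k w) \<le> \<bar>c\<bar> * B * \<bar>w\<bar> powr \<alpha> * cmod (k w)"
        by (rule mult_right_mono) simp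
      also have "\<dots> \<le> \<bar>c\<bar> * B * (1 / (1 + w\<^sup>2))"
        using mult_left_mono[OF norm_one_plus_ii_powr_le[OF \<alpha>(1), of w], of "\<bar>c\<bar> * B"] B
        by (simp only: k_def mult.assoc) simp
      finally show "norm (of_real (\<delta> n powr (- \<alpha>)) * f (\<delta> n * w) * k w) \<le> \<bar>c\<bar> * B * (1 / (1 + w\<^sup>2))"
        by (simp add: norm_mult)
    qed
    show "AE w in lborel. (\<lambda>n. of_real (\<delta> n powr (- \<alpha>)) * f (\<delta> n * w) * k w) \<longlonglongrightarrow> \<i> * of_real c * g 0 * halfline_kernel \<alpha> 1 w"
    proof (rule AE_I2)
      fix w :: real
      define b where "b = \<i> * complex_of_real (c * \<bar>w\<bar> powr \<alpha>)"
      \<comment> \<open>The pointwise limit is this derivative at 0, taken along the null sequence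
        \<open>\<delta> n powr \<alpha>\<close>.\<close>
      have "((\<lambda>x. exp (b * x)) has_field_derivative b) (at 0)"
        by (auto intro!: derivative_eq_intros)
      then have d: "((\<lambda>x. (exp (b * x) - 1) / x) \<longlongrightarrow> b) (at 0)"
        by (simp add: has_field_derivative_iff)
      have "(\<lambda>n. complex_of_real (\<delta> n powr \<alpha>)) \<longlonglongrightarrow> of_real 0"
        using \<delta>0 \<alpha> \<delta> by (intro tendsto_of_real) (auto intro!: tendsto_eq_intros tendsto_powr2 simp: less_imp_le)
      moreover have "\<delta> n powr \<alpha> \<noteq> 0" for n using \<delta>[of n] by simp
      ultimately have "(\<lambda>n. (exp (b * of_real (\<delta> n powr \<alpha>)) - 1) / of_real (\<delta> n powr \<alpha>)) \<longlonglongrightarrow> b"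
        using d unfolding tendsto_at_iff_sequentially by (auto simp: o_def)
      moreover have "(\<lambda>n. g (\<delta> n * w)) \<longlonglongrightarrow> g 0"
        using isCont_tendsto_compose[OF g(3), of "\<lambda>n. \<delta> n * w"] tendsto_mult_left_zero[OF \<delta>0] by simp
      ultimately have "(\<lambda>n. (exp (b * of_real (\<delta> n powr \<alpha>)) - 1) / of_real (\<delta> n powr \<alpha>) * g (\<delta> n * w) * k w) \<longlonglongrightarrow> b * g 0 * k w"
        by (intro tendsto_intros)
      moreover have "(exp (b * of_real (\<delta> n powr \<alpha>)) - 1) / of_real (\<delta> n powr \<alpha>) * g (\<delta> n * w) * k w
          = of_real (\<delta> n powr (- \<alpha>)) * f (\<delta> n * w) * k w" for n
      proof -
        have "b * of_real (\<delta> n powr \<alpha>) = \<i> * of_real (c * \<bar>\<delta> n * w\<bar> powr \<alpha>)"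
          using \<delta>[of n] by (simp add: b_def abs_mult powr_mult)
        then show ?thesis using \<delta>[of n] by (simp add: f_def powr_minus field_simps)
      qed
      moreover have "b * g 0 * k w = \<i> * of_real c * g 0 * halfline_kernel \<alpha> 1 w"
        by (simp add: b_def halfline_kernel_def k_def)
      ultimately show "(\<lambda>n. of_real (\<delta> n powr (- \<alpha>)) * f (\<delta> n * w) * k w) \<longlonglongrightarrow> \<i> * of_real c * g 0 * halfline_kernel \<alpha> 1 w"
        by simp
    qed
  qed
  moreover have "I \<longlonglongrightarrow> 0"
  proof (rule Lim_null_comparison)
    show "(\<lambda>n. \<delta> n * (R / cmod L)) \<longlonglongrightarrow> 0"
      by (rule tendsto_mult_left_zero[OF \<delta>0])
    have "cmod (I n) \<le> \<delta> n * (R / cmod L)" for n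
    proof -
      \<comment> \<open>Substitute \<open>y = \<delta> n * w\<close>: the Jacobian gives
        \<open>\<delta> n\<close>, the kernel \<open>\<delta> n powr (- \<alpha> - 2)\<close>, and
        \<open>- \<alpha>\<close> of this exponent is assigned to \<open>I n\<close>.\<close>
      have "(LINT y|lborel. f y * (of_real (\<delta> n) + \<i> * of_real y) powr of_real (- \<alpha> - 2))
          = \<delta> n *\<^sub>R (LINT w|lborel. f (\<delta> n * w) * (of_real (\<delta> n) + \<i> * of_real (\<delta> n * w)) powr of_real (- \<alpha> - 2))"
        using lborel_integral_real_affine[of "\<delta> n" "\<lambda>y. f y * (of_real (\<delta> n) + \<i> * of_real y) powr of_real (- \<alpha> - 2)" 0] \<delta>[of n]
        by simp
      also have "(\<lambda>w. f (\<delta> n * w) * (of_real (\<delta> n) + \<i> * of_real (\<delta> n * w)) powr of_real (- \<alpha> - 2))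
          = (\<lambda>w. of_real (\<delta> n powr (- 2)) * (of_real (\<delta> n powr (- \<alpha>)) * f (\<delta> n * w) * k w))"
      proof
        fix w :: real
        have "of_real (\<delta> n) + \<i> * of_real (\<delta> n * w) = of_real (\<delta> n) * (1 + \<i> * of_real w)"
          by (simp add: algebra_simps)
        then have "(of_real (\<delta> n) + \<i> * of_real (\<delta> n * w)) powr of_real (- \<alpha> - 2)
            = of_real (\<delta> n) powr of_real (- \<alpha> - 2) * k w"
          using \<delta>[of n] by (simp add: powr_times_real_left k_def)
        also have "of_real (\<delta> n) powr complex_of_real (- \<alpha> - 2) = of_real (\<delta> n powr (- \<alpha> - 2))"
          using \<delta>[of n] by (intro powr_of_real) simp
        also have "\<delta> n powr (- \<alpha> - 2) = \<delta> n powr (- 2) * \<delta> n powr (- \<alpha>)"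
          using powr_add[of "\<delta> n" "- 2" "- \<alpha>"] by (simp add: add.commute)
        finally show "f (\<delta> n * w) * (of_real (\<delta> n) + \<i> * of_real (\<delta> n * w)) powr of_real (- \<alpha> - 2)
            = of_real (\<delta> n powr (- 2)) * (of_real (\<delta> n powr (- \<alpha>)) * f (\<delta> n * w) * k w)"
          by simp
      qed
      also have "(LINT w|lborel. of_real (\<delta> n powr (- 2)) * (of_real (\<delta> n powr (- \<alpha>)) * f (\<delta> n * w) * k w)) = of_real (\<delta> n powr (- 2)) * I n"
        unfolding I_def by (rule integral_mult_right_zero)
      also have "\<delta> n *\<^sub>R (of_real (\<delta> n powr (- 2)) * I n) = of_real (1 / \<delta> n) * I n"
        using \<delta>[of n] by (simp add: scaleR_conv_of_real powr_minus powr_realpow[of _ 2, simplified] power2_eq_square field_simps)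
      finally have "cmod (L * (of_real (1 / \<delta> n) * I n)) \<le> R"
        using bound[OF \<delta>[of n]] by simp
      then show ?thesis using \<delta>[of n] L by (simp add: norm_mult norm_divide field_simps)
    qed
    then show "eventually (\<lambda>n. cmod (I n) \<le> \<delta> n * (R / cmod L)) sequentially"
      by simp
  qed
  ultimately have "(LINT w|lborel. \<i> * of_real c * g 0 * halfline_kernel \<alpha> 1 w) = 0"
    by (rule LIMSEQ_unique)
  then have "\<i> * of_real c * g 0 * of_real (2 * cos ((\<alpha> + 1) * pi / 2) / (\<alpha> + 1)) = 0"
    by (simp only: integral_mult_right_zero integral_abs_powr_kernel[OF \<alpha>(1)])
  then have "\<i> = 0 \<or> complex_of_real c = 0 \<or> g 0 = 0 \<or> 2 * cos ((\<alpha> + 1) * pi / 2) / (\<alpha> + 1) = 0"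
    by (simp only: mult_eq_0_iff of_real_eq_0_iff disj_assoc)
  then show False
    using c g(4) cos_nonzero_of_not_even[OF \<alpha>] \<alpha>(1) by simp
qed

section \<open>Wave front sets of chirps\<close>

text \<open>The supremum condition from the wave front set, written with an explicit bound and for
  arbitrary sets \<open>K\<close>, so that it can also be used on compact sets that are not
  open.\<close>

definition stft_decay ::
    "(real \<Rightarrow> complex) \<Rightarrow> real \<Rightarrow> real \<Rightarrow> ((real \<Rightarrow> complex) \<Rightarrow> complex) \<Rightarrow> (real \<times> real) set \<Rightarrow> bool" where
  "stft_decay \<psi> t s u K \<longleftrightarrow> (\<forall>r>0. \<exists>C. \<forall>\<mu> x \<xi>. \<mu> > 0 \<longrightarrow> (x, \<xi>) \<in> K \<longrightarrow>
     exp (r * \<mu>) * cmod (stft \<psi> u (\<mu> powr t * x) (\<mu> powr s * \<xi>)) \<le> C)"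

lemma stft_decay_subset:
  assumes "stft_decay \<psi> t s u K" and L: "L \<subseteq> K"
  shows "stft_decay \<psi> t s u L"
  unfolding stft_decay_def
proof (intro allI impI)
  fix r :: real assume "r > 0"
  then obtain C where C: "\<And>\<mu> x \<xi>. \<mu> > 0 \<Longrightarrow> (x, \<xi>) \<in> K \<Longrightarrow>
      exp (r * \<mu>) * cmod (stft \<psi> u (\<mu> powr t * x) (\<mu> powr s * \<xi>)) \<le> C"
    using assms(1) unfolding stft_decay_def by metis
  then show "\<exists>C. \<forall>\<mu> x \<xi>. \<mu> > 0 \<longrightarrow> (x, \<xi>) \<in> L \<longrightarrow>
      exp (r * \<mu>) * cmod (stft \<psi> u (\<mu> powr t * x) (\<mu> powr s * \<xi>)) \<le> C"
    using L by (intro exI[of _ C]) auto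
qed

lemma bdd_above_setcompr_iff:
  fixes f :: "'a \<Rightarrow> 'b \<Rightarrow> 'c \<Rightarrow> real"
  shows "bdd_above {f \<mu> x \<xi> | \<mu> x \<xi>. P \<mu> x \<xi>} \<longleftrightarrow> (\<exists>C. \<forall>\<mu> x \<xi>. P \<mu> x \<xi> \<longrightarrow> f \<mu> x \<xi> \<le> C)"
  unfolding bdd_above_def by fastforce

lemma not_in_wave_front_iff:
  assumes "p \<noteq> (0, 0)"
  shows "p \<notin> wave_front \<psi> t s u \<longleftrightarrow> (\<exists>U. open U \<and> p \<in> U \<and> stft_decay \<psi> t s u U)"
proof -
  have bdd: "(\<forall>r>0. bdd_above {exp (r * \<mu>) * cmod (stft \<psi> u (\<mu> powr t * x) (\<mu> powr s * \<xi>)) | \<mu> x \<xi>.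
                              \<mu> > 0 \<and> (x, \<xi>) \<in> U}) \<longleftrightarrow> stft_decay \<psi> t s u U" for U
    unfolding stft_decay_def bdd_above_setcompr_iff by (simp only: imp_conjL)
  show ?thesis
  proof
    assume "p \<notin> wave_front \<psi> t s u"
    then show "\<exists>U. open U \<and> p \<in> U \<and> stft_decay \<psi> t s u U"
      using assms unfolding wave_front_def bdd by auto
  next
    assume "\<exists>U. open U \<and> p \<in> U \<and> stft_decay \<psi> t s u U"
    then obtain U where U: "open U" "p \<in> U" "stft_decay \<psi> t s u U" by auto
    then have "open (U - {(0, 0)}) \<and> U - {(0, 0)} \<subseteq> - {(0, 0)} \<and> p \<in> U - {(0, 0)} \<and>
        stft_decay \<psi> t s u (U - {(0, 0)})"
      using assms stft_decay_subset[OF U(3), of "U - {(0, 0)}"] by auto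
    then show "p \<notin> wave_front \<psi> t s u"
      unfolding wave_front_def bdd mem_Collect_eq by (simp only: de_Morgan_conj not_not) (rule disjI2, rule exI)
  qed
qed

text \<open>A finite subcover by neighbourhoods with decay; the sum of the absolute values of their
  constants serves for all of \<open>K\<close>.\<close>

lemma stft_decay_compact:
  assumes K: "compact K" "(0, 0) \<notin> K" "K \<inter> wave_front \<psi> t s u = {}"
  shows "stft_decay \<psi> t s u K"
  unfolding stft_decay_def
proof (intro allI impI)
  fix r :: real assume r: "r > 0"
  have "\<exists>U. open U \<and> p \<in> U \<and> stft_decay \<psi> t s u U" if "p \<in> K" for p
    using not_in_wave_front_iff[of p \<psi> t s u] K that by auto
  then obtain U where U: "\<And>p. p \<in> K \<Longrightarrow> open (U p) \<and> p \<in> U p \<and> stft_decay \<psi> t s u (U p)"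
    by metis
  have "\<exists>D\<subseteq>K. finite D \<and> K \<subseteq> (\<Union>p\<in>D. U p)"
    by (rule compactE_image[OF K(1), of K U]) (use U in auto)
  then obtain D where D: "D \<subseteq> K" "finite D" "K \<subseteq> (\<Union>p\<in>D. U p)" by auto
  have "\<exists>C. \<forall>\<mu> x \<xi>. \<mu> > 0 \<longrightarrow> (x, \<xi>) \<in> U p \<longrightarrow> exp (r * \<mu>) * cmod (stft \<psi> u (\<mu> powr t * x) (\<mu> powr s * \<xi>)) \<le> C" if "p \<in> K" for p
    using U[OF that] r unfolding stft_decay_def by blast
  then obtain C where C: "\<And>p \<mu> x \<xi>. p \<in> K \<Longrightarrow> \<mu> > 0 \<Longrightarrow> (x, \<xi>) \<in> U p \<Longrightarrow>
      exp (r * \<mu>) * cmod (stft \<psi> u (\<mu> powr t * x) (\<mu> powr s * \<xi>)) \<le> C p"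
    by metis
  have "exp (r * \<mu>) * cmod (stft \<psi> u (\<mu> powr t * x) (\<mu> powr s * \<xi>)) \<le> (\<Sum>p\<in>D. \<bar>C p\<bar>)"
    if \<mu>: "\<mu> > 0" and x: "(x, \<xi>) \<in> K" for \<mu> x \<xi>
  proof -
    obtain p where p: "p \<in> D" "(x, \<xi>) \<in> U p" using D(3) x by auto
    have "exp (r * \<mu>) * cmod (stft \<psi> u (\<mu> powr t * x) (\<mu> powr s * \<xi>)) \<le> C p"
      using D(1) p by (intro C \<mu>) auto
    also have "\<dots> \<le> \<bar>C p\<bar>" by simp
    also have "\<dots> \<le> (\<Sum>p\<in>D. \<bar>C p\<bar>)"
      using D(2) p(1) by (intro member_le_sum) auto
    finally show ?thesis .
  qed
  then show "\<exists>C. \<forall>\<mu> x \<xi>. \<mu> > 0 \<longrightarrow> (x, \<xi>) \<in> K \<longrightarrow> exp (r * \<mu>) * cmod (stft \<psi> u (\<mu> powr t * x) (\<mu> powr s * \<xi>)) \<le> C"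
    by (intro exI[of _ "\<Sum>p\<in>D. \<bar>C p\<bar>"] allI impI)
qed

text \<open>From \<open>ln x \<le> x - 1\<close> at \<open>x = \<mu> / (2 * p)\<close>. Half of the
  decay \<open>exp (- \<mu>)\<close> thereby pays for any power of \<open>\<mu>\<close>, and so for
  powers of a frequency of size \<open>\<mu> powr s\<close>.\<close>

lemma powr_le_exp_half:
  fixes \<mu> p :: real
  assumes "\<mu> > 0" "p > 0"
  shows "\<mu> powr p \<le> (2 * p) powr p * exp (\<mu> / 2)"
proof -
  have "ln (\<mu> / (2 * p)) \<le> \<mu> / (2 * p) - 1" using assms by (intro ln_le_minus_one) simp
  then have "ln \<mu> \<le> \<mu> / (2 * p) + ln (2 * p)" using assms by (simp add: ln_div)
  then have "p * ln \<mu> \<le> p * (\<mu> / (2 * p) + ln (2 * p))" using assms by (intro mult_left_mono) auto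
  also have "\<dots> = p * ln (2 * p) + \<mu> / 2" using assms by (simp add: field_simps)
  finally have "exp (p * ln \<mu>) \<le> exp (p * ln (2 * p) + \<mu> / 2)" by simp
  then show ?thesis using assms by (simp add: powr_def exp_add)
qed

lemma powr_le_exp_half_gevrey:
  fixes \<eta> :: real
  assumes "0 \<le> \<eta>" "\<eta> \<le> a * \<mu> powr s" "a > 0" "\<mu> > 0" "s > 0" "p > 0"
  shows "\<eta> powr p \<le> a powr p * (2 * (s * p)) powr (s * p) * exp (\<mu> / 2)"
proof -
  have "\<eta> powr p \<le> (a * \<mu> powr s) powr p" using assms by (intro powr_mono2) auto
  also have "\<dots> = a powr p * \<mu> powr (s * p)" using assms by (simp add: powr_mult powr_powr)
  also have "\<dots> \<le> a powr p * ((2 * (s * p)) powr (s * p) * exp (\<mu> / 2))"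
    using assms by (intro mult_left_mono powr_le_exp_half) auto
  finally show ?thesis by (simp add: mult.assoc)
qed

section \<open>Points outside the wave front set of a chirp\<close>

lemma noncharacteristic_not_in_wave_front:
  fixes u :: "real \<Rightarrow> complex" and P :: "complex \<Rightarrow> complex" and x0 p0 \<xi>0 :: real
  assumes "\<psi> \<in> gelfand_shilov t s" "t > 0" "s > 1"
    and "u \<in> borel_measurable borel" "\<And>y. cmod (u y) \<le> 1"
    and "e0 > 0" "P holomorphic_on ball (of_real x0) e0"
    and "\<And>w::real. \<bar>w - x0\<bar> < e0 \<Longrightarrow> P (of_real w) \<in> \<real>"
    and "\<And>\<mu> w::real. \<mu> > 0 \<Longrightarrow> \<bar>w - x0\<bar> < e0 \<Longrightarrow>
       u (\<mu> powr t * w) = exp (\<i> * of_real (\<mu> powr (s + t)) * P (of_real w))"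
    and "(P has_field_derivative of_real p0) (at (of_real x0))" "p0 \<noteq> \<xi>0"
  shows "(x0, \<xi>0) \<notin> wave_front \<psi> t s (functional_of u)"
proof (cases "(x0, \<xi>0) = (0, 0)")
  case True
  then show ?thesis by (auto simp: wave_front_def)
next
  case False
  have "\<exists>\<delta>>0. \<forall>r>0. \<exists>C. \<forall>\<mu> x \<xi>. \<mu> > 0 \<longrightarrow> \<bar>x - x0\<bar> \<le> \<delta> \<longrightarrow> \<bar>\<xi> - \<xi>0\<bar> \<le> \<delta> \<longrightarrow>
       exp (r * \<mu>) * cmod (stft \<psi> (functional_of u) (\<mu> powr t * x) (\<mu> powr s * \<xi>)) \<le> C"
    by (rule stft_decay_noncharacteristic[where P=P and ?e0.0=e0 and ?p0.0=p0]) (fact assms)+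
  then obtain \<delta> where \<delta>: "\<delta> > 0" "\<And>r. r > 0 \<Longrightarrow> \<exists>C. \<forall>\<mu> x \<xi>. \<mu> > 0 \<longrightarrow> \<bar>x - x0\<bar> \<le> \<delta> \<longrightarrow> \<bar>\<xi> - \<xi>0\<bar> \<le> \<delta> \<longrightarrow>
       exp (r * \<mu>) * cmod (stft \<psi> (functional_of u) (\<mu> powr t * x) (\<mu> powr s * \<xi>)) \<le> C"
    by metis
  define U where "U = {x0 - \<delta><..<x0 + \<delta>} \<times> {\<xi>0 - \<delta><..<\<xi>0 + \<delta>}"
  have "stft_decay \<psi> t s (functional_of u) U"
    unfolding stft_decay_def
  proof (intro allI impI)
    fix r :: real assume "r > 0"
    from \<delta>(2)[OF this] obtain C where C: "\<And>\<mu> x \<xi>. \<mu> > 0 \<Longrightarrow> \<bar>x - x0\<bar> \<le> \<delta> \<Longrightarrow> \<bar>\<xi> - \<xi>0\<bar> \<le> \<delta> \<Longrightarrow>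
       exp (r * \<mu>) * cmod (stft \<psi> (functional_of u) (\<mu> powr t * x) (\<mu> powr s * \<xi>)) \<le> C" by metis
    show "\<exists>C. \<forall>\<mu> x \<xi>. \<mu> > 0 \<longrightarrow> (x, \<xi>) \<in> U \<longrightarrow>
       exp (r * \<mu>) * cmod (stft \<psi> (functional_of u) (\<mu> powr t * x) (\<mu> powr s * \<xi>)) \<le> C"
      by (intro exI[of _ C] allI impI C) (auto simp: U_def)
  qed
  moreover have "open U" "(x0, \<xi>0) \<in> U"
    using \<delta>(1) by (auto simp: U_def intro: open_Times)
  ultimately show ?thesis
    using not_in_wave_front_iff[OF False] by auto
qed

text \<open>By \<open>s + t = t * m\<close> the phase \<open>c * w ^ m\<close> is homogeneous under
  the scaling with factor \<open>\<mu> powr (s + t)\<close>. It is entire, so a disc of radius 1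
  will do around every \<open>x\<close>, including the origin.\<close>

lemma power_chirp_not_in_wave_front:
  assumes \<psi>: "\<psi> \<in> gelfand_shilov t s" and t: "t > 0" and s: "s > 1" "s + t = t * real m"
    and \<xi>: "\<xi> \<noteq> c * real m * x ^ (m - 1)"
  shows "(x, \<xi>) \<notin> wave_front \<psi> t s (functional_of (\<lambda>x. exp (\<i> * complex_of_real (c * x ^ m))))"
proof (rule noncharacteristic_not_in_wave_front[OF \<psi> t s(1), where P="\<lambda>z. of_real c * z ^ m" and ?e0.0=1])
  show "(\<lambda>x. exp (\<i> * complex_of_real (c * x ^ m))) \<in> borel_measurable borel"
    by (intro borel_measurable_continuous_onI continuous_intros)
  show "(\<lambda>z. of_real c * z ^ m) holomorphic_on ball (of_real x) 1"
    by (intro holomorphic_intros)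
  show "of_real c * complex_of_real w ^ m \<in> \<real>" for w by simp
  show "exp (\<i> * complex_of_real (c * (\<mu> powr t * w) ^ m))
      = exp (\<i> * of_real (\<mu> powr (s + t)) * (of_real c * of_real w ^ m))" if "\<mu> > 0" for \<mu> w
  proof -
    have "(\<mu> powr t) ^ m = \<mu> powr (s + t)"
      using that by (simp add: s(2) powr_powr powr_realpow[symmetric])
    then show ?thesis by (simp add: power_mult_distrib mult_ac flip: of_real_power)
  qed
  show "((\<lambda>z. of_real c * z ^ m) has_field_derivative of_real (c * real m * x ^ (m - 1))) (at (of_real x))"
    by (auto intro!: derivative_eq_intros)
  show "c * real m * x ^ (m - 1) \<noteq> \<xi>" using \<xi> by simp
qed (simp_all del: of_real_mult)

text \<open>On the side of the origin where \<open>x\<close> lies, \<open>\<bar>w\<bar>\<close>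
  equals \<open>sgn x * w\<close>, so the phase extends holomorphically as a principal power. The
  disc of radius \<open>\<bar>x\<bar>\<close> around \<open>x\<close> stays in the half plane where
  \<open>sgn x * z\<close> has positive real part.\<close>

lemma abs_chirp_not_in_wave_front:
  assumes \<psi>: "\<psi> \<in> gelfand_shilov t s" and t: "t > 0" and s: "s > 1" "s + t = t * \<alpha>"
    and \<alpha>: "\<alpha> > 0" and x: "x \<noteq> 0" and \<xi>: "\<xi> \<noteq> c * \<alpha> * sgn x * \<bar>x\<bar> powr (\<alpha> - 1)"
  shows "(x, \<xi>) \<notin> wave_front \<psi> t s (functional_of (\<lambda>x. exp (\<i> * complex_of_real (c * \<bar>x\<bar> powr \<alpha>))))"
proof (rule noncharacteristic_not_in_wave_front[OF \<psi> t s(1),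
      where P="\<lambda>z. of_real c * (of_real (sgn x) * z) powr of_real \<alpha>" and ?e0.0="\<bar>x\<bar>"])
  have pos: "Re (of_real (sgn x) * z) > 0" if "z \<in> ball (of_real x) \<bar>x\<bar>" for z :: complex
  proof -
    have "\<bar>x - Re z\<bar> < \<bar>x\<bar>"
      using that abs_Re_le_cmod[of "of_real x - z"] by (simp add: dist_norm)
    then show ?thesis using x by (cases "x > 0"; simp add: sgn_if; linarith)
  qed
  have np: "of_real (sgn x) * z \<notin> \<real>\<^sub>\<le>\<^sub>0" if "z \<in> ball (of_real x) \<bar>x\<bar>" for z :: complex
    using pos[OF that] by (auto simp: complex_nonpos_Reals_iff)
  have abs_w: "sgn x * w = \<bar>w\<bar>" if "\<bar>w - x\<bar> < \<bar>x\<bar>" for w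
    using that by (auto simp: sgn_if abs_if split: if_splits)
  have P_real: "of_real c * (of_real (sgn x) * complex_of_real w) powr of_real \<alpha> = of_real (c * \<bar>w\<bar> powr \<alpha>)"
    if "\<bar>w - x\<bar> < \<bar>x\<bar>" for w
    using powr_of_real[of "\<bar>w\<bar>" \<alpha>] abs_w[OF that] by (simp flip: of_real_mult)
  show "(\<lambda>x. exp (\<i> * complex_of_real (c * \<bar>x\<bar> powr \<alpha>))) \<in> borel_measurable borel"
    using \<alpha> by (intro borel_measurable_continuous_onI continuous_intros continuous_on_powr') auto
  show "\<bar>x\<bar> > 0" using x by simp
  show "(\<lambda>z. of_real c * (of_real (sgn x) * z) powr of_real \<alpha>) holomorphic_on ball (of_real x) \<bar>x\<bar>"
    using np by (intro holomorphic_intros) auto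
  show "of_real c * (of_real (sgn x) * complex_of_real w) powr of_real \<alpha> \<in> \<real>" if "\<bar>w - x\<bar> < \<bar>x\<bar>" for w
    unfolding P_real[OF that] by simp
  show "exp (\<i> * complex_of_real (c * \<bar>\<mu> powr t * w\<bar> powr \<alpha>))
      = exp (\<i> * of_real (\<mu> powr (s + t)) * (of_real c * (of_real (sgn x) * of_real w) powr of_real \<alpha>))"
    if "\<mu> > 0" "\<bar>w - x\<bar> < \<bar>x\<bar>" for \<mu> w
  proof -
    have "\<bar>\<mu> powr t * w\<bar> powr \<alpha> = \<mu> powr (s + t) * \<bar>w\<bar> powr \<alpha>"
      using that by (simp add: abs_mult powr_mult powr_powr s(2))
    then show ?thesis unfolding P_real[OF that(2)] by (simp add: mult_ac)
  qed
  have "((\<lambda>z::complex. of_real c * (of_real (sgn x) * z) powr of_real \<alpha>) has_field_derivative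
      of_real c * (of_real \<alpha> * (of_real (sgn x) * of_real x) powr (of_real \<alpha> - 1) * of_real (sgn x))) (at (of_real x))"
    using np[of "of_real x"] x
    by (intro DERIV_cmult DERIV_chain2[OF has_field_derivative_powr]) (auto intro!: derivative_eq_intros)
  moreover have "of_real (sgn x) * complex_of_real x = of_real \<bar>x\<bar>"
    by (simp add: sgn_if)
  then have "(of_real (sgn x) * complex_of_real x) powr (of_real \<alpha> - 1) = of_real (\<bar>x\<bar> powr (\<alpha> - 1))"
    using powr_of_real[of "\<bar>x\<bar>" "\<alpha> - 1"] by simp
  ultimately show "((\<lambda>z::complex. of_real c * (of_real (sgn x) * z) powr of_real \<alpha>) has_field_derivative
      of_real (c * \<alpha> * sgn x * \<bar>x\<bar> powr (\<alpha> - 1))) (at (of_real x))"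
    by (simp add: mult_ac)
  show "c * \<alpha> * sgn x * \<bar>x\<bar> powr (\<alpha> - 1) \<noteq> \<xi>" using \<xi> by simp
qed (simp_all del: of_real_mult)

lemma gevrey_square_exp_le:
  fixes \<eta> :: real
  assumes "0 \<le> \<eta>" "\<eta> \<le> a * \<mu> powr s" "a > 0" "\<mu> > 0" "s > 0"
  shows "(1 + \<eta>\<^sup>2) * exp (- \<mu> / 2) \<le> 1 + a powr 2 * (2 * (s * 2)) powr (s * 2)"
proof -
  have "\<eta>\<^sup>2 \<le> a powr 2 * (2 * (s * 2)) powr (s * 2) * exp (\<mu> / 2)"
    using powr_le_exp_half_gevrey[OF assms, of 2] assms(1) by simp
  then have "\<eta>\<^sup>2 * exp (- \<mu> / 2) \<le> a powr 2 * (2 * (s * 2)) powr (s * 2) * exp (\<mu> / 2) * exp (- \<mu> / 2)"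
    by (rule mult_right_mono) simp
  also have "\<dots> = a powr 2 * (2 * (s * 2)) powr (s * 2)" by (simp add: mult.assoc exp_add[symmetric])
  finally have "\<eta>\<^sup>2 * exp (- \<mu> / 2) \<le> a powr 2 * (2 * (s * 2)) powr (s * 2)" .
  moreover have "exp (- \<mu> / 2) \<le> 1" using assms by simp
  ultimately show ?thesis unfolding distrib_right mult_1_left by linarith
qed

lemma fourier_integral_eq_stft:
  "cmod (LINT y|lborel. u y * cnj (\<psi> (y - x)) * exp (- \<i> * of_real (y * \<xi>)))
     = sqrt (2 * pi) * cmod (stft \<psi> (functional_of u) x \<xi>)"
proof -
  have "sqrt (2 * pi) * (2 * pi) powr (- 1 / 2) = 1"
    by (simp add: powr_minus_divide powr_half_sqrt)
  then show ?thesis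
    by (simp add: stft_functional_of norm_mult mult.assoc[symmetric])
qed

lemma borel_measurable_fourier_integral:
  fixes f :: "real \<Rightarrow> complex"
  assumes "f \<in> borel_measurable borel"
  shows "(\<lambda>\<xi>. LINT y|lborel. f y * exp (- \<i> * of_real (y * \<xi>))) \<in> borel_measurable borel"
proof -
  have e: "(\<lambda>p. exp (- \<i> * of_real (snd p * fst p))) \<in> borel_measurable (borel :: (real \<times> real) measure)"
    by (intro borel_measurable_continuous_onI continuous_intros)
  have "(\<lambda>p::real \<times> real. f (snd p)) \<in> borel_measurable (borel \<Otimes>\<^sub>M borel)"
    using assms by measurable
  then have "(\<lambda>p. f (snd p) * exp (- \<i> * of_real (snd p * fst p))) \<in> borel_measurable (borel \<Otimes>\<^sub>M borel)"
    by (intro borel_measurable_times e[folded borel_prod])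
  then have "(\<lambda>(\<xi>, y). f y * exp (- \<i> * of_real (y * \<xi>))) \<in> borel_measurable (borel \<Otimes>\<^sub>M lborel)"
    by (simp add: case_prod_unfold)
  then show ?thesis by (rule lborel.borel_measurable_lebesgue_integral)
qed

lemma gelfand_shilov_isCont:
  assumes "\<psi> \<in> gelfand_shilov t s"
  shows "isCont (\<lambda>y. \<psi> (y - x)) z"
proof -
  have "isCont \<psi> (z - x)"
    using has_vector_derivative_continuous[OF gelfand_shilov_has_vector_derivative[OF assms, of 0 "z - x"]]
    by (simp add: iter_deriv_def)
  then show ?thesis by (rule isCont_o2[rotated]) (intro continuous_intros)
qed

lemma gelfand_shilov_bounded:
  assumes "\<psi> \<in> gelfand_shilov t s"
  shows "\<exists>B. \<forall>z. cmod (\<psi> z) \<le> B"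
proof -
  obtain C where "\<And>a j z. \<bar>z\<bar> ^ a * cmod (iter_deriv j \<psi> z) \<le> C * 1 ^ (a + j) * fact a powr t * fact j powr s"
    using gelfand_shilov_bounds[OF assms, of 1] by (metis zero_less_one)
  from this[of _ 0 0] show ?thesis by (intro exI[of _ C]) (simp add: iter_deriv_def)
qed

section \<open>Points inside the wave front set of a chirp\<close>

text \<open>If the point were missing, the wave front set would not meet the vertical line over
  \<open>x\<close> at all. Decay then holds at every frequency over
  \<open>\<mu>0 powr t * x\<close>, and integrating the Fourier transform bounds the window at a
  fixed point by a quantity tending to 0 with growing \<open>\<mu>0\<close>. But the chirp has
  modulus 1, so no size is lost.\<close>

lemma power_chirp_in_wave_front:
  assumes \<psi>: "\<psi> \<in> gelfand_shilov t s" "\<psi> \<noteq> (\<lambda>_. 0)" and t: "t > 0" and s: "s > 1" "s + t = t * real m"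
    and x: "x \<noteq> 0"
  shows "(x, c * real m * x ^ (m - 1)) \<in> wave_front \<psi> t s (functional_of (\<lambda>x. exp (\<i> * complex_of_real (c * x ^ m))))"
proof (rule ccontr)
  define u where "u x = exp (\<i> * complex_of_real (c * x ^ m))" for x
  define WF where "WF = wave_front \<psi> t s (functional_of u)"
  assume "\<not> ?thesis"
  then have notin: "(x, c * real m * x ^ (m - 1)) \<notin> WF" by (simp add: WF_def u_def[abs_def])
  have off: "(y, \<xi>) \<notin> WF" if "\<xi> \<noteq> c * real m * y ^ (m - 1)" for y \<xi>
    unfolding WF_def u_def[abs_def] by (rule power_chirp_not_in_wave_front[OF \<psi>(1) t s that])
  have um: "u \<in> borel_measurable borel" "continuous_on UNIV u"
    unfolding u_def[abs_def] by (intro borel_measurable_continuous_onI continuous_intros)+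
  have u1: "cmod (u y) = 1" for y by (simp add: u_def del: of_real_mult)
  \<comment> \<open>One more than the largest modulus of the slope over
    \<open>{- \<bar>x\<bar>..\<bar>x\<bar>}\<close>, so the horizontal segments \<open>K2\<close>
    miss the curve. The vertical segment \<open>K1\<close> meets it only in the point assumed
    missing.\<close>
  define R where "R = \<bar>c\<bar> * real m * \<bar>x\<bar> ^ (m - 1) + 1"
  have R: "R > 0" by (simp add: R_def add_nonneg_pos)
  define K1 where "K1 = {x} \<times> {-R..R}"
  define K2 where "K2 = {- \<bar>x\<bar>..\<bar>x\<bar>} \<times> {R, - R}"
  have "stft_decay \<psi> t s (functional_of u) K1"
  proof (rule stft_decay_compact)
    have "(y, \<xi>) \<notin> WF" if "(y, \<xi>) \<in> K1" for y \<xi>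
      using notin off[of \<xi> y] that by (cases "\<xi> = c * real m * y ^ (m - 1)") (auto simp: K1_def)
    then show "K1 \<inter> wave_front \<psi> t s (functional_of u) = {}"
      by (fold WF_def) auto
  qed (use x in \<open>auto simp: K1_def intro: compact_Times\<close>)
  moreover have "stft_decay \<psi> t s (functional_of u) K2"
  proof (rule stft_decay_compact)
    have "(y, \<xi>) \<notin> WF" if "(y, \<xi>) \<in> K2" for y \<xi>
    proof (rule off)
      have "\<bar>c * real m * y ^ (m - 1)\<bar> \<le> \<bar>c\<bar> * real m * \<bar>x\<bar> ^ (m - 1)"
        using that by (auto simp: K2_def abs_mult power_abs intro!: mult_left_mono power_mono)
      moreover have "\<bar>\<xi>\<bar> = R" using that R by (auto simp: K2_def)
      ultimately show "\<xi> \<noteq> c * real m * y ^ (m - 1)" by (auto simp: R_def)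
    qed
    then show "K2 \<inter> wave_front \<psi> t s (functional_of u) = {}"
      by (fold WF_def) auto
    show "compact K2" unfolding K2_def by (intro compact_Times) (auto intro: finite_imp_compact)
  qed (use R in \<open>auto simp: K2_def\<close>)
  ultimately obtain C1 C2 where
    C1: "\<And>\<mu> y \<xi>. \<mu> > 0 \<Longrightarrow> (y, \<xi>) \<in> K1 \<Longrightarrow> exp (1 * \<mu>) * cmod (stft \<psi> (functional_of u) (\<mu> powr t * y) (\<mu> powr s * \<xi>)) \<le> C1" and
    C2: "\<And>\<mu> y \<xi>. \<mu> > 0 \<Longrightarrow> (y, \<xi>) \<in> K2 \<Longrightarrow> exp (1 * \<mu>) * cmod (stft \<psi> (functional_of u) (\<mu> powr t * y) (\<mu> powr s * \<xi>)) \<le> C2"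
    unfolding stft_decay_def by (metis zero_less_one)
  define C where "C = max 0 (max C1 C2)"
  define D where "D = 1 + R powr 2 * (2 * (s * 2)) powr (s * 2)"
  define J :: real where "J = (LINT x|lborel. 1 / (1 + x\<^sup>2))"
  have decay: "cmod (stft \<psi> (functional_of u) (\<mu>0 powr t * x) \<xi>) \<le> C * D * exp (- \<mu>0 / 2) * (1 / (1 + \<xi>\<^sup>2))"
    if \<mu>0: "\<mu>0 \<ge> 1" for \<mu>0 \<xi>
  proof -
    have "\<exists>\<mu>\<ge>\<mu>0. \<bar>\<xi>\<bar> \<le> R * \<mu> powr s \<and> exp \<mu> * cmod (stft \<psi> (functional_of u) (\<mu>0 powr t * x) \<xi>) \<le> C"
    proof (cases "\<bar>\<xi>\<bar> \<le> R * \<mu>0 powr s")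
      case True
      have p: "\<mu>0 powr s > 0" using \<mu>0 by simp
      have "\<bar>\<xi> / \<mu>0 powr s\<bar> \<le> R" using True p by (simp add: pos_divide_le_eq)
      then have "\<xi> / \<mu>0 powr s \<le> R" "- R \<le> \<xi> / \<mu>0 powr s" by linarith+
      then have "(x, \<xi> / \<mu>0 powr s) \<in> K1" by (simp add: K1_def)
      from C1[OF _ this, of \<mu>0] have "exp \<mu>0 * cmod (stft \<psi> (functional_of u) (\<mu>0 powr t * x) \<xi>) \<le> C1"
        using \<mu>0 by simp
      then show ?thesis using True by (intro exI[of _ \<mu>0]) (simp add: C_def)
    next
      case False
      \<comment> \<open>High frequencies are rescaled to height \<open>R\<close>: this
        \<open>\<mu>\<close> solves \<open>\<mu> powr s * R = \<bar>\<xi>\<bar>\<close> and is at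
        least \<open>\<mu>0\<close>, so the base point moves towards the origin and lands in
        \<open>K2\<close>.\<close>
      define \<mu> where "\<mu> = (\<bar>\<xi>\<bar> / R) powr (1 / s)"
      have "0 \<le> R * \<mu>0 powr s" using R by simp
      with False have "\<bar>\<xi>\<bar> > 0" by linarith
      then have \<xi>p: "\<bar>\<xi>\<bar> / R > 0" using R by simp
      then have \<mu>s: "\<mu> powr s = \<bar>\<xi>\<bar> / R" using s R by (simp add: \<mu>_def powr_powr)
      have "\<mu>0 powr s \<le> \<bar>\<xi>\<bar> / R" using False R by (simp add: field_simps)
      then have "(\<mu>0 powr s) powr (1 / s) \<le> \<mu>"
        unfolding \<mu>_def using s by (intro powr_mono2) auto
      then have \<mu>: "\<mu>0 \<le> \<mu>" using s \<mu>0 by (simp add: powr_powr)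
      have "\<mu>0 powr t \<le> \<mu> powr t" using \<mu> \<mu>0 t by (intro powr_mono2) auto
      then have "\<mu>0 powr t / \<mu> powr t \<le> 1" using \<mu> \<mu>0 by simp
      then have "\<bar>x\<bar> * (\<mu>0 powr t / \<mu> powr t) \<le> \<bar>x\<bar>" by (intro mult_left_le) auto
      then have "\<bar>x * (\<mu>0 powr t / \<mu> powr t)\<bar> \<le> \<bar>x\<bar>" by (simp add: abs_mult)
      then have "x * (\<mu>0 powr t / \<mu> powr t) \<le> \<bar>x\<bar>" "- \<bar>x\<bar> \<le> x * (\<mu>0 powr t / \<mu> powr t)"
        by linarith+
      then have "(x * (\<mu>0 powr t / \<mu> powr t), sgn \<xi> * R) \<in> K2"
        using \<open>\<bar>\<xi>\<bar> > 0\<close> by (simp add: K2_def sgn_if)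
      from C2[OF _ this, of \<mu>]
      have "exp \<mu> * cmod (stft \<psi> (functional_of u) (\<mu> powr t * (x * (\<mu>0 powr t / \<mu> powr t))) (\<mu> powr s * (sgn \<xi> * R))) \<le> C2"
        using \<mu> \<mu>0 by simp
      moreover have "\<mu> powr t * (x * (\<mu>0 powr t / \<mu> powr t)) = \<mu>0 powr t * x"
        using \<mu> \<mu>0 by simp
      moreover have "\<mu> powr s * (sgn \<xi> * R) = \<xi>"
      proof -
        have "\<bar>\<xi>\<bar> / R * (sgn \<xi> * R) = sgn \<xi> * \<bar>\<xi>\<bar>" using R by simp
        then show ?thesis unfolding \<mu>s by (simp only: sgn_mult_abs)
      qed
      ultimately have "exp \<mu> * cmod (stft \<psi> (functional_of u) (\<mu>0 powr t * x) \<xi>) \<le> C2" by simp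
      then show ?thesis using \<mu> \<mu>s R by (intro exI[of _ \<mu>]) (simp add: C_def)
    qed
    then obtain \<mu> where \<mu>: "\<mu> \<ge> \<mu>0" "\<bar>\<xi>\<bar> \<le> R * \<mu> powr s"
      "exp \<mu> * cmod (stft \<psi> (functional_of u) (\<mu>0 powr t * x) \<xi>) \<le> C" by auto
    have "(1 + \<xi>\<^sup>2) * exp (- \<mu> / 2) \<le> D"
      using gevrey_square_exp_le[of "\<bar>\<xi>\<bar>" R \<mu> s] \<mu> R s \<mu>0 by (simp add: D_def)
    \<comment> \<open>One half of the exponential makes the bound integrable in
      \<open>\<xi>\<close>; the other half retains smallness in \<open>\<mu>0\<close>.\<close>
    then have "(1 + \<xi>\<^sup>2) * exp (- \<mu> / 2) * exp (- \<mu> / 2) \<le> D * exp (- \<mu>0 / 2)"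
      using \<mu>(1) by (intro mult_mono) (auto simp: D_def add_nonneg_nonneg)
    then have E: "(1 + \<xi>\<^sup>2) * exp (- \<mu>) \<le> D * exp (- \<mu>0 / 2)"
      by (simp add: mult.assoc exp_add[symmetric])
    have "cmod (stft \<psi> (functional_of u) (\<mu>0 powr t * x) \<xi>) \<le> C * exp (- \<mu>)"
      using \<mu>(3) by (simp add: exp_minus field_simps)
    then have "(1 + \<xi>\<^sup>2) * cmod (stft \<psi> (functional_of u) (\<mu>0 powr t * x) \<xi>) \<le> (1 + \<xi>\<^sup>2) * (C * exp (- \<mu>))"
      by (intro mult_left_mono) auto
    also have "\<dots> = C * ((1 + \<xi>\<^sup>2) * exp (- \<mu>))" by simp
    also have "\<dots> \<le> C * (D * exp (- \<mu>0 / 2))"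
      using E by (intro mult_left_mono) (auto simp: C_def)
    finally show ?thesis by (simp add: pos_le_divide_eq add_pos_nonneg mult_ac)
  qed
  obtain z where z: "\<psi> z \<noteq> 0" using \<psi>(2) by auto
  obtain B where B: "\<And>z. cmod (\<psi> z) \<le> B" using gelfand_shilov_bounded[OF \<psi>(1)] by auto
  define M where "M = sqrt (2 * pi) * C * D * J"
  have main: "cmod (\<psi> z) \<le> M * exp (- \<mu> / 2)" if \<mu>: "\<mu> \<ge> 1" for \<mu>
  proof -
    define X where "X = \<mu> powr t * x"
    define f where "f y = u y * cnj (\<psi> (y - X))" for y
    define F where "F \<xi> = (LINT y|lborel. f y * exp (- \<i> * of_real (y * \<xi>)))" for \<xi> :: real
    have fint: "integrable lborel f"
      using stft_integrand_integrable[OF \<psi>(1) um(1), of X 0] u1 by (simp add: f_def[abs_def])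
    have Fle: "cmod (F \<xi>) \<le> sqrt (2 * pi) * C * D * exp (- \<mu> / 2) * (1 / (1 + \<xi>\<^sup>2))" for \<xi>
      using mult_left_mono[OF decay[OF \<mu>, of \<xi>], of "sqrt (2 * pi)"]
      unfolding F_def f_def fourier_integral_eq_stft X_def by (simp add: mult.assoc)
    have dom: "integrable lborel (\<lambda>\<xi>. sqrt (2 * pi) * C * D * exp (- \<mu> / 2) * (1 / (1 + \<xi>\<^sup>2)))"
      by (intro integrable_mult_right integrable_inverse_one_plus_square)
    have Fint: "integrable lborel F"
    proof (rule Bochner_Integration.integrable_bound[OF dom])
      show "F \<in> borel_measurable lborel"
        unfolding F_def[abs_def] using borel_measurable_fourier_integral[of f] fint by auto
      show "AE \<xi> in lborel. cmod (F \<xi>) \<le> norm (sqrt (2 * pi) * C * D * exp (- \<mu> / 2) * (1 / (1 + \<xi>\<^sup>2)))"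
        unfolding real_norm_def by (intro AE_I2 order_trans[OF Fle abs_ge_self])
    qed
    \<comment> \<open>The modulus at \<open>X + z\<close> is that of the window at \<open>z\<close>,
      independently of \<open>\<mu>\<close>.\<close>
    have "cmod (\<psi> z) = cmod (f (X + z))" by (simp add: f_def norm_mult u1)
    also have "\<dots> \<le> (LINT \<xi>|lborel. cmod (F \<xi>))"
      unfolding F_def
    proof (rule bounded_by_fourier_transform[OF fint])
      have "isCont u (X + z)" using um(2) by (simp add: continuous_on_eq_continuous_at)
      then show "isCont f (X + z)"
        unfolding f_def[abs_def] by (intro continuous_mult continuous_cnj gelfand_shilov_isCont[OF \<psi>(1)])
      show "cmod (f y) \<le> B" for y using B by (simp add: f_def norm_mult u1)
      show "integrable lborel (\<lambda>\<xi>. LINT y|lborel. f y * exp (- \<i> * of_real (y * \<xi>)))"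
        using Fint by (simp only: F_def[abs_def])
    qed
    also have "\<dots> \<le> (LINT \<xi>|lborel. sqrt (2 * pi) * C * D * exp (- \<mu> / 2) * (1 / (1 + \<xi>\<^sup>2)))"
      by (intro integral_mono integrable_norm Fint dom Fle)
    also have "\<dots> = M * exp (- \<mu> / 2)"
      by (simp only: integral_mult_right_zero J_def M_def) (simp only: mult_ac)
    finally show ?thesis .
  qed
  have M: "M \<ge> 0"
    using order_trans[OF norm_ge_zero main[of 1]] by (simp add: zero_le_mult_iff)
  \<comment> \<open>Large enough that \<open>exp (\<mu> / 2)\<close>, being at least
    \<open>1 + \<mu> / 2\<close>, exceeds \<open>M / cmod (\<psi> z)\<close>.\<close>
  define \<mu> where "\<mu> = 2 * (M / cmod (\<psi> z)) + 1"
  have \<mu>: "\<mu> \<ge> 1" using M by (simp add: \<mu>_def)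
  have "M / cmod (\<psi> z) < exp (\<mu> / 2)"
  proof -
    have "M / cmod (\<psi> z) < 1 + \<mu> / 2" by (simp add: \<mu>_def add_divide_distrib)
    then show ?thesis using exp_ge_add_one_self[of "\<mu> / 2"] by linarith
  qed
  then have "M * exp (- \<mu> / 2) < cmod (\<psi> z)"
    using z by (simp add: exp_minus field_simps)
  then show False using main[OF \<mu>] by simp
qed

text \<open>A fixed \<open>b\<close> equals \<open>\<mu> powr t\<close> times
  \<open>b * \<mu> powr (- t)\<close>, which tends to 0. So the phase space points above
  \<open>b\<close> enter the scaled neighbourhood of \<open>(0, \<xi>)\<close> for large
  \<open>\<mu>\<close>. The rate 1 is enough for what follows.\<close>

lemma wave_front_vertical_decay:
  assumes notin: "(0, \<xi>) \<notin> wave_front \<psi> t s u" and \<xi>: "\<xi> \<noteq> 0" and t: "t > 0"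
  shows "\<exists>C \<mu>1. \<forall>\<mu>\<ge>\<mu>1. \<mu> > 0 \<longrightarrow> cmod (stft \<psi> u b (\<mu> powr s * \<xi>)) \<le> C * exp (- \<mu>)"
proof -
  obtain U where U: "open U" "(0, \<xi>) \<in> U" "stft_decay \<psi> t s u U"
    using not_in_wave_front_iff[of "(0, \<xi>)"] notin \<xi> by auto
  obtain C where C: "\<And>\<mu> x \<eta>. \<mu> > 0 \<Longrightarrow> (x, \<eta>) \<in> U \<Longrightarrow>
      exp (1 * \<mu>) * cmod (stft \<psi> u (\<mu> powr t * x) (\<mu> powr s * \<eta>)) \<le> C"
    using U(3) unfolding stft_decay_def by (metis zero_less_one)
  obtain e where e: "e > 0" "\<And>p. dist p (0, \<xi>) < e \<Longrightarrow> p \<in> U"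
    using U(1,2) unfolding open_dist by metis
  have "((\<lambda>\<mu>. \<bar>b * \<mu> powr (- t)\<bar>) \<longlongrightarrow> \<bar>b * 0\<bar>) at_top"
    using t by (intro tendsto_rabs tendsto_mult tendsto_const tendsto_neg_powr filterlim_ident) auto
  then have "eventually (\<lambda>\<mu>. \<bar>b * \<mu> powr (- t)\<bar> < e) at_top"
    using e(1) by (intro order_tendstoD(2)) auto
  then obtain \<mu>1 where \<mu>1: "\<And>\<mu>. \<mu> \<ge> \<mu>1 \<Longrightarrow> \<bar>b * \<mu> powr (- t)\<bar> < e"
    by (auto simp: eventually_at_top_linorder)
  have "cmod (stft \<psi> u b (\<mu> powr s * \<xi>)) \<le> C * exp (- \<mu>)" if \<mu>: "\<mu> \<ge> \<mu>1" "\<mu> > 0" for \<mu>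
  proof -
    have "(b * \<mu> powr (- t), \<xi>) \<in> U"
      using \<mu>1[OF \<mu>(1)] by (intro e(2)) (simp add: dist_Pair_Pair)
    from C[OF \<mu>(2) this] have "exp \<mu> * cmod (stft \<psi> u b (\<mu> powr s * \<xi>)) \<le> C"
      using \<mu>(2) by (simp add: powr_minus field_simps)
    then show ?thesis by (simp add: exp_minus field_simps)
  qed
  then show ?thesis by (intro exI[of _ C] exI[of _ \<mu>1]) auto
qed

text \<open>Neither \<open>u\<close>, by assumption, nor the constant 1 has
  \<open>(0, \<xi>)\<close> in its wave front set, so the transform of \<open>(u - 1) * g\<close>
  decays like \<open>exp (- \<mu>)\<close> at the frequency \<open>\<mu> powr s * \<xi>\<close>.
  This beats all polynomial weights on a half line and contradicts the singularity of
  \<open>u - 1\<close> at the origin.\<close>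

lemma abs_chirp_origin_in_wave_front:
  assumes \<psi>: "\<psi> \<in> gelfand_shilov t s" "\<psi> \<noteq> (\<lambda>_. 0)" and t: "t > 0" and s: "s > 1"
    and \<alpha>: "\<alpha> > 0" "\<alpha> \<notin> {2 * real k | k::nat. True}" and c: "c \<noteq> 0" and \<xi>: "\<xi> \<noteq> 0"
  shows "(0, \<xi>) \<in> wave_front \<psi> t s (functional_of (\<lambda>x. exp (\<i> * complex_of_real (c * \<bar>x\<bar> powr \<alpha>))))"
proof (rule ccontr)
  define u where "u x = exp (\<i> * complex_of_real (c * \<bar>x\<bar> powr \<alpha>))" for x
  define v where "v = (\<lambda>x::real. 1 :: complex)"
  assume "\<not> ?thesis"
  then have u_notin: "(0, \<xi>) \<notin> wave_front \<psi> t s (functional_of u)" by (simp add: u_def[abs_def])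
  \<comment> \<open>The constant 1 is a chirp with phase 0, whose slope 0 differs from
    \<open>\<xi>\<close>.\<close>
  have v_notin: "(0, \<xi>) \<notin> wave_front \<psi> t s (functional_of v)"
    by (rule noncharacteristic_not_in_wave_front[OF \<psi>(1) t s, where P="\<lambda>_. 0" and ?e0.0=1 and ?p0.0=0])
      (use \<xi> in \<open>auto simp: v_def\<close>)
  have um: "u \<in> borel_measurable borel"
    unfolding u_def[abs_def] using \<alpha>
    by (intro borel_measurable_continuous_onI continuous_intros continuous_on_powr') auto
  have vm: "v \<in> borel_measurable borel" by (simp add: v_def)
  have u1: "cmod (u y) \<le> 1" and v1: "cmod (v y) \<le> 1" for y by (simp_all add: u_def v_def del: of_real_mult)
  obtain z where z: "\<psi> z \<noteq> 0" using \<psi>(2) by auto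
  obtain B where B: "\<And>z. cmod (\<psi> z) \<le> B" using gelfand_shilov_bounded[OF \<psi>(1)] by auto
  \<comment> \<open>This translation moves a point where the window does not vanish to the origin:
    \<open>g 0 = cnj (\<psi> z)\<close>.\<close>
  define b where "b = - z"
  define g where "g y = cnj (\<psi> (y - b))" for y
  define F where "F \<eta> = (LINT y|lborel. (u y - 1) * g y * exp (- \<i> * of_real (y * \<eta>)))" for \<eta> :: real
  define N where "N = (LINT y|lborel. cmod (\<psi> y))"
  obtain C1 \<mu>1 where C1: "\<And>\<mu>. \<mu> \<ge> \<mu>1 \<Longrightarrow> \<mu> > 0 \<Longrightarrow> cmod (stft \<psi> (functional_of u) b (\<mu> powr s * \<xi>)) \<le> C1 * exp (- \<mu>)"
    using wave_front_vertical_decay[OF u_notin \<xi> t, of b] by auto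
  obtain C2 \<mu>2 where C2: "\<And>\<mu>. \<mu> \<ge> \<mu>2 \<Longrightarrow> \<mu> > 0 \<Longrightarrow> cmod (stft \<psi> (functional_of v) b (\<mu> powr s * \<xi>)) \<le> C2 * exp (- \<mu>)"
    using wave_front_vertical_decay[OF v_notin \<xi> t, of b] by auto
  have F_le: "cmod (F \<eta>) \<le> sqrt (2 * pi) * (cmod (stft \<psi> (functional_of u) b \<eta>) + cmod (stft \<psi> (functional_of v) b \<eta>))" for \<eta>
  proof -
    have "F \<eta> = (LINT y|lborel. u y * cnj (\<psi> (y - b)) * exp (- \<i> * of_real (y * \<eta>))
        - v y * cnj (\<psi> (y - b)) * exp (- \<i> * of_real (y * \<eta>)))"
      unfolding F_def g_def v_def by (simp add: algebra_simps)
    also have "\<dots> = (LINT y|lborel. u y * cnj (\<psi> (y - b)) * exp (- \<i> * of_real (y * \<eta>)))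
        - (LINT y|lborel. v y * cnj (\<psi> (y - b)) * exp (- \<i> * of_real (y * \<eta>)))"
      by (intro Bochner_Integration.integral_diff stft_integrand_integrable[OF \<psi>(1)] um vm u1 v1)
    finally show ?thesis
      using norm_triangle_ineq4 by (simp only: distrib_left fourier_integral_eq_stft[symmetric])
  qed
  define \<mu>0 where "\<mu>0 = max \<mu>1 \<mu>2"
  \<comment> \<open>The last summand covers the range below \<open>\<mu>0\<close>, where each of the
    two transforms is bounded only by \<open>N\<close>.\<close>
  define C where "C = sqrt (2 * pi) * (\<bar>C1\<bar> + \<bar>C2\<bar> + 2 * N * exp \<mu>0)"
  have N: "N \<ge> 0" unfolding N_def by (rule Bochner_Integration.integral_nonneg) simp
  have C0: "C \<ge> 0" using N by (simp add: C_def)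
  have F_decay: "cmod (F (\<mu> powr s * \<xi>)) \<le> C * exp (- \<mu>)" if \<mu>: "\<mu> > 0" for \<mu>
  proof -
    have "cmod (stft \<psi> (functional_of u) b (\<mu> powr s * \<xi>)) + cmod (stft \<psi> (functional_of v) b (\<mu> powr s * \<xi>))
        \<le> (\<bar>C1\<bar> + \<bar>C2\<bar> + 2 * N * exp \<mu>0) * exp (- \<mu>)"
    proof (cases "\<mu> \<ge> \<mu>0")
      case True
      have "cmod (stft \<psi> (functional_of u) b (\<mu> powr s * \<xi>)) + cmod (stft \<psi> (functional_of v) b (\<mu> powr s * \<xi>))
          \<le> C1 * exp (- \<mu>) + C2 * exp (- \<mu>)"
        using True \<mu> by (intro add_mono C1 C2) (auto simp: \<mu>0_def)
      also have "\<dots> = (C1 + C2 + 0) * exp (- \<mu>)" by (simp add: distrib_right)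
      also have "\<dots> \<le> (\<bar>C1\<bar> + \<bar>C2\<bar> + 2 * N * exp \<mu>0) * exp (- \<mu>)"
        using N by (intro mult_right_mono add_mono) auto
      finally show ?thesis .
    next
      case False
      have "cmod (stft \<psi> (functional_of u) b (\<mu> powr s * \<xi>)) + cmod (stft \<psi> (functional_of v) b (\<mu> powr s * \<xi>)) \<le> N + N"
        unfolding N_def by (intro add_mono stft_bounded[OF \<psi>(1)] um vm u1 v1)
      also have "\<dots> \<le> 2 * N * exp (\<mu>0 - \<mu>)"
        using False N by (simp add: mult_le_cancel_left1)
      also have "\<dots> = (0 + 0 + 2 * N * exp \<mu>0) * exp (- \<mu>)"
        by (simp add: exp_diff exp_minus field_simps)
      also have "\<dots> \<le> (\<bar>C1\<bar> + \<bar>C2\<bar> + 2 * N * exp \<mu>0) * exp (- \<mu>)"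
        using N by (intro mult_right_mono add_mono) auto
      finally show ?thesis .
    qed
    then have "sqrt (2 * pi) * (cmod (stft \<psi> (functional_of u) b (\<mu> powr s * \<xi>)) + cmod (stft \<psi> (functional_of v) b (\<mu> powr s * \<xi>)))
        \<le> sqrt (2 * pi) * ((\<bar>C1\<bar> + \<bar>C2\<bar> + 2 * N * exp \<mu>0) * exp (- \<mu>))"
      by (rule mult_left_mono) simp
    then show ?thesis
      using order_trans[OF F_le] by (simp add: C_def mult.assoc)
  qed
  define a where "a = \<bar>\<xi>\<bar>"
  define D1 where "D1 = a powr (\<alpha> + 1) * (2 * (s * (\<alpha> + 1))) powr (s * (\<alpha> + 1))"
  define D2 where "D2 = 1 + a powr 2 * (2 * (s * 2)) powr (s * 2)"
  have W: "\<eta> powr (\<alpha> + 1) * cmod (F (sgn \<xi> * \<eta>)) \<le> C * D1 * D2 * (1 / (1 + \<eta>\<^sup>2))" if \<eta>: "\<eta> > 0" for \<eta>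
  proof -
    define \<mu> where "\<mu> = (\<eta> / a) powr (1 / s)"
    have a: "a > 0" using \<xi> by (simp add: a_def)
    then have \<mu>: "\<mu> > 0" using \<eta> by (simp add: \<mu>_def)
    have \<mu>s: "\<mu> powr s = \<eta> / a" using s \<eta> a by (simp add: \<mu>_def powr_powr)
    then have \<eta>a: "\<eta> = a * \<mu> powr s" using a by simp
    have "\<mu> powr s * \<xi> = sgn \<xi> * \<eta>"
      unfolding \<eta>a a_def by (simp add: sgn_if)
    then have 1: "cmod (F (sgn \<xi> * \<eta>)) \<le> C * exp (- \<mu>)" using F_decay[OF \<mu>] by simp
    have "\<eta> powr (\<alpha> + 1) \<le> D1 * exp (\<mu> / 2)"
      unfolding D1_def using \<eta> \<eta>a a \<mu> s \<alpha> by (intro powr_le_exp_half_gevrey) auto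
    then have "\<eta> powr (\<alpha> + 1) * exp (- \<mu> / 2) \<le> D1 * exp (\<mu> / 2) * exp (- \<mu> / 2)"
      by (rule mult_right_mono) simp
    then have 2: "\<eta> powr (\<alpha> + 1) * exp (- \<mu> / 2) \<le> D1" by (simp add: mult.assoc exp_add[symmetric])
    have 3: "(1 + \<eta>\<^sup>2) * exp (- \<mu> / 2) \<le> D2"
      unfolding D2_def using \<eta> \<eta>a a \<mu> s by (intro gevrey_square_exp_le) auto
    have "\<eta> powr (\<alpha> + 1) * cmod (F (sgn \<xi> * \<eta>)) * (1 + \<eta>\<^sup>2) \<le> \<eta> powr (\<alpha> + 1) * (C * exp (- \<mu>)) * (1 + \<eta>\<^sup>2)"
      using 1 by (intro mult_right_mono mult_left_mono) auto
    \<comment> \<open>One half pays for \<open>\<eta> powr (\<alpha> + 1)\<close>, the other for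
      \<open>1 + \<eta>\<^sup>2\<close>.\<close>
    also have "exp (- \<mu>) = exp (- \<mu> / 2) * exp (- \<mu> / 2)" by (simp add: exp_add[symmetric])
    also have "\<eta> powr (\<alpha> + 1) * (C * (exp (- \<mu> / 2) * exp (- \<mu> / 2))) * (1 + \<eta>\<^sup>2)
        = C * ((\<eta> powr (\<alpha> + 1) * exp (- \<mu> / 2)) * ((1 + \<eta>\<^sup>2) * exp (- \<mu> / 2)))"
      by (simp only: mult_ac)
    also have "\<dots> \<le> C * (D1 * D2)"
      using 2 3 C0 by (intro mult_left_mono mult_mono) (auto simp: D1_def)
    finally show ?thesis
      by (simp add: pos_le_divide_eq add_pos_nonneg mult.assoc)
  qed
  have gm: "integrable lborel g"
    unfolding g_def using lborel_integrable_real_affine[OF gelfand_shilov_integrable[OF \<psi>(1)], of 1 "- b"]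
    by simp
  have gc: "isCont g 0"
    unfolding g_def[abs_def] by (intro continuous_cnj gelfand_shilov_isCont[OF \<psi>(1)])
  have g0: "g 0 \<noteq> 0" using z by (simp add: g_def b_def)
  have gB: "cmod (g y) \<le> B" for y using B by (simp add: g_def)
  show False
  proof (cases "\<xi> > 0")
    case True
    show False
    proof (rule singularity_obstruction[OF \<alpha> c gm gB gc g0])
      fix \<eta> :: real assume "\<eta> > 0"
      from W[OF this] True
      show "\<eta> powr (\<alpha> + 1) * cmod (LINT y|lborel. (exp (\<i> * of_real (c * \<bar>y\<bar> powr \<alpha>)) - 1) * g y * exp (- \<i> * of_real (y * \<eta>)))
          \<le> C * D1 * D2 * (1 / (1 + \<eta>\<^sup>2))"
        unfolding F_def u_def by simp
    qed
  next
    case False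
    then have sg: "sgn \<xi> = - 1" using \<xi> by simp
    show False
    \<comment> \<open>For negative \<open>\<xi>\<close> the decay is on the negative half line.
      Complex conjugation reflects the frequency and replaces \<open>c\<close> by \<open>- c\<close>
      and \<open>g\<close> by its conjugate.\<close>
    proof (rule singularity_obstruction[OF \<alpha>, of "- c" "\<lambda>y. cnj (g y)" B "C * D1 * D2"])
      fix \<eta> :: real assume "\<eta> > 0"
      have "(LINT y|lborel. (exp (\<i> * of_real (- c * \<bar>y\<bar> powr \<alpha>)) - 1) * cnj (g y) * exp (- \<i> * of_real (y * \<eta>)))
          = (LINT y|lborel. cnj ((u y - 1) * g y * exp (- \<i> * of_real (y * (sgn \<xi> * \<eta>)))))"
        by (intro Bochner_Integration.integral_cong) (simp_all add: u_def sg exp_cnj)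
      also have "\<dots> = cnj (F (sgn \<xi> * \<eta>))" unfolding F_def by (rule Bochner_Integration.integral_cnj)
      finally show "\<eta> powr (\<alpha> + 1) * cmod (LINT y|lborel. (exp (\<i> * of_real (- c * \<bar>y\<bar> powr \<alpha>)) - 1) * cnj (g y) * exp (- \<i> * of_real (y * \<eta>)))
          \<le> C * D1 * D2 * (1 / (1 + \<eta>\<^sup>2))"
        using W[OF \<open>\<eta> > 0\<close>] by (simp only: complex_mod_cnj)
    qed (use c gm gc g0 gB in \<open>auto intro: continuous_cnj\<close>)
  qed
qed

theorem theorem4p2:
  fixes c :: real
  assumes "c \<noteq> 0"
  shows "(\<forall>(m::nat) (t::real) (\<psi>::real \<Rightarrow> complex).
            m \<notin> {0, 1} \<longrightarrow> t > 1 / (real m - 1) \<longrightarrow>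
            \<psi> \<in> gelfand_shilov t (t * (real m - 1)) - {\<lambda>_. 0} \<longrightarrow>
            wave_front \<psi> t (t * (real m - 1))
                (functional_of (\<lambda>x. exp (\<i> * complex_of_real (c * x ^ m))))
              = {(x, c * real m * x ^ (m - 1)) | x. x \<noteq> 0})
       \<and> (\<forall>(\<alpha>::real) (t::real) (\<psi>::real \<Rightarrow> complex).
            \<alpha> \<notin> {2 * real k | k::nat. True} \<longrightarrow> \<alpha> > 1 \<longrightarrow> t > 1 / (\<alpha> - 1) \<longrightarrow>
            \<psi> \<in> gelfand_shilov t (t * (\<alpha> - 1)) - {\<lambda>_. 0} \<longrightarrow>
            {0} \<times> (UNIV - {0})
              \<subseteq> wave_front \<psi> t (t * (\<alpha> - 1))
                  (functional_of (\<lambda>x. exp (\<i> * complex_of_real (c * \<bar>x\<bar> powr \<alpha>)))) \<and>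
            wave_front \<psi> t (t * (\<alpha> - 1))
                (functional_of (\<lambda>x. exp (\<i> * complex_of_real (c * \<bar>x\<bar> powr \<alpha>))))
              \<subseteq> {(x, c * \<alpha> * sgn x * \<bar>x\<bar> powr (\<alpha> - 1)) | x. x \<noteq> 0} \<union> {0} \<times> (UNIV - {0}))"
proof (intro conjI allI impI)
  \<comment> \<open>The lower bound on \<open>t\<close> says exactly that
    \<open>s = t * (a - 1)\<close> exceeds 1, as the contour shift requires.\<close>
  have exponents: "t > 0" "t * (a - 1) > 1" if "a > 1" "t > 1 / (a - 1)" for a t :: real
  proof -
    have "1 / (a - 1) > 0" using that by simp
    with that show "t > 0" by linarith
    show "t * (a - 1) > 1" using that by (simp add: pos_divide_less_eq)
  qed
  have nz: "(0, 0) \<notin> wave_front \<psi> t s u" for \<psi> t s u by (simp add: wave_front_def)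
  {
    fix m :: nat and t :: real and \<psi> :: "real \<Rightarrow> complex"
    assume m: "m \<notin> {0, 1}" and t: "t > 1 / (real m - 1)"
      and \<psi>: "\<psi> \<in> gelfand_shilov t (t * (real m - 1)) - {\<lambda>_. 0}"
    define s where "s = t * (real m - 1)"
    have m2: "m \<ge> 2" using m by (cases m) auto
    then have ts: "t > 0" "s > 1" "s + t = t * real m"
      using exponents[of "real m" t] t by (auto simp: s_def algebra_simps)
    have \<psi>': "\<psi> \<in> gelfand_shilov t s" "\<psi> \<noteq> (\<lambda>_. 0)" using \<psi> by (auto simp: s_def)
    let ?WF = "wave_front \<psi> t s (functional_of (\<lambda>x. exp (\<i> * complex_of_real (c * x ^ m))))"
    have "p \<in> {(x, c * real m * x ^ (m - 1)) | x. x \<noteq> 0}" if "p \<in> ?WF" for p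
    proof -
      obtain x \<xi> where p: "p = (x, \<xi>)" by (cases p)
      have \<xi>: "\<xi> = c * real m * x ^ (m - 1)"
        using power_chirp_not_in_wave_front[OF \<psi>'(1) ts, of \<xi> c x] that p by blast
      moreover have "x \<noteq> 0"
      proof
        assume "x = 0"
        \<comment> \<open>For exponents at least 2 the curve passes through the origin, which a wave
          front set excludes by definition.\<close>
        then have "p = (0, 0)" using m2 by (simp add: p \<xi> power_0_left)
        then show False using that nz by simp
      qed
      ultimately show ?thesis using p by blast
    qed
    moreover have "(x, c * real m * x ^ (m - 1)) \<in> ?WF" if "x \<noteq> 0" for x
      by (rule power_chirp_in_wave_front[OF \<psi>' ts that])
    ultimately show "wave_front \<psi> t (t * (real m - 1))
        (functional_of (\<lambda>x. exp (\<i> * complex_of_real (c * x ^ m))))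
      = {(x, c * real m * x ^ (m - 1)) | x. x \<noteq> 0}"
      unfolding s_def[symmetric] by blast
  }
  fix \<alpha> t :: real and \<psi> :: "real \<Rightarrow> complex"
  assume \<alpha>: "\<alpha> \<notin> {2 * real k | k::nat. True}" "\<alpha> > 1" and t: "t > 1 / (\<alpha> - 1)"
    and \<psi>: "\<psi> \<in> gelfand_shilov t (t * (\<alpha> - 1)) - {\<lambda>_. 0}"
  define s where "s = t * (\<alpha> - 1)"
  have ts: "t > 0" "s > 1" "s + t = t * \<alpha>"
    using exponents[of \<alpha> t] t \<alpha> by (auto simp: s_def algebra_simps)
  have \<psi>': "\<psi> \<in> gelfand_shilov t s" "\<psi> \<noteq> (\<lambda>_. 0)" using \<psi> by (auto simp: s_def)
  have \<alpha>0: "\<alpha> > 0" using \<alpha> by simp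
  let ?WF = "wave_front \<psi> t s (functional_of (\<lambda>x. exp (\<i> * complex_of_real (c * \<bar>x\<bar> powr \<alpha>))))"
  have "(0, \<xi>) \<in> ?WF" if "\<xi> \<noteq> 0" for \<xi>
    by (rule abs_chirp_origin_in_wave_front[OF \<psi>' ts(1,2) \<alpha>0 \<alpha>(1) assms that])
  then show "{0} \<times> (UNIV - {0}) \<subseteq> wave_front \<psi> t (t * (\<alpha> - 1))
      (functional_of (\<lambda>x. exp (\<i> * complex_of_real (c * \<bar>x\<bar> powr \<alpha>))))"
    unfolding s_def[symmetric] by auto
  have "p \<in> {(x, c * \<alpha> * sgn x * \<bar>x\<bar> powr (\<alpha> - 1)) | x. x \<noteq> 0} \<union> {0} \<times> (UNIV - {0})" if "p \<in> ?WF" for p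
  proof -
    obtain x \<xi> where p: "p = (x, \<xi>)" by (cases p)
    show ?thesis
    proof (cases "x = 0")
      case True
      then have "\<xi> \<noteq> 0" using that nz p by auto
      then show ?thesis using True p by simp
    next
      case False
      then have "\<xi> = c * \<alpha> * sgn x * \<bar>x\<bar> powr (\<alpha> - 1)"
        using abs_chirp_not_in_wave_front[OF \<psi>'(1) ts \<alpha>0 False, of \<xi> c] that p by blast
      then show ?thesis using False p by blast
    qed
  qed
  then show "wave_front \<psi> t (t * (\<alpha> - 1)) (functional_of (\<lambda>x. exp (\<i> * complex_of_real (c * \<bar>x\<bar> powr \<alpha>))))
      \<subseteq> {(x, c * \<alpha> * sgn x * \<bar>x\<bar> powr (\<alpha> - 1)) | x. x \<noteq> 0} \<union> {0} \<times> (UNIV - {0})"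
    unfolding s_def[symmetric] by (rule subsetI)
qed
end
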